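(* Let $\mu\in\mathbb{R}$ with $\mu\neq 0$, $\sigma>0$ and $t>0$, let $W=(W_s)_{s\ge 0}$ be a standard Brownian motion, and let $X_t=\int_0^t|\mu s+\sigma W_s|\,\mathrm{d}s$. Then for every $n\in\mathbb{N}=\{0,1,2,\dots\}$ the moment $M_{X_t}(n):=\mathbb{E}X_t^n$ is given by $$M_{X_t}(n)=\frac{(-1)^n\sigma^nt^{3n/2}\,n!\,e^{-\mu^2t/(2\sigma^2)}}{\sqrt{2^n}}\sum_{k=0}^{n}\tilde c^{(1)}_{n-k}\sum_{l=0}^{k}\sum_{i=0}^{l}\binom{l-k-1/2}{l-i}\Big(\frac32\Big)^{l}c^{(2)}_{k-l}\,\Sigma\Big(n,l,i\Big|\frac{\mu^2t}{2\sigma^2}\Big),$$ where the coefficients satisfy $$c^{(2)}_k=\frac{(-1)^k\,\Gamma(k+5/6)\,\Gamma(k+1/6)\,(3/4)^k}{2\pi\,k!},\qquad c^{(1)}_k=\frac{6k+1}{1-6k}\,c^{(2)}_k,\qquad k\in\mathbb{N},$$ $$\tilde c^{(1)}_0=1,\qquad \tilde c^{(1)}_k=-\sum_{m=1}^{k}c^{(1)}_m\,\tilde c^{(1)}_{k-m},\quad k\ge1,$$ and, for $0\le i\le l\le n$, $\Sigma(n,l,i|\mu^2t/(2\sigma^2))=S_i(1)$, where the functions $S_i(p)$ (depending also on $n$, $l$ and $\mu^2t/(2\sigma^2)$) are determined for $\mathrm{Re}\,p>0$ by the differential–difference equation $$S_0(p)=\frac{l!}{\Gamma(3n/2+1)}\;{}_2F_2\Big(\frac{l+1}{2},\frac{l}{2}+1;\frac12,\frac{3n}{2}+1\Big|\frac{\mu^2t}{2\sigma^2p}\Big),$$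 $$S_i(p)=\frac{\Gamma(2/3)}{i}\sum_{m=1}^{i}\frac{(m-i)\,S_{i-m}(p)-2mp\,S'_{i-m}(p)}{\Gamma(2/3-m)\,(m+1)!},\qquad i\ge1.$$
   Context: $\Gamma$ is the gamma function, and ${}_2F_2(a_1,a_2;b_1,b_2|z)=\sum_{r\ge0}\frac{(a_1)_r(a_2)_r}{(b_1)_r(b_2)_r}\frac{z^r}{r!}$ is the generalized hypergeometric function. For real $a$ and integer $r\ge0$, $\binom{a}{r}=a(a-1)\cdots(a-r+1)/r!$. $S'_i$ denotes the derivative with respect to $p$. *)

theory Defs
  imports "HOL-Probability.Probability"
begin

(* Only the values at times s >= 0 are constrained.  Every path (not just almost every one) is
   required to be continuous on [0,\<infinity>), so that time integrals along the paths are random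
   variables without assuming that M is complete. *)
locale standard_brownian_motion = prob_space M
  for M :: "'a measure" and W :: "real \<Rightarrow> 'a \<Rightarrow> real" +
  assumes random_variable: "\<And>s. 0 \<le> s \<Longrightarrow> W s \<in> borel_measurable M"
    and start_zero: "AE \<omega> in M. W 0 \<omega> = 0"
    and indep_increments: "\<And>(k::nat) \<tau>. 0 \<le> \<tau> 0 \<Longrightarrow> strict_mono_on {..k} \<tau> \<Longrightarrow>
      indep_vars (\<lambda>_. borel) (\<lambda>j \<omega>. W (\<tau> (Suc j)) \<omega> - W (\<tau> j) \<omega>) {..<k}"
    and normal_increments: "\<And>s u. 0 \<le> s \<Longrightarrow> s < u \<Longrightarrow>
      distributed M lborel (\<lambda>\<omega>. W u \<omega> - W s \<omega>) (normal_density 0 (sqrt (u - s)))"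
    and continuous_paths: "\<And>\<omega>. \<omega> \<in> space M \<Longrightarrow> continuous_on {0..} (\<lambda>s. W s \<omega>)"

definition abs_drift_integral ::
    "(real \<Rightarrow> 'a \<Rightarrow> real) \<Rightarrow> real \<Rightarrow> real \<Rightarrow> real \<Rightarrow> 'a \<Rightarrow> real" where
  "abs_drift_integral W \<mu> \<sigma> t \<omega> = integral {0..t} (\<lambda>s. \<bar>\<mu> * s + \<sigma> * W s \<omega>\<bar>)"

definition hypergeom_2F2 :: "complex \<Rightarrow> complex \<Rightarrow> complex \<Rightarrow> complex \<Rightarrow> complex \<Rightarrow> complex" where
  "hypergeom_2F2 a1 a2 b1 b2 z =
     (\<Sum>r. pochhammer a1 r * pochhammer a2 r / (pochhammer b1 r * pochhammer b2 r) * (z ^ r / fact r))"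

definition c2 :: "nat \<Rightarrow> real" where
  "c2 k = (-1) ^ k * Gamma (real k + 5/6) * Gamma (real k + 1/6) * (3/4) ^ k / (2 * pi * fact k)"

definition c1 :: "nat \<Rightarrow> real" where
  "c1 k = (6 * real k + 1) / (1 - 6 * real k) * c2 k"

fun c1_tilde :: "nat \<Rightarrow> real" where
  "c1_tilde k = (if k = 0 then 1 else - (\<Sum>m=1..k. c1 m * c1_tilde (k - m)))"

declare c1_tilde.simps [simp del]

(* S n l x i is the function S_i of the complex variable p, where x stands for \<mu>^2 t / (2 \<sigma>^2).
   The equations are only meaningful for Re p > 0; as S_(i-m)' at such a p depends only on values
   near p, values elsewhere have no influence. *)
fun S :: "nat \<Rightarrow> nat \<Rightarrow> real \<Rightarrow> nat \<Rightarrow> complex \<Rightarrow> complex" where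
  "S n l x i = (\<lambda>p.
     if i = 0 then
       fact l / Gamma (3 * of_nat n / 2 + 1) *
         hypergeom_2F2 ((of_nat l + 1) / 2) (of_nat l / 2 + 1) (1/2) (3 * of_nat n / 2 + 1)
           (of_real x / p)
     else
       Gamma (2/3) / of_nat i *
         (\<Sum>m=1..i. ((of_nat m - of_nat i) * S n l x (i - m) p
                       - 2 * of_nat m * p * deriv (S n l x (i - m)) p)
                     / (Gamma (2/3 - of_nat m) * fact (m + 1))))"

declare S.simps [simp del]

definition Sigma_coeff :: "nat \<Rightarrow> nat \<Rightarrow> nat \<Rightarrow> real \<Rightarrow> complex" where
  "Sigma_coeff n l i x = S n l x i 1"

end

theory Submission
  imports Defs "HOL-Real_Asymp.Real_Asymp"
begin

text \<open>
  Put \<open>\<nu> = \<mu>/\<sigma>\<close> and \<open>A\<^sub>t = \<integral>\<^sub>0\<^sup>t |W\<^sub>s + \<nu> s| ds\<close>. Since \<open>dA\<^sub>t = |W\<^sub>t + \<nu> t| dt\<close>, the Markov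
  property expresses \<open>E[A\<^sub>t\<^sup>n; W\<^sub>t + \<nu> t \<in> dy]\<close> through iterated integrals against the heat kernel,
  in which the drift only contributes the factor \<open>exp (\<nu> y - \<nu>\<^sup>2 t/2)\<close>. By Brownian scaling, a
  single value of the Laplace variable in \<open>t\<close> determines the moments of the driftless density
  against \<open>y\<^sup>2\<^sup>r\<close>; at the value \<open>1/2\<close> the heat kernel becomes \<open>exp (-|y|)\<close> and the iterated
  integrals become \<open>P\<^sub>n(|y|) exp (-|y|)\<close> with polynomials \<open>P\<^sub>n\<close> obeying
  \<open>P\<^sub>n' - P\<^sub>n''/2 = y P\<^sub>n\<^sub>-\<^sub>1\<close> and \<open>P\<^sub>n(0) = P\<^sub>n'(0)\<close> for \<open>n \<ge> 1\<close>, \<open>P\<^sub>0 = 1\<close>. Hence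
  \<open>\<integral>\<^sub>0\<^sup>\<infinity> y\<^sup>N P\<^sub>n(y) exp (-y) dy / N!\<close> is a polynomial in \<open>N\<close> satisfying a two-step recursion
  in \<open>N\<close>, and a polynomial that is 2-periodic is constant, so the recursion has only one such solution.

  Formally \<open>\<Sum>\<^sub>n (-\<delta>/2)\<^sup>n P\<^sub>n(y) exp (-y)\<close> is the decaying solution of \<open>G'' = (1 + \<delta> y) G\<close> with
  \<open>G'(0) = -1\<close>, an Airy function. Inserting its asymptotic expansion and substituting \<open>1 + \<delta> y = (1 + w)\<^sup>2\<^sup>/\<^sup>3\<close>,
  \<open>w = 3\<delta>s/2\<close>, turns the exponential into \<open>exp (-s)\<close>, and integrating termwise gives the
  coefficients of the theorem. Formal integration by parts shows that they solve the same recursion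
  and are polynomial in \<open>N\<close>.
\<close>

text \<open>Only even N enter the final formula, because the density is even and
  \<open>exp (\<nu> * y)\<close> may be replaced by cosh. Yet the recursion leads from level n and
  even N to level n - 1 and odd N, and the condition at y = 0 gives an initial value for N = 0 but
  none for N = 1. Polynomial dependence on N supplies the missing value; this is the reason for
  dividing by N! and for keeping both families of moments as explicit finite sums. The Airy
  expansion is divergent, so no Airy function appears: integration against exp (-s) is the linear
  map that replaces s^m by m!, and all identities are between coefficients of powers of \<delta>.
  The exponents come from the leading behaviour (1 + \<delta> y)^(-1/4) exp (-s) with s =
  (2/(3\<delta>)) ((1 + \<delta> y)^(3/2) - 1). Thus 1 + w = (1 + \<delta> y)^(3/2), dy/ds = (1 +
  w)^(-1/3), and term k of the expansion is \<open>c2 k\<close> \<delta>^k (1 + w)^(-1/6 - k) exp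
  (-s). The numbers \<open>c2\<close> and \<open>c1\<close> are the classical coefficients for Ai
  and its derivative, rescaled to powers of \<delta>.\<close>

unbundle no vec_syntax
unbundle fps_syntax

section \<open>Formal power series of the Airy expansion\<close>

text \<open>
  The series is \<open>(3/2) ((1 + w)\<^sup>2\<^sup>/\<^sup>3 - 1) / w\<close>, so that \<open>y = s chord_fps(w)\<close> in the substitution
  \<open>1 + \<delta> y = (1 + w)\<^sup>2\<^sup>/\<^sup>3\<close>, \<open>w = 3\<delta>s/2\<close>.
\<close>

definition chord_fps :: "real fps" where
  "chord_fps = Abs_fps (\<lambda>m. ((-1/3) gchoose m) / (real m + 1))"

lemma fps_nth_chord_fps [simp]: "chord_fps $ m = ((-1/3) gchoose m) / (real m + 1)"
  by (simp add: chord_fps_def)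

text \<open>This series is dy/ds: w times \<open>chord_fps\<close> is (3/2) ((1 + w)^(2/3) - 1),
  with derivative (1 + w)^(-1/3).\<close>

lemma chord_fps_deriv: "chord_fps + fps_X * fps_deriv chord_fps = fps_binomial (-1/3)"
proof (rule fps_ext)
  fix m show "(chord_fps + fps_X * fps_deriv chord_fps) $ m = fps_binomial (-1/3) $ m"
    by (cases m) (auto simp: divide_simps, auto simp: algebra_simps)
qed

lemma fps_binomial_two_thirds: "1 + fps_const (2/3) * (fps_X * chord_fps) = fps_binomial (2/3)"
proof (rule fps_ext)
  fix m show "(1 + fps_const (2/3) * (fps_X * chord_fps)) $ m = fps_binomial (2/3) $ m"
    using gbinomial_absorption[of "m - 1" "2/3::real"] by (cases m) (auto simp: field_simps)
qed

text \<open>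
  \<open>laplace_fps N g\<close> is the formal expansion of \<open>\<integral>\<^sub>0\<^sup>\<infinity> s\<^sup>N g(3\<delta>s/2) exp (-s) ds\<close> in powers of \<open>\<delta>\<close>.
\<close>

definition laplace_fps :: "nat \<Rightarrow> real fps \<Rightarrow> real fps" where
  "laplace_fps N g = Abs_fps (\<lambda>l. (3/2) ^ l * fact (N + l) * g $ l)"

lemma fps_nth_laplace_fps [simp]: "laplace_fps N g $ l = (3/2) ^ l * fact (N + l) * g $ l"
  by (simp add: laplace_fps_def)

lemma laplace_fps_add: "laplace_fps N (f + g) = laplace_fps N f + laplace_fps N g"
  by (rule fps_ext) (simp add: algebra_simps)

lemma laplace_fps_const_mult: "laplace_fps N (fps_const c * f) = fps_const c * laplace_fps N f"
  by (rule fps_ext) simp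

text \<open>The quantity 3\<delta>/2, which is w/s and also dw/ds, the chain-rule factor of a
  derivative in w.\<close>

definition \<theta> :: "real fps" where "\<theta> = fps_const (3/2) * fps_X"

lemma theta_laplace_fps: "\<theta> * laplace_fps (Suc N) g = laplace_fps N (fps_X * g)"
proof (rule fps_ext)
  fix m show "(\<theta> * laplace_fps (Suc N) g) $ m = laplace_fps N (fps_X * g) $ m"
    by (cases m) (auto simp: \<theta>_def mult.assoc)
qed

text \<open>Formal integration by parts against exp (-s); for N = 0 the boundary value at s = 0
  survives.\<close>

lemma laplace_fps_by_parts_0: "laplace_fps 0 g - \<theta> * laplace_fps 0 (fps_deriv g) = fps_const (g $ 0)"
proof (rule fps_ext)
  fix m show "(laplace_fps 0 g - \<theta> * laplace_fps 0 (fps_deriv g)) $ m = fps_const (g $ 0) $ m"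
    by (cases m) (auto simp: \<theta>_def mult.assoc)
qed

lemma laplace_fps_by_parts_Suc:
  "laplace_fps (Suc N) g - \<theta> * laplace_fps (Suc N) (fps_deriv g) = of_nat (Suc N) * laplace_fps N g"
proof (rule fps_ext)
  fix m show "(laplace_fps (Suc N) g - \<theta> * laplace_fps (Suc N) (fps_deriv g)) $ m = (of_nat (Suc N) * laplace_fps N g) $ m"
    by (cases m) (auto simp: \<theta>_def mult.assoc fps_mult_of_nat_nth, auto simp: field_simps)
qed

text \<open>Integration by parts in the variable y: s^N \<open>chord_fps ^ N\<close> is y^N and
  \<open>fps_binomial (-1/3)\<close> is dy/ds, so the left side integrates the differential of
  y^(N+1) against g exp (-s).\<close>

lemma laplace_fps_chord_by_parts:
  "of_nat (Suc N) * laplace_fps N (chord_fps ^ N * fps_binomial (-1/3) * g)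
    = laplace_fps (Suc N) (chord_fps ^ Suc N * g) - \<theta> * laplace_fps (Suc N) (chord_fps ^ Suc N * fps_deriv g)"
proof -
  have p: "fps_deriv (chord_fps ^ Suc N) = of_nat (Suc N) * (chord_fps ^ N * fps_deriv chord_fps)"
    by (simp only: fps_deriv_power' diff_Suc_1 mult_ac)
  have d: "fps_deriv (chord_fps ^ Suc N * g) =
      of_nat (Suc N) * (chord_fps ^ N * fps_deriv chord_fps * g) + chord_fps ^ Suc N * fps_deriv g"
    unfolding fps_deriv_mult p by (simp only: algebra_simps)
  have c: "laplace_fps m (of_nat k * f) = of_nat k * laplace_fps m f" for m k f
    using laplace_fps_const_mult[of m "of_nat k" f] by (simp add: fps_of_nat)
  have "laplace_fps (Suc N) (chord_fps ^ Suc N * g) - \<theta> * laplace_fps (Suc N) (chord_fps ^ Suc N * fps_deriv g)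
     = of_nat (Suc N) * laplace_fps N (chord_fps ^ Suc N * g) + \<theta> * (of_nat (Suc N) * laplace_fps (Suc N) (chord_fps ^ N * fps_deriv chord_fps * g))"
    using laplace_fps_by_parts_Suc[of N "chord_fps ^ Suc N * g"] unfolding d laplace_fps_add c by (simp add: algebra_simps)
  also have "\<dots> = of_nat (Suc N) * (laplace_fps N (chord_fps ^ Suc N * g) + \<theta> * laplace_fps (Suc N) (chord_fps ^ N * fps_deriv chord_fps * g))"
    by (simp add: algebra_simps)
  also have "laplace_fps N (chord_fps ^ Suc N * g) + \<theta> * laplace_fps (Suc N) (chord_fps ^ N * fps_deriv chord_fps * g)
     = laplace_fps N (chord_fps ^ N * (chord_fps + fps_X * fps_deriv chord_fps) * g)"
    by (simp add: theta_laplace_fps laplace_fps_add[symmetric] algebra_simps)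
  finally show ?thesis by (simp add: chord_fps_deriv)
qed

lemma fps_deriv_binomial: "fps_deriv (fps_binomial c) = fps_const c * fps_binomial (c - 1 :: real)"
proof (rule fps_ext)
  fix m show "fps_deriv (fps_binomial c) $ m = (fps_const c * fps_binomial (c - 1)) $ m"
    using gbinomial_absorption[of m c] by (simp add: algebra_simps)
qed

section \<open>Recurrences of the Airy coefficients\<close>

text \<open>Euler's reflection formula at 1/6, where the sine is 1/2; the 2\<pi> in
  \<open>c2\<close> is the normalisation to leading coefficient 1.\<close>

lemma c2_0: "c2 0 = 1"
proof -
  have "Gamma (1/6 :: real) * Gamma (1 - 1/6) = pi / sin (pi * (1/6))"
  proof -
    have "complex_of_real (Gamma (1/6) * Gamma (1 - 1/6)) = Gamma (of_real (1/6)) * Gamma (1 - of_real (1/6))"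
      unfolding of_real_mult Gamma_complex_of_real[symmetric] by simp
    also have "\<dots> = of_real pi / sin (of_real pi * of_real (1/6))"
      by (rule Gamma_reflection_complex)
    also have "\<dots> = of_real (pi / sin (pi * (1/6)))"
      by (simp only: of_real_mult sin_of_real[symmetric] of_real_divide)
    finally show ?thesis unfolding of_real_eq_iff .
  qed
  also have "sin (pi * (1/6)) = 1/2" using sin_30 by simp
  finally show ?thesis by (simp add: c2_def mult.commute)
qed

text \<open>This is what makes the expansion a formal solution of the Airy equation: it cancels the
  errors of consecutive terms in \<open>c2_series_telescope\<close>.\<close>

lemma c2_Suc: "(real k + 1) * c2 (Suc k) = - (3/4) * (real k + 1/6) * (real k + 5/6) * c2 k"
proof -
  have g1: "Gamma (real k + 1 + 5/6) = (real k + 5/6) * Gamma (real k + 5/6)"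
    using Gamma_plus1[of "real k + 5/6"] nonpos_Ints_nonpos[of "real k + 5/6"] by (auto simp: add_ac)
  have g2: "Gamma (real k + 1 + 1/6) = (real k + 1/6) * Gamma (real k + 1/6)"
    using Gamma_plus1[of "real k + 1/6"] nonpos_Ints_nonpos[of "real k + 1/6"] by (auto simp: add_ac)
  show ?thesis
    unfolding c2_def of_nat_Suc add.commute[of 1] g1 g2 by (simp add: divide_simps) (auto simp: algebra_simps)
qed

lemma c1_0: "c1 0 = 1" by (simp add: c1_def c2_0)

text \<open>The derivative of term k at y = 0 is -(1 + (k + 1/6) \<open>\<theta>\<close>) times its
  coefficient, so the right side is a coefficient of -G'(0); \<open>c1\<close> is therefore the
  expansion of -G'(0).\<close>

lemma c1_Suc: "c1 (Suc k) = c2 (Suc k) + 3/2 * (real k + 1/6) * c2 k"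
proof -
  have "(1 - 6 * real (Suc k)) * (c2 (Suc k) + 3/2 * (real k + 1/6) * c2 k)
      = (1 - 6 * real (Suc k)) * c2 (Suc k) + 12 * (- (3/4) * (real k + 1/6) * (real k + 5/6) * c2 k)"
    by (simp add: field_simps)
  also have "\<dots> = (6 * real (Suc k) + 1) * c2 (Suc k)"
    unfolding c2_Suc[symmetric] by (simp add: algebra_simps)
  finally have "(1 - 6 * real (Suc k)) * (c2 (Suc k) + 3/2 * (real k + 1/6) * c2 k)
      = (6 * real (Suc k) + 1) * c2 (Suc k)" .
  thus ?thesis by (simp only: c1_def) (simp add: divide_simps mult.commute)
qed

section \<open>Termwise integration of the Airy expansion\<close>

text \<open>Term k integrated against y^N. The exponent is -1/6 - k from the term plus -1/3 from
  dy/ds.\<close>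

definition airy_term :: "nat \<Rightarrow> nat \<Rightarrow> real fps" where
  "airy_term N k = laplace_fps N (chord_fps ^ N * fps_binomial (- 1/2 - real k))"

text \<open>A single term does not solve G'' = (1 + \<delta> y) G. Its two errors have exponents
  -1/2 - k and -3/2 - k; with the -1/3 of dy/ds they take this form for k and for k + 1.\<close>

definition airy_remainder :: "nat \<Rightarrow> nat \<Rightarrow> real fps" where
  "airy_remainder N k = laplace_fps N (chord_fps ^ N * fps_binomial (- 5/6 - real k))"

text \<open>Multiplication by 1 + \<delta> y = (1 + w)^(2/3) raises the exponent by 2/3.\<close>

lemma airy_term_plus: "airy_term N k + fps_X * airy_term (Suc N) k = laplace_fps N (chord_fps ^ N * fps_binomial (1/6 - real k))"
proof -
  have "fps_binomial (1/6 - real k) = fps_binomial (2/3) * fps_binomial (- 1/2 - real k)"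
    by (simp add: fps_binomial_add_mult[symmetric])
  also have "chord_fps ^ N * \<dots> = chord_fps ^ N * fps_binomial (- 1/2 - real k)
      + fps_const (2/3) * (fps_X * (chord_fps ^ Suc N * fps_binomial (- 1/2 - real k)))"
    by (simp add: fps_binomial_two_thirds[symmetric] algebra_simps)
  also have "laplace_fps N \<dots> = airy_term N k + fps_const (2/3) * \<theta> * airy_term (Suc N) k"
    by (simp add: laplace_fps_add laplace_fps_const_mult theta_laplace_fps[symmetric] airy_term_def mult.assoc)
  also have "fps_const (2/3) * \<theta> = fps_X"
    by (simp add: \<theta>_def mult.assoc[symmetric])
  finally show ?thesis by simp
qed

text \<open>Two integrations by parts move two y-derivatives from y^(N+2) to G_k = (1 + w)^(-1/6 -
  k) exp (-s). As d/dy = (1 + w)^(1/3) d/ds, the second derivative of G_k is (1 + \<delta> y) G_k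
  plus errors. Those of first order in \<delta> carry -(1/6 - k) and 1/6 + k times 3/2, in total
  3k.\<close>

lemma airy_term_rec:
  "of_nat (Suc (Suc N)) * of_nat (Suc N) * airy_term N k = airy_term (Suc (Suc N)) k + fps_X * airy_term (Suc (Suc (Suc N))) k
     + fps_const (3 * real k) * (fps_X * airy_remainder (Suc (Suc N)) k)
     + fps_const (9/4 * (real k + 1/6) * (real k + 5/6)) * (fps_X ^ 2 * airy_remainder (Suc (Suc N)) (Suc k))"
proof -
  let ?b = "fps_binomial :: real \<Rightarrow> real fps" and ?N = "Suc (Suc N)"
  have mul: "?b a * ?b b = ?b c" if "a + b = c" for a b c
    using that by (simp add: fps_binomial_add_mult[symmetric])
  have s1: "of_nat (Suc N) * airy_term N k = laplace_fps (Suc N) (chord_fps ^ Suc N * ?b (-1/6 - real k))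
     - fps_const (-1/6 - real k) * (\<theta> * laplace_fps (Suc N) (chord_fps ^ Suc N * ?b (-7/6 - real k)))"
  proof -
    have a: "airy_term N k = laplace_fps N (chord_fps ^ N * ?b (-1/3) * ?b (-1/6 - real k))"
      by (simp add: airy_term_def mult.assoc mul)
    have b: "chord_fps ^ Suc N * fps_deriv (?b (-1/6 - real k)) = fps_const (-1/6 - real k) * (chord_fps ^ Suc N * ?b (-7/6 - real k))"
      by (simp only: fps_deriv_binomial mult.left_commute) (simp add: field_simps)
    show ?thesis
      unfolding a laplace_fps_chord_by_parts b laplace_fps_const_mult by (simp only: mult.left_commute)
  qed
  have s2: "of_nat ?N * laplace_fps (Suc N) (chord_fps ^ Suc N * ?b a) = laplace_fps ?N (chord_fps ^ ?N * ?b (a + 1/3))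
     - fps_const (a + 1/3) * (\<theta> * laplace_fps ?N (chord_fps ^ ?N * ?b (a - 2/3)))" for a
  proof -
    have "laplace_fps (Suc N) (chord_fps ^ Suc N * ?b a) = laplace_fps (Suc N) (chord_fps ^ Suc N * ?b (-1/3) * ?b (a + 1/3))"
      by (simp add: mult.assoc mul)
    thus ?thesis
      using laplace_fps_chord_by_parts[of "Suc N" "?b (a + 1/3)"]
      by (simp add: fps_deriv_binomial laplace_fps_const_mult mult.left_commute[of _ "fps_const _"])
  qed
  have "of_nat ?N * of_nat (Suc N) * airy_term N k =
       of_nat ?N * laplace_fps (Suc N) (chord_fps ^ Suc N * ?b (-1/6 - real k))
     - fps_const (-1/6 - real k) * (\<theta> * (of_nat ?N * laplace_fps (Suc N) (chord_fps ^ Suc N * ?b (-7/6 - real k))))"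
    unfolding mult.assoc s1 right_diff_distrib by (simp only: mult_ac)
  also have "\<dots> = laplace_fps ?N (chord_fps ^ ?N * ?b (1/6 - real k))
     - fps_const (1/6 - real k) * (\<theta> * airy_remainder ?N k)
     - fps_const (-1/6 - real k) * (\<theta> * airy_remainder ?N k)
     + fps_const (-1/6 - real k) * (fps_const (-5/6 - real k) * (\<theta> * \<theta> * airy_remainder ?N (Suc k)))"
  proof -
    have "-1/6 - real k + 1/3 = 1/6 - real k" "-7/6 - real k + 1/3 = -5/6 - real k"
      "-1/6 - real k - 2/3 = -5/6 - real k" "-7/6 - real k - 2/3 = -5/6 - real (Suc k)"
      by auto
    thus ?thesis unfolding s2 airy_remainder_def by (simp only: right_diff_distrib diff_diff_eq2 mult_ac add_ac)
        (simp only: add_diff_eq)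
  qed
  also have "\<dots> = laplace_fps ?N (chord_fps ^ ?N * ?b (1/6 - real k))
     - fps_const ((1/6 - real k) * (3/2)) * (fps_X * airy_remainder ?N k)
     - fps_const ((-1/6 - real k) * (3/2)) * (fps_X * airy_remainder ?N k)
     + fps_const ((-1/6 - real k) * (-5/6 - real k) * (9/4)) * (fps_X ^ 2 * airy_remainder ?N (Suc k))"
    unfolding \<theta>_def fps_const_mult[symmetric] power2_eq_square by (simp only: mult_ac) (simp add: mult_ac)
  also have "fps_const ((-1/6 - real k) * (-5/6 - real k) * (9/4)) = fps_const (9/4 * (real k + 1/6) * (real k + 5/6))"
    by (simp add: algebra_simps)
  also have "laplace_fps ?N (chord_fps ^ ?N * ?b (1/6 - real k))
     - fps_const ((1/6 - real k) * (3/2)) * (fps_X * airy_remainder ?N k)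
     - fps_const ((-1/6 - real k) * (3/2)) * (fps_X * airy_remainder ?N k)
    = laplace_fps ?N (chord_fps ^ ?N * ?b (1/6 - real k)) +
      (- fps_const ((1/6 - real k) * (3/2)) - fps_const ((-1/6 - real k) * (3/2))) * (fps_X * airy_remainder ?N k)"
    by (simp only: distrib_right diff_conv_add_uminus add.assoc mult_minus_left)
  also have "- fps_const ((1/6 - real k) * (3/2)) - fps_const ((-1/6 - real k) * (3/2)) = fps_const (3 * real k)"
    by (rule fps_ext) (simp add: field_simps)
  finally show ?thesis unfolding airy_term_plus[symmetric] .
qed

text \<open>The formal sum over k of \<open>c2 k\<close> \<delta>^k \<open>f k\<close>.\<close>

definition c2_series :: "(nat \<Rightarrow> real fps) \<Rightarrow> real fps" where
  "c2_series f = Abs_fps (\<lambda>n. \<Sum>k\<le>n. c2 k * f k $ (n - k))"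

lemma c2_series_nth: "c2_series f $ n = (\<Sum>k\<le>n. c2 k * f k $ (n - k))"
  by (simp add: c2_series_def)

lemma c2_series_add: "c2_series (\<lambda>k. f k + g k) = c2_series f + c2_series g"
  by (rule fps_ext) (simp add: c2_series_nth algebra_simps sum.distrib)

lemma c2_series_const_mult: "c2_series (\<lambda>k. fps_const a * f k) = fps_const a * c2_series f"
  by (rule fps_ext) (simp add: c2_series_nth sum_distrib_left algebra_simps)

lemma c2_series_X_mult: "c2_series (\<lambda>k. fps_X * f k) = fps_X * c2_series f"
proof (rule fps_ext)
  fix n show "c2_series (\<lambda>k. fps_X * f k) $ n = (fps_X * c2_series f) $ n"
    by (cases n) (auto simp: c2_series_nth Suc_diff_le intro!: sum.cong)
qed

text \<open>The second error of term k and the first error of term k + 1 involve the same series,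
  and \<open>c2_Suc\<close> makes their factors opposite. The first error of term 0 vanishes because
  of the factor k.\<close>

lemma c2_series_telescope:
  "c2_series (\<lambda>k. fps_const (3 * real k) * (fps_X * f k)
     + fps_const (9/4 * (real k + 1/6) * (real k + 5/6)) * (fps_X ^ 2 * f (Suc k))) = 0"
proof (rule fps_ext)
  fix n
  have X2: "(fps_X ^ 2 * g) $ Suc (Suc m) = g $ m" "(fps_X ^ 2 * g) $ 0 = 0" "(fps_X ^ 2 * g) $ Suc 0 = 0" for g :: "real fps" and m
    by (simp_all add: power2_eq_square mult.assoc)
  have a: "(\<Sum>k\<le>n. c2 k * (3 * real k * (fps_X * f k) $ (n - k)))
     = (\<Sum>k<n. c2 (Suc k) * (3 * real (Suc k) * (fps_X * f (Suc k)) $ (n - Suc k)))"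
    by (subst lessThan_Suc_atMost[symmetric], subst sum.lessThan_Suc_shift) simp
  have "c2 (Suc k) * (3 * real (Suc k) * (fps_X * f (Suc k)) $ (n - Suc k))
      + c2 k * (9/4 * (real k + 1/6) * (real k + 5/6) * (fps_X ^ 2 * f (Suc k)) $ (n - k)) = 0" if "k < n" for k
  proof -
    have e: "(fps_X ^ 2 * f (Suc k)) $ (n - k) = (fps_X * f (Suc k)) $ (n - Suc k)"
    proof -
      have "n - k = Suc (n - Suc k)" using that by simp
      thus ?thesis by (cases "n - Suc k") (simp_all add: X2)
    qed
    have "c2 (Suc k) * (3 * real (Suc k) * u) + c2 k * (9/4 * (real k + 1/6) * (real k + 5/6) * u) =
      3 * u * ((real k + 1) * c2 (Suc k) - (- (3/4) * (real k + 1/6) * (real k + 5/6) * c2 k))" for u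
      by (simp add: algebra_simps)
    thus ?thesis unfolding e c2_Suc by simp
  qed
  hence "(\<Sum>k<n. c2 (Suc k) * (3 * real (Suc k) * (fps_X * f (Suc k)) $ (n - Suc k))
      + c2 k * (9/4 * (real k + 1/6) * (real k + 5/6) * (fps_X ^ 2 * f (Suc k)) $ (n - k))) = 0"
    by (intro sum.neutral) auto
  moreover have "(\<Sum>k\<le>n. c2 k * (9/4 * (real k + 1/6) * (real k + 5/6) * (fps_X ^ 2 * f (Suc k)) $ (n - k)))
     = (\<Sum>k<n. c2 k * (9/4 * (real k + 1/6) * (real k + 5/6) * (fps_X ^ 2 * f (Suc k)) $ (n - k)))"
    by (simp add: lessThan_Suc_atMost[symmetric] X2)
  moreover have "c2_series (\<lambda>k. fps_const (3 * real k) * (fps_X * f k)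
     + fps_const (9/4 * (real k + 1/6) * (real k + 5/6)) * (fps_X ^ 2 * f (Suc k))) $ n
     = (\<Sum>k\<le>n. c2 k * (3 * real k * (fps_X * f k) $ (n - k)))
     + (\<Sum>k\<le>n. c2 k * (9/4 * (real k + 1/6) * (real k + 5/6) * (fps_X ^ 2 * f (Suc k)) $ (n - k)))"
    by (simp only: c2_series_nth fps_add_nth fps_mult_left_const_nth distrib_left[of "c2 _"] sum.distrib)
  ultimately show "c2_series (\<lambda>k. fps_const (3 * real k) * (fps_X * f k)
     + fps_const (9/4 * (real k + 1/6) * (real k + 5/6)) * (fps_X ^ 2 * f (Suc k))) $ n = 0 $ n"
    unfolding a by (simp only: sum.distrib fps_zero_nth)
qed

lemma c2_series_airy_term_rec:
  "of_nat (Suc (Suc N)) * of_nat (Suc N) * c2_series (airy_term N)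
     = c2_series (airy_term (Suc (Suc N))) + fps_X * c2_series (airy_term (Suc (Suc (Suc N))))"
proof -
  have "of_nat (Suc (Suc N)) * of_nat (Suc N) * c2_series (airy_term N)
      = c2_series (\<lambda>k. of_nat (Suc (Suc N)) * of_nat (Suc N) * airy_term N k)"
    using c2_series_const_mult[of "real (Suc (Suc N) * Suc N)" "airy_term N"] by (simp only: fps_of_nat of_nat_mult fps_const_mult[symmetric])
  also have "\<dots> = c2_series (\<lambda>k. airy_term (Suc (Suc N)) k + (fps_X * airy_term (Suc (Suc (Suc N))) k +
     (fps_const (3 * real k) * (fps_X * airy_remainder (Suc (Suc N)) k)
     + fps_const (9/4 * (real k + 1/6) * (real k + 5/6)) * (fps_X ^ 2 * airy_remainder (Suc (Suc N)) (Suc k)))))"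
    unfolding airy_term_rec by (simp only: add.assoc)
  also have "\<dots> = c2_series (airy_term (Suc (Suc N))) + fps_X * c2_series (airy_term (Suc (Suc (Suc N))))"
    unfolding c2_series_add[of "airy_term _"] unfolding c2_series_add[of "\<lambda>k. fps_X * airy_term _ k"] c2_series_telescope c2_series_X_mult by simp
  finally show ?thesis .
qed

text \<open>The integral of G'' = (1 + \<delta> y) G over the half-line is -G'(0), whose expansion
  is \<open>c1\<close>.\<close>

lemma c2_series_airy_term_0: "c2_series (airy_term 0) + fps_X * c2_series (airy_term 1) = Abs_fps c1"
proof -
  let ?b = "fps_binomial :: real \<Rightarrow> real fps"
  have J0: "laplace_fps 0 g = fps_const (g $ 0) + \<theta> * laplace_fps 0 (fps_deriv g)" for g
    using laplace_fps_by_parts_0[of g] by (simp add: algebra_simps)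
  \<comment> \<open>For the single term G_k the integral of the second derivative is minus its first
    derivative at 0, that is 1 + (k + 1/6) \<open>\<theta>\<close>; the errors are those of
    \<open>airy_term_rec\<close>.\<close>
  have "airy_term 0 k + fps_X * airy_term 1 k + (fps_const (3 * real k) * (fps_X * airy_remainder 0 k)
     + fps_const (9/4 * (real k + 1/6) * (real k + 5/6)) * (fps_X ^ 2 * airy_remainder 0 (Suc k)))
     = 1 + fps_const (real k + 1/6) * \<theta>" for k
  proof -
    have "airy_term 0 k + fps_X * airy_term 1 k = laplace_fps 0 (?b (1/6 - real k))"
      using airy_term_plus[of 0 k] by simp
    also have "\<dots> = 1 + fps_const (1/6 - real k) * (\<theta> * airy_remainder 0 k)"
      by (subst J0) (simp add: fps_deriv_binomial laplace_fps_const_mult airy_remainder_def mult.left_commute)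
    finally have 1: "airy_term 0 k + fps_X * airy_term 1 k = 1 + fps_const (1/6 - real k) * (\<theta> * airy_remainder 0 k)" .
    have 2: "airy_remainder 0 k = 1 + fps_const (-5/6 - real k) * (\<theta> * airy_remainder 0 (Suc k))"
      unfolding airy_remainder_def by (subst J0) (simp add: fps_deriv_binomial laplace_fps_const_mult mult.left_commute algebra_simps)
    have c3: "fps_const (3 * real k) * fps_X = fps_const (2 * real k) * \<theta>"
      by (simp add: \<theta>_def mult.assoc[symmetric])
    have c4: "fps_const (9/4 * (real k + 1/6) * (real k + 5/6)) * fps_X ^ 2
       = fps_const (- real k - 1/6) * \<theta> * (fps_const (-5/6 - real k) * \<theta>)"
    proof -
      have "fps_const (9/4 * (real k + 1/6) * (real k + 5/6)) = fps_const (- real k - 1/6) * fps_const (3/2) * (fps_const (-5/6 - real k) * fps_const (3/2))"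
        by (rule fps_ext) (simp add: field_simps)
      thus ?thesis by (simp only: \<theta>_def power2_eq_square mult_ac)
    qed
    have "airy_term 0 k + fps_X * airy_term 1 k + (fps_const (3 * real k) * (fps_X * airy_remainder 0 k)
     + fps_const (9/4 * (real k + 1/6) * (real k + 5/6)) * (fps_X ^ 2 * airy_remainder 0 (Suc k)))
     = 1 + fps_const (1/6 - real k) * (\<theta> * airy_remainder 0 k) + fps_const (2 * real k) * (\<theta> * airy_remainder 0 k)
       + fps_const (- real k - 1/6) * (\<theta> * (fps_const (-5/6 - real k) * (\<theta> * airy_remainder 0 (Suc k))))"
      unfolding 1 mult.assoc[symmetric] c3 c4 by (simp only: add.assoc)
    also have "fps_const (-5/6 - real k) * (\<theta> * airy_remainder 0 (Suc k)) = airy_remainder 0 k - 1"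
      using 2 by simp
    also have "1 + fps_const (1/6 - real k) * (\<theta> * airy_remainder 0 k) + fps_const (2 * real k) * (\<theta> * airy_remainder 0 k)
       + fps_const (- real k - 1/6) * (\<theta> * (airy_remainder 0 k - 1)) = 1 - fps_const (- real k - 1/6) * \<theta> +
        (fps_const (1/6 - real k) + fps_const (2 * real k) + fps_const (- real k - 1/6)) * (\<theta> * airy_remainder 0 k)"
      by (simp only: algebra_simps mult_1)
    also have "fps_const (1/6 - real k) + fps_const (2 * real k) + fps_const (- real k - 1/6) = 0"
      by simp
    also have "1 - fps_const (- real k - 1/6) * \<theta> + 0 * (\<theta> * airy_remainder 0 k) = 1 + fps_const (real k + 1/6) * \<theta>"
    proof -
      have "fps_const (real k + 1/6) = - fps_const (- real k - 1/6)" by simp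
      thus ?thesis by (simp only: mult_minus_left) simp
    qed
    finally show ?thesis by (simp only: add.assoc)
  qed
  hence "c2_series (\<lambda>k. airy_term 0 k + (fps_X * airy_term 1 k + (fps_const (3 * real k) * (fps_X * airy_remainder 0 k)
     + fps_const (9/4 * (real k + 1/6) * (real k + 5/6)) * (fps_X ^ 2 * airy_remainder 0 (Suc k)))))
     = c2_series (\<lambda>k. 1 + fps_const (real k + 1/6) * \<theta>)"
    by (simp only: add.assoc)
  hence "c2_series (airy_term 0) + fps_X * c2_series (airy_term 1) = c2_series (\<lambda>k. 1 + fps_const (real k + 1/6) * \<theta>)"
    unfolding c2_series_add[of "airy_term _"] unfolding c2_series_add[of "\<lambda>k. fps_X * airy_term _ k"] c2_series_telescope c2_series_X_mult by simp
  also have "\<dots> = Abs_fps c1"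
  proof (rule fps_ext)
    fix n
    show "c2_series (\<lambda>k. 1 + fps_const (real k + 1/6) * \<theta>) $ n = Abs_fps c1 $ n"
    proof (cases n)
      case 0 thus ?thesis by (simp add: c2_series_nth c2_0 c1_0 \<theta>_def)
    next
      case (Suc m)
      have "c2_series (\<lambda>k. 1 + fps_const (real k + 1/6) * \<theta>) $ n =
         (\<Sum>k\<le>n. if k = n then c2 k else if k = m then 3/2 * (real k + 1/6) * c2 k else 0)"
        unfolding c2_series_nth
        by (intro sum.cong refl) (auto simp: \<theta>_def Suc fps_X_def algebra_simps)
      also have "\<dots> = c2 n + 3/2 * (real m + 1/6) * c2 m"
        by (simp add: Suc lessThan_Suc_atMost[symmetric] sum.delta')
      finally show ?thesis by (simp add: Suc c1_Suc)
    qed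
  qed
  finally show ?thesis .
qed

lemma c1_tilde_c1: "Abs_fps c1_tilde * Abs_fps c1 = 1"
proof (rule fps_ext)
  fix n
  show "(Abs_fps c1_tilde * Abs_fps c1) $ n = 1 $ n"
  proof (cases n)
    case 0 thus ?thesis by (simp add: c1_tilde.simps[of 0] c1_0)
  next
    case (Suc m)
    have "(Abs_fps c1_tilde * Abs_fps c1) $ n = (\<Sum>i=0..n. c1 i * c1_tilde (n - i))"
      by (subst mult.commute) (simp add: fps_mult_nth)
    also have "\<dots> = c1_tilde n + (\<Sum>i=1..n. c1 i * c1_tilde (n - i))"
      by (simp add: sum.atLeast_Suc_atMost c1_0)
    also have "c1_tilde n = - (\<Sum>i=1..n. c1 i * c1_tilde (n - i))"
      using Suc by (subst c1_tilde.simps) simp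
    finally show ?thesis using Suc by simp
  qed
qed

text \<open>
  The factor \<open>c1_tilde\<close> normalises the formal Airy solution to have derivative \<open>-1\<close> at \<open>0\<close>.
\<close>

definition airy_moment :: "nat \<Rightarrow> real fps" where
  "airy_moment N = Abs_fps c1_tilde * c2_series (airy_term N)"

text \<open>The integral of G'' = (1 + \<delta> y) G for the solution with G'(0) = -1. Tested
  against y^(N+2), the same equation yields \<open>airy_moment_rec\<close>.\<close>

lemma airy_moment_0: "airy_moment 0 + fps_X * airy_moment 1 = 1"
proof -
  have "airy_moment 0 + fps_X * airy_moment 1 = Abs_fps c1_tilde * (c2_series (airy_term 0) + fps_X * c2_series (airy_term 1))"
    by (simp add: airy_moment_def algebra_simps)
  thus ?thesis by (simp only: c2_series_airy_term_0 c1_tilde_c1)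
qed

lemma airy_moment_rec: "airy_moment (Suc (Suc N)) + fps_X * airy_moment (Suc (Suc (Suc N))) = of_nat (Suc (Suc N)) * of_nat (Suc N) * airy_moment N"
proof -
  have "airy_moment (Suc (Suc N)) + fps_X * airy_moment (Suc (Suc (Suc N))) = Abs_fps c1_tilde * (of_nat (Suc (Suc N)) * of_nat (Suc N) * c2_series (airy_term N))"
    unfolding c2_series_airy_term_rec by (simp add: airy_moment_def algebra_simps)
  thus ?thesis by (simp add: airy_moment_def mult_ac)
qed

text \<open>Expanding the products gives the triple sum of the theorem. The Airy index is k - l,
  whence the upper entry -1/2 - (k - l) of the binomial. Only the last factor depends on N, which
  becomes 2r and is summed over at the end.\<close>

lemma airy_moment_nth: "airy_moment N $ n = (\<Sum>k=0..n. c1_tilde (n - k) * (\<Sum>l=0..k. \<Sum>i=0..l.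
    ((real l - real k - 1/2) gchoose (l - i)) * (3/2) ^ l * c2 (k - l) * (fact (N + l) * (chord_fps ^ N) $ i)))"
proof -
  have "airy_moment N $ n = (\<Sum>k=0..n. c1_tilde (n - k) * c2_series (airy_term N) $ k)"
    unfolding airy_moment_def by (subst mult.commute, subst fps_mult_nth) (simp add: mult.commute)
  also have "\<dots> = (\<Sum>k=0..n. c1_tilde (n - k) * (\<Sum>l=0..k. \<Sum>i=0..l.
    ((real l - real k - 1/2) gchoose (l - i)) * (3/2) ^ l * c2 (k - l) * (fact (N + l) * (chord_fps ^ N) $ i)))"
  proof (intro sum.cong refl arg_cong2[of _ _ _ _ "(*)"])
    fix k
    have "c2_series (airy_term N) $ k = (\<Sum>l=0..k. c2 (k - l) * airy_term N (k - l) $ l)"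
      unfolding c2_series_nth atMost_atLeast0
      by (subst sum.atLeastAtMost_rev) (auto intro!: sum.cong)
    also have "\<dots> = (\<Sum>l=0..k. \<Sum>i=0..l.
      ((real l - real k - 1/2) gchoose (l - i)) * (3/2) ^ l * c2 (k - l) * (fact (N + l) * (chord_fps ^ N) $ i))"
    proof (intro sum.cong refl)
      fix l assume "l \<in> {0..k}"
      hence "airy_term N (k - l) $ l = (3/2) ^ l * fact (N + l) *
          (\<Sum>i=0..l. (chord_fps ^ N) $ i * ((real l - real k - 1/2) gchoose (l - i)))"
        by (simp add: airy_term_def fps_mult_nth of_nat_diff algebra_simps)
      thus "c2 (k - l) * airy_term N (k - l) $ l = (\<Sum>i=0..l.
        ((real l - real k - 1/2) gchoose (l - i)) * (3/2) ^ l * c2 (k - l) * (fact (N + l) * (chord_fps ^ N) $ i))"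
        by (simp add: sum_distrib_left mult_ac)
    qed
    finally show "c2_series (airy_term N) $ k = (\<Sum>l=0..k. \<Sum>i=0..l.
      ((real l - real k - 1/2) gchoose (l - i)) * (3/2) ^ l * c2 (k - l) * (fact (N + l) * (chord_fps ^ N) $ i))" .
  qed
  finally show ?thesis .
qed

section \<open>Uniqueness of polynomial solutions of the moment recursion\<close>

text \<open>Miller's recurrence for powers of a series, read off from F (F^N)' = N F' F^N. It shows
  that the coefficients of F^N are polynomials in N, and for N = 2r it becomes the recursion of the
  S_i.\<close>

lemma fps_power_rec:
  fixes F :: "real fps"
  assumes "F $ 0 = 1"
  shows "real i * (F ^ N) $ i = (\<Sum>m=1..i. (real m * (real N + 1) - real i) * F $ m * (F ^ N) $ (i - m))"
proof -
  have "F * (fps_X * fps_deriv (F ^ N)) = of_nat N * ((fps_X * fps_deriv F) * F ^ N)"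
  proof (cases N)
    case (Suc n)
    show ?thesis unfolding Suc fps_deriv_power' diff_Suc_1 by (simp only: power_Suc mult_ac)
  qed simp
  hence 1: "(F * (fps_X * fps_deriv (F ^ N))) $ i = (of_nat N * ((fps_X * fps_deriv F) * F ^ N)) $ i"
    by (rule arg_cong)
  have X: "(fps_X * fps_deriv G) $ j = real j * G $ j" for G :: "real fps" and j
    by (cases j) auto
  have "(\<Sum>m=0..i. F $ m * (real (i - m) * (F ^ N) $ (i - m)))
     = (\<Sum>m=0..i. real N * (real m * F $ m * (F ^ N) $ (i - m)))"
    using 1 unfolding fps_mult_nth[of F "fps_X * _"] fps_mult_of_nat_nth
      fps_mult_nth[of "fps_X * fps_deriv F"] X sum_distrib_left by (simp only: mult.assoc)
  hence "real i * (F ^ N) $ i + (\<Sum>m=1..i. F $ m * (real (i - m) * (F ^ N) $ (i - m)))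
     = (\<Sum>m=1..i. real N * (real m * F $ m * (F ^ N) $ (i - m)))"
    by (simp add: sum.atLeast_Suc_atMost assms)
  hence "real i * (F ^ N) $ i = (\<Sum>m=1..i. real N * (real m * F $ m * (F ^ N) $ (i - m)) - F $ m * (real (i - m) * (F ^ N) $ (i - m)))"
    by (simp add: sum_subtractf)
  also have "\<dots> = (\<Sum>m=1..i. (real m * (real N + 1) - real i) * F $ m * (F ^ N) $ (i - m))"
    by (intro sum.cong refl) (auto simp: of_nat_diff algebra_simps)
  finally show ?thesis .
qed

section \<open>Polynomial dependence on N\<close>

definition is_poly :: "(nat \<Rightarrow> real) \<Rightarrow> bool" where
  "is_poly f \<longleftrightarrow> (\<exists>p. \<forall>N. f N = poly p (real N))"

lemma is_poly_const [intro]: "is_poly (\<lambda>_. c)"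
  unfolding is_poly_def by (rule exI[of _ "[:c:]"]) simp

lemma is_poly_of_nat [intro]: "is_poly real"
  unfolding is_poly_def by (rule exI[of _ "[:0, 1:]"]) simp

lemma is_poly_add [intro]: "is_poly f \<Longrightarrow> is_poly g \<Longrightarrow> is_poly (\<lambda>N. f N + g N)"
  unfolding is_poly_def by (metis poly_add)

lemma is_poly_diff [intro]: "is_poly f \<Longrightarrow> is_poly g \<Longrightarrow> is_poly (\<lambda>N. f N - g N)"
  unfolding is_poly_def by (metis poly_diff)

lemma is_poly_mult [intro]: "is_poly f \<Longrightarrow> is_poly g \<Longrightarrow> is_poly (\<lambda>N. f N * g N)"
  unfolding is_poly_def by (metis poly_mult)

lemma is_poly_divide [intro]: "is_poly f \<Longrightarrow> is_poly (\<lambda>N. f N / c)"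
  using is_poly_mult[OF _ is_poly_const[of "1/c"]] by fastforce

lemma is_poly_sum [intro]: "(\<And>i. i \<in> A \<Longrightarrow> is_poly (f i)) \<Longrightarrow> is_poly (\<lambda>N. \<Sum>i\<in>A. f i N)"
  by (induction A rule: infinite_finite_induct) auto

lemma is_poly_fact_quotient: "is_poly (\<lambda>N. fact (N + l) / fact N)"
proof (induction l)
  case (Suc l)
  have eq: "(\<lambda>N. fact (N + Suc l) / fact N :: real) = (\<lambda>N. (real N + real (Suc l)) * (fact (N + l) / fact N))"
    by (rule ext) (simp add: add_ac)
  show ?case unfolding eq by (intro is_poly_mult is_poly_add is_poly_of_nat is_poly_const Suc)
qed auto

lemma is_poly_fps_power:
  fixes F :: "real fps"
  assumes "F $ 0 = 1"
  shows "is_poly (\<lambda>N. (F ^ N) $ i)"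
proof (induction i rule: less_induct)
  case (less i)
  show ?case
  proof (cases "i = 0")
    case True
    thus ?thesis using assms by (auto simp: fps_power_zeroth)
  next
    case False
    have eq: "(\<lambda>N. (F ^ N) $ i) =
        (\<lambda>N. (\<Sum>m=1..i. (real m * (real N + 1) - real i) * F $ m * (F ^ N) $ (i - m)) / real i)"
      using fps_power_rec[OF assms, of i] False by (intro ext) (simp add: field_simps)
    show ?thesis unfolding eq using False
      by (intro is_poly_divide is_poly_sum is_poly_mult is_poly_diff is_poly_const is_poly_add is_poly_of_nat less) auto
  qed
qed

text \<open>Vanishing at 0 spreads to all even numbers; these are infinitely many roots, so the odd
  numbers follow.\<close>

lemma is_poly_eq_0:
  assumes "is_poly f" "\<And>N. f (N + 2) = f N" "f 0 = 0"
  shows "f N = 0"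
proof -
  obtain p where p: "\<And>N. f N = poly p (real N)" using assms(1) by (auto simp: is_poly_def)
  have "f (2 * j) = 0" for j
    by (induction j) (use assms in \<open>auto simp: algebra_simps\<close>)
  hence "range (\<lambda>j. real (2 * j)) \<subseteq> {x. poly p x = 0}" by (auto simp: p simp flip: of_nat_mult)
  moreover have "infinite (range (\<lambda>j. real (2 * j)))"
    by (intro range_inj_infinite) (auto simp: inj_on_def)
  ultimately have "p = 0" using poly_roots_finite finite_subset by blast
  thus ?thesis by (simp add: p)
qed

text \<open>Once level n - 1 agrees, the inhomogeneous parts cancel in the difference at level n,
  which is then 2-periodic and zero at N = 0.\<close>

lemma moment_rec_unique:
  fixes u v :: "nat \<Rightarrow> nat \<Rightarrow> real"
  assumes "\<And>n. is_poly (u n)" "\<And>n. is_poly (v n)"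
    and "\<And>n. u n 0 = (if n = 0 then 1 else - u (n - 1) 1)"
    and "\<And>n. v n 0 = (if n = 0 then 1 else - v (n - 1) 1)"
    and "\<And>n N. u n (N + 2) = u n N - (if n = 0 then 0 else real (N + 3) * u (n - 1) (N + 3))"
    and "\<And>n N. v n (N + 2) = v n N - (if n = 0 then 0 else real (N + 3) * v (n - 1) (N + 3))"
  shows "u n N = v n N"
proof (induction n arbitrary: N)
  case 0
  have "u 0 N - v 0 N = 0"
    using assms(3,4)[of 0] assms(5,6)[of 0]
    by (intro is_poly_eq_0[where f = "\<lambda>N. u 0 N - v 0 N" and N = N, OF is_poly_diff[OF assms(1,2)]]) simp_all
  thus ?case by simp
next
  case (Suc n)
  have "u (Suc n) N - v (Suc n) N = 0"
    using assms(3,4)[of "Suc n"] assms(5,6)[of "Suc n"] Suc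
    by (intro is_poly_eq_0[where f = "\<lambda>N. u (Suc n) N - v (Suc n) N" and N = N, OF is_poly_diff[OF assms(1,2)]]) (simp_all add: Suc)
  thus ?case by simp
qed

lemma is_poly_airy_moment: "is_poly (\<lambda>N. airy_moment N $ n / fact N)"
proof -
  have eq: "(\<lambda>N. airy_moment N $ n / fact N) = (\<lambda>N. \<Sum>k=0..n. c1_tilde (n - k) * (\<Sum>l=0..k. \<Sum>i=0..l.
    ((real l - real k - 1/2) gchoose (l - i)) * (3/2) ^ l * c2 (k - l) * ((fact (N + l) / fact N) * (chord_fps ^ N) $ i)))"
    by (simp add: airy_moment_nth sum_divide_distrib sum_distrib_left mult.assoc)
  show ?thesis unfolding eq
    by (intro is_poly_sum is_poly_mult is_poly_const is_poly_fact_quotient is_poly_fps_power) simp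
qed

text \<open>Division by N! turns the factorials (N + l)! into polynomials in N and removes the
  factor (N + 2)(N + 1), so that the homogeneous part of the recursion says 2-periodicity.\<close>

lemma airy_moment_unique:
  fixes u :: "nat \<Rightarrow> nat \<Rightarrow> real"
  assumes "\<And>n. is_poly (u n)"
    and "\<And>n. u n 0 = (if n = 0 then 1 else - u (n - 1) 1)"
    and "\<And>n N. u n (N + 2) = u n N - (if n = 0 then 0 else real (N + 3) * u (n - 1) (N + 3))"
  shows "u n N = airy_moment N $ n / fact N"
proof (rule moment_rec_unique[of u "\<lambda>n N. airy_moment N $ n / fact N"])
  show "airy_moment 0 $ n / fact 0 = (if n = 0 then 1 else - (airy_moment 1 $ (n - 1) / fact 1))" for n
    using arg_cong[OF airy_moment_0, of "\<lambda>f. f $ n"] by (cases n) auto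
  show "airy_moment (N + 2) $ n / fact (N + 2) = airy_moment N $ n / fact N - (if n = 0 then 0 else real (N + 3) * (airy_moment (N + 3) $ (n - 1) / fact (N + 3)))" for n N
  proof -
    have "airy_moment (N + 2) $ n + (if n = 0 then 0 else airy_moment (N + 3) $ (n - 1)) = real (Suc (Suc N)) * real (Suc N) * airy_moment N $ n"
      using arg_cong[OF airy_moment_rec[of N], of "\<lambda>f. f $ n"]
      by (cases n) (simp_all add: fps_mult_of_nat_nth mult.assoc numeral_3_eq_3 del: of_nat_Suc)
    hence *: "airy_moment (N + 2) $ n = real (Suc (Suc N)) * real (Suc N) * airy_moment N $ n - (if n = 0 then 0 else airy_moment (N + 3) $ (n - 1))"
      by simp
    have f2: "fact (N + 2) = real (Suc (Suc N)) * real (Suc N) * fact N"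
      by (simp add: mult_ac)
    have f3: "fact (N + 3) = real (N + 3) * fact (N + 2)"
      by (simp add: numeral_3_eq_3)
    show ?thesis
      unfolding * diff_divide_distrib f3 unfolding f2 by simp
  qed
qed (use assms is_poly_airy_moment in auto)

section \<open>The series defining the functions S\<close>

text \<open>Coefficients of everywhere convergent power series: they permit termwise differentiation
  in p at every p \<noteq> 0 without tracking radii of convergence.\<close>

definition entire :: "(nat \<Rightarrow> complex) \<Rightarrow> bool" where
  "entire c \<longleftrightarrow> (\<forall>z. summable (\<lambda>r. c r * z ^ r))"

lemma entire_add: "entire c \<Longrightarrow> entire d \<Longrightarrow> entire (\<lambda>r. c r + d r)"
  unfolding entire_def by (simp add: distrib_right summable_add)

lemma entire_cmult: "entire c \<Longrightarrow> entire (\<lambda>r. k * c r)"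
  unfolding entire_def by (simp add: mult.assoc summable_mult)

lemma entire_sum: "(\<And>m. m \<in> A \<Longrightarrow> entire (c m)) \<Longrightarrow> entire (\<lambda>r. \<Sum>m\<in>A. c m r)"
  unfolding entire_def by (simp add: sum_distrib_right summable_sum)

lemma diffs_power: "of_nat (Suc r) * c (Suc r) * z ^ Suc r = (z::complex) * (diffs c r * z ^ r)"
  by (simp add: diffs_def mult_ac)

lemma entire_of_nat_mult:
  assumes "entire c" shows "entire (\<lambda>r. of_nat r * c r)"
  unfolding entire_def
proof
  fix z
  have "summable (\<lambda>r. diffs c r * z ^ r)"
    using assms by (intro termdiff_converges_all) (simp add: entire_def)
  hence "summable (\<lambda>r. of_nat (Suc r) * c (Suc r) * z ^ Suc r)"
    unfolding diffs_power by (rule summable_mult)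
  thus "summable (\<lambda>r. of_nat r * c r * z ^ r)"
    by (subst (asm) summable_Suc_iff)
qed

lemma has_field_derivative_entire_divide:
  assumes "entire c" "p \<noteq> 0"
  shows "((\<lambda>p. \<Sum>r. c r * (x / p) ^ r) has_field_derivative - (\<Sum>r. of_nat r * c r * (x / p) ^ r) / p) (at p)"
proof -
  have c: "summable (\<lambda>r. c r * z ^ r)" for z using assms by (simp add: entire_def)
  have "((\<lambda>p. \<Sum>r. c r * (x / p) ^ r) has_field_derivative (\<Sum>r. diffs c r * (x / p) ^ r) * (- x / p\<^sup>2)) (at p)"
    by (rule DERIV_chain2[OF termdiffs_strong_converges_everywhere[OF c]])
      (use assms in \<open>auto intro!: derivative_eq_intros simp: power2_eq_square\<close>)
  also have "(\<Sum>r. diffs c r * (x / p) ^ r) * (- x / p\<^sup>2) = - ((x / p) * (\<Sum>r. diffs c r * (x / p) ^ r)) / p"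
    using assms by (simp add: power2_eq_square)
  also have "(x / p) * (\<Sum>r. diffs c r * (x / p) ^ r) = (\<Sum>r. (x / p) * (diffs c r * (x / p) ^ r))"
    by (rule suminf_mult[symmetric]) (intro termdiff_converges_all c)
  also have "\<dots> = (\<Sum>r. of_nat (Suc r) * c (Suc r) * (x / p) ^ Suc r)"
    unfolding diffs_power ..
  also have "\<dots> = (\<Sum>r. of_nat r * c r * (x / p) ^ r)"
    using suminf_split_initial_segment[of "\<lambda>r. of_nat r * c r * (x / p) ^ r" 1] entire_of_nat_mult[OF assms(1)]
    by (simp add: entire_def)
  finally show ?thesis .
qed

section \<open>Power series coefficients of the S_i\<close>

text \<open>The coefficient of (x/p)^r in S_i. The factorial (l + 2r)! is that of
  \<open>laplace_fps\<close> for N = 2r; i enters only through the coefficient of the power of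
  \<open>chord_fps\<close>.\<close>

definition S_coeff :: "nat \<Rightarrow> nat \<Rightarrow> nat \<Rightarrow> nat \<Rightarrow> real" where
  "S_coeff n l i r = (chord_fps ^ (2 * r)) $ i * (fact (l + 2 * r) / (fact (2 * r) * Gamma (3 * real n / 2 + 1 + real r)))"

lemma chord_fps_0 [simp]: "(chord_fps ^ N) $ 0 = 1"
  by (simp add: fps_power_zeroth)

lemma S_coeff_0: "S_coeff n l 0 r = fact (l + 2 * r) / (fact (2 * r) * Gamma (3 * real n / 2 + 1 + real r))"
  by (simp add: S_coeff_def)

lemma Gamma_add_nat:
  assumes "a > 0" shows "Gamma (a + real r) = pochhammer a r * Gamma (a::real)"
proof -
  have "a \<notin> \<int>\<^sub>\<le>\<^sub>0" using nonpos_Ints_nonpos[of a] assms by force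
  thus ?thesis using pochhammer_Gamma[of a r] Gamma_real_pos[OF assms] by (simp add: field_simps)
qed

lemma pochhammer_ge_fact: "a \<ge> 1 \<Longrightarrow> fact r \<le> pochhammer (a::real) r"
proof (induction r)
  case (Suc r)
  have "fact (Suc r) = fact r * (1 + real r)" by simp
  also have "\<dots> \<le> pochhammer a r * (a + real r)" using Suc by (intro mult_mono) (auto intro!: less_imp_le[OF pochhammer_pos])
  finally show ?case by (simp add: pochhammer_Suc)
qed simp

text \<open>Raising l by one multiplies coefficient r by l + 1 + 2r, which keeps the series entire.
  For l = 0 the comparison is with the exponential series.\<close>

lemma entire_S_coeff_0: "entire (\<lambda>r. of_real (S_coeff n l 0 r))"
proof (induction l)
  case 0
  define a where "a = 3 * real n / 2 + 1"
  have a: "a \<ge> 1" by (simp add: a_def)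
  have g: "Gamma a > 0" using a by (intro Gamma_real_pos) auto
  show ?case unfolding entire_def
  proof
    fix z :: complex
    show "summable (\<lambda>r. of_real (S_coeff n 0 0 r) * z ^ r)"
    proof (rule summable_comparison_test[OF exI])
      show "\<forall>r\<ge>0. norm (of_real (S_coeff n 0 0 r) * z ^ r) \<le> 1 / Gamma a * (norm z ^ r / fact r)"
      proof (intro allI impI)
        fix r
        have "norm (of_real (S_coeff n 0 0 r) * z ^ r) = norm z ^ r / (pochhammer a r * Gamma a)"
          using a g pochhammer_pos[of a r]
          by (simp add: S_coeff_0 norm_mult norm_power norm_divide a_def[symmetric] Gamma_add_nat abs_mult)
        also have "\<dots> \<le> norm z ^ r / (fact r * Gamma a)"
          using pochhammer_ge_fact[OF a, of r] g by (intro divide_left_mono mult_right_mono mult_pos_pos pochhammer_pos) (use a in auto)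
        finally show "norm (of_real (S_coeff n 0 0 r) * z ^ r) \<le> 1 / Gamma a * (norm z ^ r / fact r)"
          by (simp add: mult.commute)
      qed
      show "summable (\<lambda>r. 1 / Gamma a * (norm z ^ r / fact r))"
        using summable_exp[of "norm z"] by (intro summable_mult) (simp add: field_simps)
    qed
  qed
next
  case (Suc l)
  have "(\<lambda>r. of_real (S_coeff n (Suc l) 0 r)) = (\<lambda>r. complex_of_real (real (Suc l)) * of_real (S_coeff n l 0 r) + 2 * (of_nat r * of_real (S_coeff n l 0 r)))"
  proof
    fix r
    have "S_coeff n (Suc l) 0 r = real (Suc l) * S_coeff n l 0 r + 2 * (real r * S_coeff n l 0 r)"
      by (simp add: S_coeff_0 add_divide_distrib algebra_simps)
    thus "of_real (S_coeff n (Suc l) 0 r) = complex_of_real (real (Suc l)) * of_real (S_coeff n l 0 r) + 2 * (of_nat r * of_real (S_coeff n l 0 r))"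
      by simp
  qed
  thus ?case using Suc by (simp only:) (intro entire_add entire_cmult entire_of_nat_mult)
qed

text \<open>The duplication formula for Pochhammer symbols, applied to (l + 2r)!/l! and to (2r)!,
  produces the parameters of the 2F2.\<close>

lemma S_0_eq:
  "S n l x 0 p = (\<Sum>r. of_real (S_coeff n l 0 r) * (of_real x / p) ^ r)"
proof -
  define a where "a = 3 * real n / 2 + 1"
  have a: "a > 0" by (simp add: a_def)
  have eq: "fact l / Gamma a * (pochhammer ((real l + 1) / 2) r * pochhammer (real l / 2 + 1) r / (pochhammer (1/2) r * pochhammer a r) / fact r) = S_coeff n l 0 r" for r
  proof -
    have 1: "fact (l + 2 * r) = fact l * (4 ^ r * pochhammer ((real l + 1) / 2) r * pochhammer (real l / 2 + 1) r)"
      using pochhammer_double[of "(real l + 1) / 2" r] pochhammer_product'[of "1::real" l "2 * r"]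
      by (simp add: pochhammer_fact[symmetric] power_mult add.commute add_divide_distrib)
    have 2: "fact (2 * r) = 4 ^ r * pochhammer (1/2) r * (fact r :: real)"
      using pochhammer_double[of "1/2 :: real" r] by (simp add: pochhammer_fact[symmetric] power_mult)
    have p: "pochhammer (1/2) r > (0::real)" "pochhammer a r > 0" using a by (auto intro: pochhammer_pos)
    show ?thesis
      unfolding S_coeff_0 a_def[symmetric] Gamma_add_nat[OF a] 1 2
      using p Gamma_real_pos[OF a] by (simp add: field_simps)
  qed
  have "S n l x 0 p = of_real (fact l / Gamma a) * hypergeom_2F2 (of_real ((real l + 1) / 2)) (of_real (real l / 2 + 1)) (of_real (1/2)) (of_real a) (of_real x / p)"
    by (simp add: S.simps[of n l x 0] a_def Gamma_complex_of_real[symmetric])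
  also have "\<dots> = of_real (fact l / Gamma a) * (\<Sum>r. of_real (pochhammer ((real l + 1) / 2) r * pochhammer (real l / 2 + 1) r / (pochhammer (1/2) r * pochhammer a r) / fact r) * (of_real x / p) ^ r)"
    unfolding hypergeom_2F2_def pochhammer_of_real by simp
  also have "\<dots> = (\<Sum>r. of_real (fact l / Gamma a) * (of_real (pochhammer ((real l + 1) / 2) r * pochhammer (real l / 2 + 1) r / (pochhammer (1/2) r * pochhammer a r) / fact r) * (of_real x / p) ^ r))"
  proof (rule suminf_mult[symmetric])
    have g: "Gamma a > 0" using a by (rule Gamma_real_pos)
    have "pochhammer ((real l + 1) / 2) r * pochhammer (real l / 2 + 1) r / (pochhammer (1/2) r * pochhammer a r) / fact r
      = Gamma a / fact l * S_coeff n l 0 r" for r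
      unfolding eq[symmetric] using g by simp
    thus "summable (\<lambda>r. of_real (pochhammer ((real l + 1) / 2) r * pochhammer (real l / 2 + 1) r / (pochhammer (1/2) r * pochhammer a r) / fact r) * (of_real x / p) ^ r)"
      using entire_cmult[OF entire_S_coeff_0[of n l], of "of_real (Gamma a / fact l)"]
      by (simp only: entire_def of_real_mult)
  qed
  also have "\<dots> = (\<Sum>r. of_real (S_coeff n l 0 r) * (of_real x / p) ^ r)"
    unfolding eq[symmetric] by (simp only: of_real_mult mult.assoc)
  finally show ?thesis .
qed

text \<open>The constants of the differential-difference equation are thus the ones in Miller's
  recurrence for \<open>chord_fps\<close>; the binomial of -1/3 over m is a quotient of Gamma
  values.\<close>

lemma chord_fps_Gamma: "Gamma (2/3) / (Gamma (2/3 - of_nat m) * fact (m + 1)) = complex_of_real (chord_fps $ m)"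
proof -
  have "chord_fps $ m = Gamma (2/3) / (Gamma (2/3 - real m) * fact (m + 1))"
  proof -
    have "(2/3 :: real) \<notin> \<int>\<^sub>\<le>\<^sub>0" using nonpos_Ints_nonpos[of "2/3::real"] by auto
    hence "(-1/3 :: real) gchoose m = Gamma (2/3) / (fact m * Gamma (2/3 - real m))"
      using gbinomial_Gamma[of "-1/3::real" m] by simp
    thus ?thesis by (simp add: mult_ac)
  qed
  moreover have "Gamma (2/3) = complex_of_real (Gamma (2/3))" "Gamma (2/3 - of_nat m) = complex_of_real (Gamma (2/3 - real m))"
    unfolding Gamma_complex_of_real[symmetric] by simp_all
  ultimately show ?thesis by (simp del: fps_nth_chord_fps)
qed

text \<open>
  As \<open>p d/dp\<close> multiplies \<open>(x/p)\<^sup>r\<close> by \<open>-r\<close>, the equation for \<open>S\<^sub>i\<close> becomes, power by power, the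
  recursion \<open>fps_power_rec\<close> for the coefficients of \<open>chord_fps\<^sup>2\<^sup>r\<close>.
\<close>

lemma S_eq:
  "entire (\<lambda>r. of_real (S_coeff n l i r)) \<and>
   (\<forall>p. p \<noteq> 0 \<longrightarrow> S n l x i p = (\<Sum>r. of_real (S_coeff n l i r) * (of_real x / p) ^ r))"
proof (induction i rule: less_induct)
  case (less i)
  show ?case
  proof (cases "i = 0")
    case True
    thus ?thesis using entire_S_coeff_0 S_0_eq by simp
  next
    case False
    define c where "c m r = complex_of_real (S_coeff n l (i - m) r)" for m r
    have IH: "entire (c m)" "p \<noteq> 0 \<Longrightarrow> S n l x (i - m) p = (\<Sum>r. c m r * (of_real x / p) ^ r)" if "m \<in> {1..i}" for m p
      using less[of "i - m"] that False unfolding c_def by auto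
    define b where "b m = complex_of_real (chord_fps $ m)" for m
    define d where "d m r = (of_nat m - of_nat i) * c m r + 2 * of_nat m * (of_nat r * c m r)" for m r
    have ed: "entire (d m)" if "m \<in> {1..i}" for m
      unfolding d_def by (intro entire_add entire_cmult entire_of_nat_mult IH(1)[OF that])
    have expand: "of_real (S_coeff n l i r) = (\<Sum>m=1..i. b m / of_nat i * d m r)" for r
    proof -
      have "real i * S_coeff n l i r = (\<Sum>m=1..i. chord_fps $ m * ((real m * (2 * real r + 1) - real i) * S_coeff n l (i - m) r))"
      proof -
        \<comment> \<open>This factor is independent of the index i, so the recurrence for the
          coefficients of \<open>chord_fps ^ (2 * r)\<close> passes to
          \<open>S_coeff\<close>.\<close>
        define Q where "Q = fact (l + 2 * r) / (fact (2 * r) * Gamma (3 * real n / 2 + 1 + real r))"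
        have "real i * (chord_fps ^ (2 * r)) $ i = (\<Sum>m=1..i. (real m * (2 * real r + 1) - real i) * chord_fps $ m * (chord_fps ^ (2 * r)) $ (i - m))"
          using fps_power_rec[of chord_fps i "2 * r"] by (simp del: fps_nth_chord_fps) simp
        hence "(real i * (chord_fps ^ (2 * r)) $ i) * Q = (\<Sum>m=1..i. (real m * (2 * real r + 1) - real i) * chord_fps $ m * (chord_fps ^ (2 * r)) $ (i - m)) * Q"
          by simp
        thus ?thesis unfolding S_coeff_def Q_def[symmetric] sum_distrib_right by (simp only: mult_ac)
      qed
      hence "of_nat i * of_real (S_coeff n l i r) = (\<Sum>m=1..i. b m * ((of_nat m * (2 * of_nat r + 1) - of_nat i) * c m r))"
        unfolding b_def c_def by (drule_tac arg_cong[where f = complex_of_real]) (simp del: fps_nth_chord_fps)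
      also have "\<dots> = (\<Sum>m=1..i. b m * d m r)"
        by (intro sum.cong refl) (simp add: d_def algebra_simps)
      finally show ?thesis using False by (simp add: sum_divide_distrib[symmetric] field_simps)
    qed
    have "entire (\<lambda>r. of_real (S_coeff n l i r))"
      unfolding expand by (intro entire_sum entire_cmult ed)
    moreover have "S n l x i p = (\<Sum>r. of_real (S_coeff n l i r) * (of_real x / p) ^ r)" if p: "p \<noteq> 0" for p
    proof -
      have summand: "(of_nat m - of_nat i) * S n l x (i - m) p - 2 * of_nat m * p * deriv (S n l x (i - m)) p
          = (\<Sum>r. d m r * (of_real x / p) ^ r)" if m: "m \<in> {1..i}" for m
      proof -
        have sm: "summable (\<lambda>r. c m r * (of_real x / p) ^ r)" "summable (\<lambda>r. of_nat r * c m r * (of_real x / p) ^ r)"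
          using IH(1)[OF m] entire_of_nat_mult[OF IH(1)[OF m]] unfolding entire_def by blast+
        have "(S n l x (i - m) has_field_derivative - (\<Sum>r. of_nat r * c m r * (of_real x / p) ^ r) / p) (at p)"
          by (rule has_field_derivative_transform_within_open[OF has_field_derivative_entire_divide[OF IH(1)[OF m] p], of "- {0}"])
            (use p IH(2)[OF m] in auto)
        hence "deriv (S n l x (i - m)) p = - (\<Sum>r. of_nat r * c m r * (of_real x / p) ^ r) / p"
          by (rule DERIV_imp_deriv)
        hence "(of_nat m - of_nat i) * S n l x (i - m) p - 2 * of_nat m * p * deriv (S n l x (i - m)) p
          = (of_nat m - of_nat i) * (\<Sum>r. c m r * (of_real x / p) ^ r) + 2 * of_nat m * (\<Sum>r. of_nat r * c m r * (of_real x / p) ^ r)"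
          using p IH(2)[OF m p] by simp
        also have "\<dots> = (\<Sum>r. (of_nat m - of_nat i) * (c m r * (of_real x / p) ^ r) + 2 * of_nat m * (of_nat r * c m r * (of_real x / p) ^ r))"
          unfolding suminf_mult[OF sm(1), symmetric] suminf_mult[OF sm(2), symmetric]
          by (rule suminf_add) (intro summable_mult sm)+
        also have "\<dots> = (\<Sum>r. d m r * (of_real x / p) ^ r)"
          by (intro suminf_cong) (simp add: d_def algebra_simps)
        finally show ?thesis .
      qed
      have "S n l x i p = Gamma (2/3) / of_nat i *
         (\<Sum>m=1..i. ((of_nat m - of_nat i) * S n l x (i - m) p
                       - 2 * of_nat m * p * deriv (S n l x (i - m)) p)
                     / (Gamma (2/3 - of_nat m) * fact (m + 1)))"
        using False by (subst S.simps) simp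
      also have "\<dots> = (\<Sum>m=1..i. b m / of_nat i * (\<Sum>r. d m r * (of_real x / p) ^ r))"
        unfolding sum_distrib_left
      proof (intro sum.cong refl)
        fix m assume m: "m \<in> {1..i}"
        show "Gamma (2/3) / of_nat i * (((of_nat m - of_nat i) * S n l x (i - m) p
                       - 2 * of_nat m * p * deriv (S n l x (i - m)) p)
                     / (Gamma (2/3 - of_nat m) * fact (m + 1))) = b m / of_nat i * (\<Sum>r. d m r * (of_real x / p) ^ r)"
          unfolding summand[OF m] b_def chord_fps_Gamma[symmetric] by simp
      qed
      also have "\<dots> = (\<Sum>m=1..i. \<Sum>r. b m / of_nat i * (d m r * (of_real x / p) ^ r))"
        using ed by (intro sum.cong refl suminf_mult[symmetric]) (auto simp: entire_def)
      also have "\<dots> = (\<Sum>r. \<Sum>m=1..i. b m / of_nat i * (d m r * (of_real x / p) ^ r))"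
        using ed by (intro suminf_sum[symmetric] summable_mult) (auto simp: entire_def)
      also have "\<dots> = (\<Sum>r. of_real (S_coeff n l i r) * (of_real x / p) ^ r)"
        unfolding expand by (simp only: sum_distrib_right mult.assoc)
      finally show ?thesis .
    qed
    ultimately show ?thesis by blast
  qed
qed

text \<open>At p = 1 the variable of the series is x. Real coefficients make the value real, so the
  moment formula can be proved over the reals.\<close>

lemma S_coeff_sums: "(\<lambda>r. S_coeff n l i r * x ^ r) sums Re (Sigma_coeff n l i x)"
  and Sigma_coeff_real: "Sigma_coeff n l i x = of_real (Re (Sigma_coeff n l i x))"
proof -
  have "summable (\<lambda>r. of_real (S_coeff n l i r) * complex_of_real x ^ r)"
    using S_eq[of n l i x] by (simp add: entire_def)
  moreover have "Sigma_coeff n l i x = (\<Sum>r. of_real (S_coeff n l i r) * complex_of_real x ^ r)"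
    using S_eq[of n l i x] by (simp add: Sigma_coeff_def)
  ultimately have *: "(\<lambda>r. of_real (S_coeff n l i r * x ^ r)) sums Sigma_coeff n l i x"
    by (simp add: sums_iff)
  show "(\<lambda>r. S_coeff n l i r * x ^ r) sums Re (Sigma_coeff n l i x)"
    using sums_Re[OF *] by simp
  have "Im (Sigma_coeff n l i x) = 0"
    using sums_unique[OF sums_Im[OF *]] by simp
  thus "Sigma_coeff n l i x = of_real (Re (Sigma_coeff n l i x))" by (simp add: complex_eq_iff)
qed

section \<open>Independence of the past and Brownian increments\<close>

text \<open>Rounding the time down to multiples of 1/(k + 1) leaves countably many measurable
  branches, and path continuity gives the limit. Times are clamped to [0, s], where alone
  \<open>f\<close> is controlled.\<close>

lemma borel_measurable_pair_continuous:
  fixes f :: "real \<Rightarrow> 'a \<Rightarrow> real"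
  assumes s: "0 \<le> s" and meas: "\<And>u. u \<in> {0..s} \<Longrightarrow> f u \<in> borel_measurable N"
    and cont: "\<And>\<omega>. \<omega> \<in> space N \<Longrightarrow> continuous_on {0..s} (\<lambda>u. f u \<omega>)"
  shows "(\<lambda>p. f (max 0 (min (fst p) s)) (snd p)) \<in> borel_measurable (borel \<Otimes>\<^sub>M N)"
proof (rule borel_measurable_LIMSEQ_real)
  define c where "c u = max 0 (min u s)" for u :: real
  have c: "c u \<in> {0..s}" for u using s by (auto simp: c_def)
  define F where "F k p = f (c (of_int \<lfloor>real (Suc k) * fst p\<rfloor> / real (Suc k))) (snd p)"
    for k :: nat and p :: "real \<times> 'a"
  show "F k \<in> borel_measurable (borel \<Otimes>\<^sub>M N)" for k
    unfolding F_def
  proof (rule measurable_compose_countable[where f = "\<lambda>i p. f (c (of_int i / real (Suc k))) (snd p)"])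
    fix i :: int
    have [measurable]: "f (c (of_int i / real (Suc k))) \<in> borel_measurable N" by (rule meas[OF c])
    show "(\<lambda>p. f (c (of_int i / real (Suc k))) (snd p)) \<in> borel_measurable (borel \<Otimes>\<^sub>M N)"
      by measurable
  qed measurable
  fix p :: "real \<times> 'a" assume "p \<in> space (borel \<Otimes>\<^sub>M N)"
  hence "snd p \<in> space N" by (auto simp: space_pair_measure)
  have "(\<lambda>k. of_int \<lfloor>real (Suc k) * fst p\<rfloor> / real (Suc k)) \<longlonglongrightarrow> fst p"
  proof (rule real_tendsto_sandwich)
    show "\<forall>\<^sub>F k in sequentially. fst p - 1 / real (Suc k) \<le> of_int \<lfloor>real (Suc k) * fst p\<rfloor> / real (Suc k)"
    proof (intro always_eventually allI)
      fix k
      have "fst p - 1 / real (Suc k) = (real (Suc k) * fst p - 1) / real (Suc k)"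
        by (simp add: field_simps)
      also have "\<dots> \<le> of_int \<lfloor>real (Suc k) * fst p\<rfloor> / real (Suc k)"
        by (intro divide_right_mono) linarith+
      finally show "fst p - 1 / real (Suc k) \<le> of_int \<lfloor>real (Suc k) * fst p\<rfloor> / real (Suc k)" .
    qed
    show "\<forall>\<^sub>F k in sequentially. of_int \<lfloor>real (Suc k) * fst p\<rfloor> / real (Suc k) \<le> fst p"
    proof (intro always_eventually allI)
      fix k
      have "of_int \<lfloor>real (Suc k) * fst p\<rfloor> / real (Suc k) \<le> (real (Suc k) * fst p) / real (Suc k)"
        by (intro divide_right_mono) linarith+
      thus "of_int \<lfloor>real (Suc k) * fst p\<rfloor> / real (Suc k) \<le> fst p" by simp
    qed
    show "(\<lambda>k. fst p - 1 / real (Suc k)) \<longlonglongrightarrow> fst p"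
      using tendsto_diff[OF tendsto_const lim_inverse_n'[THEN LIMSEQ_Suc], of "fst p"] by simp
  qed auto
  hence "(\<lambda>k. c (of_int \<lfloor>real (Suc k) * fst p\<rfloor> / real (Suc k))) \<longlonglongrightarrow> c (fst p)"
    unfolding c_def by (intro tendsto_max tendsto_min tendsto_const)
  thus "(\<lambda>k. F k p) \<longlonglongrightarrow> f (max 0 (min (fst p) s)) (snd p)"
    using continuous_on_tendsto_compose[OF cont[OF \<open>snd p \<in> space N\<close>], of _ "c (fst p)" sequentially] c
    unfolding F_def by (simp add: c_def)
qed

text \<open>Passage from the gauge integral, in which the area is defined, to the Lebesgue integral
  of the clamped integrand, which is jointly measurable.\<close>

lemma integral_continuous_eq_lborel:
  fixes g :: "real \<Rightarrow> real"
  assumes "continuous_on {0..s} g"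
  shows "integral {0..s} g = (\<integral>u. indicator {0..s} u * g (max 0 (min u s)) \<partial>lborel)"
proof -
  have "integral {0..s} g = (LINT x : {0..s} | lborel. g x)"
    using set_borel_integral_eq_integral(2)[OF borel_integrable_atLeastAtMost'[OF assms]] by simp
  also have "\<dots> = (\<integral>u. indicator {0..s} u * g (max 0 (min u s)) \<partial>lborel)"
    unfolding set_lebesgue_integral_def
    by (intro Bochner_Integration.integral_cong refl) (auto simp: indicator_def)
  finally show ?thesis .
qed

lemma borel_measurable_integral_continuous:
  fixes f :: "real \<Rightarrow> 'a \<Rightarrow> real"
  assumes s: "0 \<le> s" and meas: "\<And>u. u \<in> {0..s} \<Longrightarrow> f u \<in> borel_measurable N"
    and cont: "\<And>\<omega>. \<omega> \<in> space N \<Longrightarrow> continuous_on {0..s} (\<lambda>u. f u \<omega>)"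
  shows "(\<lambda>\<omega>. integral {0..s} (\<lambda>u. f u \<omega>)) \<in> borel_measurable N"
proof -
  have [measurable]: "(\<lambda>p. f (max 0 (min (fst p) s)) (snd p)) \<in> borel_measurable (borel \<Otimes>\<^sub>M N)"
    by (rule borel_measurable_pair_continuous[OF s meas cont])
  have "(\<lambda>\<omega>. \<integral>u. indicator {0..s} u * f (max 0 (min u s)) \<omega> \<partial>lborel) \<in> borel_measurable N"
  proof (rule lborel.borel_measurable_lebesgue_integral)
    have "(\<lambda>p. (\<lambda>p. indicator {0..s} (fst p) * f (max 0 (min (fst p) s)) (snd p)) (snd p, fst p))
       \<in> borel_measurable (N \<Otimes>\<^sub>M lborel)"
      by (rule measurable_compose[of _ _ "borel \<Otimes>\<^sub>M N"]) measurable
    thus "(\<lambda>(\<omega>, u). indicator {0..s} u * f (max 0 (min u s)) \<omega>) \<in> borel_measurable (N \<Otimes>\<^sub>M lborel)"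
      by (simp add: case_prod_unfold)
  qed
  also have "?this \<longleftrightarrow> ?thesis"
    using integral_continuous_eq_lborel[OF cont] by (intro measurable_cong) simp
  finally show ?thesis .
qed

text \<open>With G the running integral of g, G^(n+1) has derivative (n + 1) g G^n. The
  \<open>ennreal\<close> form prepares the exchange of time integral and expectation.\<close>

lemma power_integral_continuous:
  fixes g :: "real \<Rightarrow> real"
  assumes t: "0 \<le> t" and cont: "continuous_on {0..t} g" and nn: "\<And>s. s \<in> {0..t} \<Longrightarrow> 0 \<le> g s"
  shows "ennreal (integral {0..t} g ^ Suc n)
    = ennreal (real (Suc n)) * (\<integral>\<^sup>+s. indicator {0..t} s * ennreal (g s * integral {0..s} g ^ n) \<partial>lborel)"
proof -
  define G where "G s = integral {0..s} g" for s
  have dG: "(G has_real_derivative g s) (at s within {0..t})" if "s \<in> {0..t}" for s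
    unfolding G_def by (rule integral_has_real_derivative[OF cont that])
  hence cG: "continuous_on {0..t} G" using DERIV_continuous_on by blast
  have G0: "G s \<ge> 0" if "s \<in> {0..t}" for s
    unfolding G_def using that nn by (intro integral_nonneg integrable_continuous_real continuous_on_subset[OF cont]) auto
  let ?h = "\<lambda>s. real (Suc n) * (g s * G s ^ n)"
  have "(\<integral>s. indicator {0..t} s *\<^sub>R ?h s \<partial>lborel) = G t ^ Suc n - G 0 ^ Suc n"
  proof (rule integral_FTC_atLeastAtMost[OF t])
    show "((\<lambda>s. G s ^ Suc n) has_vector_derivative ?h s) (at s within {0..t})" if "0 \<le> s" "s \<le> t" for s
      using DERIV_power[OF dG[of s], of "Suc n"] that
      unfolding has_real_derivative_iff_has_vector_derivative[symmetric] by simp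
    show "continuous_on {0..t} ?h" by (intro continuous_intros cont cG)
  qed
  moreover have "G 0 = 0" by (simp add: G_def)
  ultimately have "ennreal (G t ^ Suc n) = ennreal (\<integral>s. indicator {0..t} s *\<^sub>R ?h s \<partial>lborel)" by simp
  also have "\<dots> = (\<integral>\<^sup>+s. ennreal (indicator {0..t} s *\<^sub>R ?h s) \<partial>lborel)"
  proof (rule nn_integral_eq_integral[symmetric])
    have "continuous_on {0..t} ?h" by (intro continuous_intros cont cG)
    thus "integrable lborel (\<lambda>s. indicator {0..t} s *\<^sub>R ?h s)"
      using borel_integrable_atLeastAtMost' unfolding set_integrable_def by blast
    show "AE s in lborel. 0 \<le> indicator {0..t} s *\<^sub>R ?h s"
      using nn G0 by (intro AE_I2) (auto simp: indicator_def)
  qed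
  also have "\<dots> = (\<integral>\<^sup>+s. ennreal (real (Suc n)) * (indicator {0..t} s * ennreal (g s * G s ^ n)) \<partial>lborel)"
    by (intro nn_integral_cong) (auto simp: indicator_def ennreal_mult' simp del: of_nat_Suc)
  also have "\<dots> = ennreal (real (Suc n)) * (\<integral>\<^sup>+s. indicator {0..t} s * ennreal (g s * G s ^ n) \<partial>lborel)"
  proof (rule nn_integral_cmult)
    have "continuous_on {0..t} (\<lambda>s. g s * G s ^ n)" by (intro continuous_intros cont cG)
    hence "(\<lambda>s. ennreal (indicator {0..t} s *\<^sub>R (g s * G s ^ n))) \<in> borel_measurable borel"
      by (intro measurable_compose[OF _ measurable_ennreal] borel_measurable_continuous_on_indicator) auto
    also have "(\<lambda>s. ennreal (indicator {0..t} s *\<^sub>R (g s * G s ^ n))) = (\<lambda>s. indicator {0..t} s * ennreal (g s * G s ^ n))"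
      by (auto simp: indicator_def)
    finally show "(\<lambda>s. indicator {0..t} s * ennreal (g s * G s ^ n)) \<in> borel_measurable lborel" by simp
  qed
  finally show ?thesis unfolding G_def .
qed

context standard_brownian_motion
begin

text \<open>
  The increment is padded to a pair because \<open>indep_var\<close> requires both variables to have the
  same type.
\<close>

lemma indep_past:
  assumes st: "0 < s" "s < t"
  obtains N where "space N = space M" "sets N \<subseteq> sets M"
    "\<And>u. u \<in> {0..s} \<Longrightarrow> (\<lambda>\<omega>. W u \<omega> - W 0 \<omega>) \<in> borel_measurable N"
    "\<And>(S :: (real \<times> real) measure) Z. Z \<in> measurable N S \<Longrightarrow> indep_var S Z (borel \<Otimes>\<^sub>M borel) (\<lambda>\<omega>. (W t \<omega> - W s \<omega>, 0))"
proof -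
  \<comment> \<open>A dyadic grid of [0, s], followed by t at index 2^k + 1: the increments with
    index below 2^k describe the past, and the one with index 2^k is
    \<open>W t - W s\<close>.\<close>
  define \<tau> where "\<tau> k j = (if j \<le> 2 ^ k then s * real j / 2 ^ k else t)" for k j :: nat
  define D where "D = (\<lambda>\<omega>. W t \<omega> - W s \<omega>)"
  define X where "X k \<omega> = (\<lambda>j\<in>{..<2 ^ k}. W (\<tau> k (Suc j)) \<omega> - W (\<tau> k j) \<omega>)" for k \<omega>
  define P where "P k = PiM {..<2 ^ k :: nat} (\<lambda>_. borel :: real measure)" for k :: nat
  define EE where "EE k = {X k -` A \<inter> space M | A. A \<in> sets (P k)}" for k
  define DD where "DD = {D -` A \<inter> space M | A. A \<in> sets (borel :: real measure)}"
  have ind: "indep_var (P k) (X k) (PiM {2 ^ k} (\<lambda>_. borel)) (\<lambda>\<omega>. \<lambda>j\<in>{2 ^ k}. D \<omega>)" for k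
  proof -
    have "strict_mono_on {..2 ^ k + 1} (\<tau> k)"
    proof (rule strict_mono_onI)
      fix i j :: nat assume ij: "i \<in> {..2 ^ k + 1}" "j \<in> {..2 ^ k + 1}" "i < j"
      have "s * real i / 2 ^ k < t" if "i \<le> 2 ^ k"
      proof -
        have "s * real i / 2 ^ k \<le> s" using that st by (simp add: field_simps)
        thus ?thesis using st by linarith
      qed
      thus "\<tau> k i < \<tau> k j" using ij st by (auto simp: \<tau>_def divide_strict_right_mono)
    qed
    hence "indep_vars (\<lambda>_. borel) (\<lambda>j \<omega>. W (\<tau> k (Suc j)) \<omega> - W (\<tau> k j) \<omega>) {..<2 ^ k + 1}"
      by (rule indep_increments[rotated]) (simp add: \<tau>_def)
    hence "indep_var (P k) (X k) (PiM {2 ^ k} (\<lambda>_. borel))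
        (\<lambda>\<omega>. \<lambda>j\<in>{2 ^ k}. W (\<tau> k (Suc j)) \<omega> - W (\<tau> k j) \<omega>)"
      unfolding P_def X_def by (rule indep_var_restrict) auto
    also have "(\<lambda>\<omega>. \<lambda>j\<in>{2 ^ k}. W (\<tau> k (Suc j)) \<omega> - W (\<tau> k j) \<omega>) = (\<lambda>\<omega>. \<lambda>j\<in>{2 ^ k}. D \<omega>)"
      by (auto simp: D_def \<tau>_def fun_eq_iff)
    finally show ?thesis .
  qed
  have Dm [measurable]: "D \<in> borel_measurable M"
    using st by (auto simp: D_def intro!: borel_measurable_diff random_variable)
  have Xm [measurable]: "X k \<in> measurable M (P k)" for k by (rule indep_var_rv1[OF ind])
  \<comment> \<open>The grids are nested and a coarse increment is the sum of two finer ones, which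
    is the map \<open>T\<close>. Hence the families \<open>EE k\<close> increase and their union is
    closed under intersection.\<close>
  have EE_Suc: "EE k \<subseteq> EE (Suc k)" for k
  proof
    fix a assume "a \<in> EE k"
    then obtain A where A: "A \<in> sets (P k)" "a = X k -` A \<inter> space M" by (auto simp: EE_def)
    define T where "T x = (\<lambda>j\<in>{..<2 ^ k}. x (2 * j) + x (Suc (2 * j)))" for x :: "nat \<Rightarrow> real"
    have T: "T \<in> measurable (P (Suc k)) (P k)"
      unfolding T_def P_def
      by (intro measurable_restrict borel_measurable_add measurable_component_singleton) auto
    have XT: "X k \<omega> = T (X (Suc k) \<omega>)" for \<omega>
    proof
      fix j
      have "\<tau> (Suc k) (2 * j) = \<tau> k j" "\<tau> (Suc k) (2 * Suc j) = \<tau> k (Suc j)" if "j < 2 ^ k"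
        using that by (auto simp: \<tau>_def field_simps)
      thus "X k \<omega> j = T (X (Suc k) \<omega>) j" by (auto simp: X_def T_def)
    qed
    have "a = X (Suc k) -` (T -` A \<inter> space (P (Suc k))) \<inter> space M"
      using measurable_space[OF Xm] by (auto simp: A XT)
    thus "a \<in> EE (Suc k)" using measurable_sets[OF T A(1)] unfolding EE_def by blast
  qed
  hence EE_mono: "i \<le> j \<Longrightarrow> EE i \<subseteq> EE j" for i j by (rule lift_Suc_mono_le)
  have EE_Int: "a \<inter> b \<in> EE k" if ab: "a \<in> EE k" "b \<in> EE k" for a b k
  proof -
    obtain A where A: "A \<in> sets (P k)" "a = X k -` A \<inter> space M"
      using ab(1) by (auto simp: EE_def)
    obtain B where B: "B \<in> sets (P k)" "b = X k -` B \<inter> space M"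
      using ab(2) by (auto simp: EE_def)
    have "a \<inter> b = X k -` (A \<inter> B) \<inter> space M" "A \<inter> B \<in> sets (P k)" using A B by auto
    thus ?thesis unfolding EE_def by blast
  qed
  have stable: "Int_stable (\<Union>k. EE k)"
  proof (rule Int_stableI)
    fix a b assume "a \<in> (\<Union>k. EE k)" "b \<in> (\<Union>k. EE k)"
    then obtain i j where "a \<in> EE i" "b \<in> EE j" by auto
    hence "a \<in> EE (max i j)" "b \<in> EE (max i j)" using EE_mono[of i "max i j"] EE_mono[of j "max i j"] by auto
    thus "a \<inter> b \<in> (\<Union>k. EE k)" using EE_Int by blast
  qed
  have stableD: "Int_stable DD"
  proof (rule Int_stableI)
    fix a b assume "a \<in> DD" "b \<in> DD"
    then obtain A B where A: "A \<in> sets borel" "a = D -` A \<inter> space M"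
      and B: "B \<in> sets borel" "b = D -` B \<inter> space M"
      by (auto simp: DD_def)
    have "a \<inter> b = D -` (A \<inter> B) \<inter> space M" "A \<inter> B \<in> sets borel" using A B by auto
    thus "a \<inter> b \<in> DD" unfolding DD_def by blast
  qed
  have "indep_set (EE k) DD" for k
  proof -
    have "indep_set (sigma_sets (space M) (EE k)) (sigma_sets (space M) DD)"
    proof -
      have "DD \<subseteq> {(\<lambda>\<omega>. \<lambda>j\<in>{2 ^ k :: nat}. D \<omega>) -` A \<inter> space M | A. A \<in> sets (PiM {2 ^ k} (\<lambda>_. borel))}"
      proof
        fix a assume "a \<in> DD"
        then obtain A where A: "A \<in> sets (borel :: real measure)" "a = D -` A \<inter> space M" by (auto simp: DD_def)
        have "(\<lambda>x. x (2 ^ k)) \<in> measurable (PiM {2 ^ k :: nat} (\<lambda>_. borel :: real measure)) borel"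
          by (rule measurable_component_singleton) simp
        from measurable_sets[OF this A(1)]
        have "(\<lambda>x. x (2 ^ k)) -` A \<inter> space (PiM {2 ^ k :: nat} (\<lambda>_. borel)) \<in> sets (PiM {2 ^ k} (\<lambda>_. borel))" .
        moreover have "a = (\<lambda>\<omega>. \<lambda>j\<in>{2 ^ k :: nat}. D \<omega>) -`
            ((\<lambda>x. x (2 ^ k)) -` A \<inter> space (PiM {2 ^ k :: nat} (\<lambda>_. borel))) \<inter> space M"
          by (auto simp: A space_PiM)
        ultimately show "a \<in> {(\<lambda>\<omega>. \<lambda>j\<in>{2 ^ k :: nat}. D \<omega>) -` A \<inter> space M | A. A \<in> sets (PiM {2 ^ k} (\<lambda>_. borel))}"
          by blast
      qed
      hence "sigma_sets (space M) DD \<subseteq> sigma_sets (space M) {(\<lambda>\<omega>. \<lambda>j\<in>{2 ^ k :: nat}. D \<omega>) -` A \<inter> space M | A. A \<in> sets (PiM {2 ^ k} (\<lambda>_. borel))}"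
        by (intro sigma_sets_mono')
      thus ?thesis
        using ind[of k] unfolding indep_var_eq EE_def indep_sets2_eq by blast
    qed
    moreover have "EE k \<subseteq> sigma_sets (space M) (EE k)" by (auto intro: sigma_sets.Basic)
    moreover have "DD \<subseteq> sigma_sets (space M) DD" by (auto intro: sigma_sets.Basic)
    ultimately show ?thesis unfolding indep_sets2_eq by blast
  qed
  \<comment> \<open>Independence passes from each level to the union, and intersection-stability
    extends it to the generated sigma-algebras.\<close>
  hence "indep_set (\<Union>k. EE k) DD" unfolding indep_sets2_eq by blast
  hence ind2: "indep_set (sigma_sets (space M) (\<Union>k. EE k)) (sigma_sets (space M) DD)"
    by (rule indep_set_sigma_sets[OF _ stable stableD])
  define N where "N = sigma (space M) (\<Union>k. EE k)"
  have sub: "(\<Union>k. EE k) \<subseteq> Pow (space M)" by (auto simp: EE_def)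
  have sN: "space N = space M" and setsN: "sets N = sigma_sets (space M) (\<Union>k. EE k)"
    using sub by (auto simp: N_def)
  have "(\<Union>k. EE k) \<subseteq> sets M" using measurable_sets[OF Xm] by (auto simp: EE_def)
  hence NM: "sets N \<subseteq> sets M" unfolding setsN by (rule sets.sigma_sets_subset)
  have XN: "X k \<in> measurable N (P k)" for k
  proof (rule measurableI)
    show "X k \<omega> \<in> space (P k)" if "\<omega> \<in> space N" for \<omega> using measurable_space[OF Xm] that sN by simp
    show "X k -` A \<inter> space N \<in> sets N" if "A \<in> sets (P k)" for A
      unfolding setsN using that by (intro sigma_sets.Basic) (auto simp: EE_def sN)
  qed
  have grid: "(\<lambda>\<omega>. W (\<tau> k j) \<omega> - W 0 \<omega>) \<in> borel_measurable N" if "j \<le> 2 ^ k" for j k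
    using that
  proof (induction j)
    case 0
    have "\<tau> k 0 = 0" by (simp add: \<tau>_def)
    thus ?case by simp
  next
    case (Suc j)
    have "(\<lambda>\<omega>. X k \<omega> j) \<in> borel_measurable N"
      using measurable_compose[OF XN[of k], of "\<lambda>x. x j" borel] Suc.prems unfolding P_def
      by (auto intro!: measurable_component_singleton)
    hence "(\<lambda>\<omega>. (W (\<tau> k j) \<omega> - W 0 \<omega>) + X k \<omega> j) \<in> borel_measurable N"
      using Suc by (intro borel_measurable_add) auto
    thus ?case using Suc.prems by (simp add: X_def)
  qed
  show ?thesis
  proof (rule that[OF sN NM])
    fix u assume u: "u \<in> {0..s}"
    \<comment> \<open>The grid point just to the left of u; by path continuity, measurability at
      grid points carries over to u.\<close>
    define j where "j k = nat \<lfloor>2 ^ k * u / s\<rfloor>" for k :: nat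
    have j: "j k \<le> 2 ^ k" "real (j k) \<le> 2 ^ k * u / s" "2 ^ k * u / s < real (j k) + 1" for k
    proof -
      have "2 ^ k * u / s \<le> 2 ^ k" using u st by (simp add: field_simps)
      hence "2 ^ k * u / s < of_int (2 ^ k) + 1" by simp
      hence "\<lfloor>2 ^ k * u / s\<rfloor> \<le> 2 ^ k" unfolding floor_le_iff .
      thus "j k \<le> 2 ^ k" by (simp add: j_def nat_le_iff)
      have "0 \<le> 2 ^ k * u / s" using u st by simp
      thus "real (j k) \<le> 2 ^ k * u / s" "2 ^ k * u / s < real (j k) + 1" unfolding j_def by linarith+
    qed
    show "(\<lambda>\<omega>. W u \<omega> - W 0 \<omega>) \<in> borel_measurable N"
    proof (rule borel_measurable_LIMSEQ_real)
      show "(\<lambda>\<omega>. W (\<tau> k (j k)) \<omega> - W 0 \<omega>) \<in> borel_measurable N" for k by (rule grid[OF j(1)])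
      fix \<omega> assume "\<omega> \<in> space N"
      hence cont: "continuous_on {0..} (\<lambda>u. W u \<omega>)" using continuous_paths sN by simp
      have "(\<lambda>k. \<tau> k (j k)) \<longlonglongrightarrow> u"
      proof (rule real_tendsto_sandwich)
        show "\<forall>\<^sub>F k in sequentially. u - s * (1 / 2) ^ k \<le> \<tau> k (j k)"
        proof (intro always_eventually allI)
          fix k
          have "u * 2 ^ k < s * real (j k) + s" using j(3)[of k] st by (simp add: field_simps)
          hence "(u * 2 ^ k - s) / 2 ^ k \<le> s * real (j k) / 2 ^ k" by (intro divide_right_mono) auto
          also have "(u * 2 ^ k - s) / 2 ^ k = u - s * (1 / 2) ^ k" by (simp add: diff_divide_distrib power_one_over)
          finally show "u - s * (1 / 2) ^ k \<le> \<tau> k (j k)" using j(1)[of k] by (simp add: \<tau>_def)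
        qed
        show "\<forall>\<^sub>F k in sequentially. \<tau> k (j k) \<le> u"
          using j st by (intro always_eventually allI) (auto simp: \<tau>_def field_simps)
        have "(\<lambda>k. u - s * (1 / 2) ^ k) \<longlonglongrightarrow> u - s * 0"
          by (intro tendsto_intros LIMSEQ_power_zero) auto
        thus "(\<lambda>k. u - s * (1 / 2) ^ k) \<longlonglongrightarrow> u" by simp
      qed auto
      moreover have "\<tau> k (j k) \<ge> 0" for k using st by (simp add: \<tau>_def)
      ultimately have "(\<lambda>k. W (\<tau> k (j k)) \<omega>) \<longlonglongrightarrow> W u \<omega>"
        using u by (intro continuous_on_tendsto_compose[OF cont]) auto
      thus "(\<lambda>k. W (\<tau> k (j k)) \<omega> - W 0 \<omega>) \<longlonglongrightarrow> W u \<omega> - W 0 \<omega>" by (intro tendsto_intros)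
    qed
  next
    fix S :: "(real \<times> real) measure" and Z assume Z: "Z \<in> measurable N S"
    have "{Z -` A \<inter> space M |A. A \<in> sets S} \<subseteq> sigma_sets (space M) (\<Union>k. EE k)"
      using measurable_sets[OF Z] unfolding sN setsN by auto
    hence "sigma_sets (space M) {Z -` A \<inter> space M |A. A \<in> sets S} \<subseteq> sigma_sets (space M) (\<Union>k. EE k)"
      by (rule sigma_sets_mono)
    hence "indep_set (sigma_sets (space M) {Z -` A \<inter> space M |A. A \<in> sets S}) (sigma_sets (space M) DD)"
      using ind2 unfolding indep_sets2_eq by blast
    moreover have "{(\<lambda>\<omega>. (D \<omega>, 0 :: real)) -` A \<inter> space M |A. A \<in> sets (borel \<Otimes>\<^sub>M borel)} \<subseteq> DD"
    proof clarify
      fix A :: "(real \<times> real) set" assume "A \<in> sets (borel \<Otimes>\<^sub>M borel)"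
      hence "(\<lambda>d. (d, 0)) -` A \<inter> space borel \<in> sets (borel :: real measure)"
        by (intro measurable_sets[of _ _ "borel \<Otimes>\<^sub>M borel"]) auto
      thus "(\<lambda>\<omega>. (D \<omega>, 0)) -` A \<inter> space M \<in> DD"
        unfolding DD_def by (intro CollectI exI[of _ "(\<lambda>d. (d, 0)) -` A \<inter> space borel"]) auto
    qed
    hence "sigma_sets (space M) {(\<lambda>\<omega>. (D \<omega>, 0 :: real)) -` A \<inter> space M |A. A \<in> sets (borel \<Otimes>\<^sub>M borel)}
        \<subseteq> sigma_sets (space M) DD" by (rule sigma_sets_mono')
    ultimately have "indep_set (sigma_sets (space M) {Z -` A \<inter> space M |A. A \<in> sets S})
        (sigma_sets (space M) {(\<lambda>\<omega>. (D \<omega>, 0 :: real)) -` A \<inter> space M |A. A \<in> sets (borel \<Otimes>\<^sub>M borel)})"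
      unfolding indep_sets2_eq by blast
    moreover have "Z \<in> measurable M S"
      using Z NM sN by (auto simp: measurable_def)
    moreover have "(\<lambda>\<omega>. (D \<omega>, 0 :: real)) \<in> measurable M (borel \<Otimes>\<^sub>M borel)" by measurable
    ultimately have "indep_var S Z (borel \<Otimes>\<^sub>M borel) (\<lambda>\<omega>. (D \<omega>, 0))"
      unfolding indep_var_eq by blast
    thus "indep_var S Z (borel \<Otimes>\<^sub>M borel) (\<lambda>\<omega>. (W t \<omega> - W s \<omega>, 0))"
      by (simp only: D_def)
  qed
qed

end

section \<open>Iterated densities of the area functional\<close>

text \<open>The driftless density of A_t^n / n! on the event that the path ends in dy: s is the
  latest of n ordered times, z the position at s, and a heat kernel leads from there to y. Ordering
  the times accounts for the missing n!.\<close>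

fun area_density :: "nat \<Rightarrow> real \<Rightarrow> real \<Rightarrow> ennreal" where
  "area_density 0 t y = ennreal (normal_density 0 (sqrt t) y)"
| "area_density (Suc n) t y = (\<integral>\<^sup>+s. indicator {0<..<t} s *
     (\<integral>\<^sup>+z. area_density n s z * ennreal (\<bar>z\<bar> * normal_density 0 (sqrt (t - s)) (y - z)) \<partial>lborel) \<partial>lborel)"

declare area_density.simps [simp del]

lemma borel_measurable_normal_density2 [measurable (raw)]:
  assumes "m \<in> borel_measurable N" "s \<in> borel_measurable N" "x \<in> borel_measurable N"
  shows "(\<lambda>w. normal_density (m w) (s w) (x w)) \<in> borel_measurable N"
  using assms unfolding normal_density_def by measurable

lemma indicator_greaterThanLessThan: "indicator {a<..<b} s = (if a < s \<and> s < b then 1 else 0)"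
  by (simp add: indicator_def)

lemma measurable_area_density': "(\<lambda>(t, y). area_density n t y) \<in> borel_measurable (borel \<Otimes>\<^sub>M borel)"
proof (induction n)
  case 0
  show ?case unfolding area_density.simps by measurable
next
  case (Suc n)
  \<comment> \<open>The induction hypothesis as a measurability rule, at the product type of the
    variables t, y, s, z.\<close>
  have [measurable (raw)]: "(\<lambda>w. area_density n (f w) (g w)) \<in> borel_measurable N"
    if "f \<in> borel_measurable N" "g \<in> borel_measurable N"
    for N :: "(((real \<times> real) \<times> real) \<times> real) measure" and f g
    using measurable_compose[OF measurable_Pair[OF that] Suc] by simp
  have "(\<lambda>p. \<integral>\<^sup>+s. indicator {0<..<fst p} s *
     (\<integral>\<^sup>+z. area_density n s z * ennreal (\<bar>z\<bar> * normal_density 0 (sqrt (fst p - s)) (snd p - z)) \<partial>lborel) \<partial>lborel)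
      \<in> borel_measurable (borel \<Otimes>\<^sub>M (borel :: real measure))"
    unfolding indicator_greaterThanLessThan by measurable
  thus ?case unfolding area_density.simps case_prod_unfold .
qed

lemma measurable_area_density [measurable (raw)]:
  assumes "f \<in> borel_measurable N" "g \<in> borel_measurable N"
  shows "(\<lambda>w. area_density n (f w) (g w)) \<in> borel_measurable N"
  using measurable_compose[OF measurable_Pair[OF assms] measurable_area_density'] by simp

context standard_brownian_motion
begin

section \<open>Moments with drift as weighted driftless densities\<close>

text \<open>Subtracting \<open>W 0\<close>, which is only almost surely 0, makes every path start at
  0.\<close>

definition drift_path :: "real \<Rightarrow> real \<Rightarrow> 'a \<Rightarrow> real" where
  "drift_path \<nu> u \<omega> = W u \<omega> - W 0 \<omega> + \<nu> * u"

definition abs_area :: "real \<Rightarrow> real \<Rightarrow> 'a \<Rightarrow> real" where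
  "abs_area \<nu> t \<omega> = integral {0..t} (\<lambda>u. \<bar>drift_path \<nu> u \<omega>\<bar>)"

lemma continuous_drift_path: "\<omega> \<in> space M \<Longrightarrow> continuous_on {0..t} (\<lambda>u. drift_path \<nu> u \<omega>)"
  unfolding drift_path_def
  by (intro continuous_intros continuous_on_subset[OF continuous_paths]) auto

lemma measurable_drift_path: "0 \<le> u \<Longrightarrow> drift_path \<nu> u \<in> borel_measurable M"
  unfolding drift_path_def[abs_def] by (intro borel_measurable_add borel_measurable_diff random_variable) auto

lemma measurable_abs_area: "0 \<le> t \<Longrightarrow> abs_area \<nu> t \<in> borel_measurable M"
  unfolding abs_area_def[abs_def]
  by (intro borel_measurable_integral_continuous borel_measurable_abs measurable_drift_path continuous_intros continuous_drift_path) auto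

lemma abs_area_nonneg: "\<omega> \<in> space M \<Longrightarrow> 0 \<le> abs_area \<nu> t \<omega>"
  unfolding abs_area_def
  by (intro integral_nonneg integrable_continuous_real continuous_intros continuous_drift_path) auto

lemma continuous_abs_area:
  assumes "\<omega> \<in> space M" shows "continuous_on {0..t} (\<lambda>s. abs_area \<nu> s \<omega>)"
  unfolding abs_area_def
  by (intro indefinite_integral_continuous_1 integrable_continuous_real continuous_intros continuous_drift_path assms)

lemma nn_integral_increment:
  assumes "0 \<le> s" "s < t" and [measurable]: "g \<in> borel_measurable borel"
  shows "(\<integral>\<^sup>+\<omega>. g (W t \<omega> - W s \<omega>) \<partial>M)
    = (\<integral>\<^sup>+d. ennreal (normal_density 0 (sqrt (t - s)) d) * g d \<partial>lborel)"
  using distributed_nn_integral[OF normal_increments[OF assms(1,2)], of g] by simp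

text \<open>Area and position at time s are functions of the past, hence independent of
  \<open>W t - W s\<close>; the joint law is a product measure, and the increment is integrated out
  by Fubini.\<close>

lemma markov:
  assumes st: "0 < s" "s < t" and F [measurable]: "F \<in> borel_measurable (borel \<Otimes>\<^sub>M borel)"
    and f [measurable]: "f \<in> borel_measurable borel"
  shows "(\<integral>\<^sup>+\<omega>. F (abs_area \<nu> s \<omega>, drift_path \<nu> s \<omega>) * f (drift_path \<nu> t \<omega>) \<partial>M)
    = (\<integral>\<^sup>+\<omega>. F (abs_area \<nu> s \<omega>, drift_path \<nu> s \<omega>) *
        (\<integral>\<^sup>+y. ennreal (normal_density (drift_path \<nu> s \<omega> + \<nu> * (t - s)) (sqrt (t - s)) y) * f y \<partial>lborel) \<partial>M)"
proof -
  obtain N where N: "space N = space M" "sets N \<subseteq> sets M"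
    and WN: "\<And>u. u \<in> {0..s} \<Longrightarrow> (\<lambda>\<omega>. W u \<omega> - W 0 \<omega>) \<in> borel_measurable N"
    and ind: "\<And>(S :: (real \<times> real) measure) Z. Z \<in> measurable N S \<Longrightarrow>
      indep_var S Z (borel \<Otimes>\<^sub>M borel) (\<lambda>\<omega>. (W t \<omega> - W s \<omega>, 0))"
    using indep_past[OF st] by blast
  define Z where "Z \<omega> = (abs_area \<nu> s \<omega>, drift_path \<nu> s \<omega>)" for \<omega>
  define D' where "D' \<omega> = (W t \<omega> - W s \<omega>, 0 :: real)" for \<omega>
  let ?B = "borel \<Otimes>\<^sub>M borel :: (real \<times> real) measure"
  have YN: "drift_path \<nu> u \<in> borel_measurable N" if "u \<in> {0..s}" for u
    unfolding drift_path_def[abs_def] using WN[OF that] by simp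
  have "abs_area \<nu> s \<in> borel_measurable N"
    unfolding abs_area_def[abs_def] using st N(1)
    by (intro borel_measurable_integral_continuous borel_measurable_abs YN continuous_intros continuous_drift_path) auto
  hence "Z \<in> measurable N ?B" unfolding Z_def using YN[of s] st by simp
  hence "indep_var ?B Z ?B D'" unfolding D'_def by (rule ind)
  hence ZD: "Z \<in> measurable M ?B" "D' \<in> measurable M ?B"
    and prod: "distr M ?B Z \<Otimes>\<^sub>M distr M ?B D' = distr M (?B \<Otimes>\<^sub>M ?B) (\<lambda>\<omega>. (Z \<omega>, D' \<omega>))"
    unfolding indep_var_distribution_eq by auto
  note ZD [measurable]
  interpret PD: prob_space "distr M ?B D'" by (rule prob_space_distr) simp
  define h where "h p = F (fst p) * f (snd (fst p) + \<nu> * (t - s) + fst (snd p))"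
    for p :: "(real \<times> real) \<times> (real \<times> real)"
  have hm [measurable]: "h \<in> borel_measurable (?B \<Otimes>\<^sub>M ?B)" unfolding h_def by measurable
  have [measurable]: "(\<lambda>y. h (z, y)) \<in> borel_measurable ?B" for z
    by (rule measurable_Pair2[OF hm]) (simp add: space_pair_measure)
  have "(\<integral>\<^sup>+\<omega>. F (abs_area \<nu> s \<omega>, drift_path \<nu> s \<omega>) * f (drift_path \<nu> t \<omega>) \<partial>M) = (\<integral>\<^sup>+\<omega>. h (Z \<omega>, D' \<omega>) \<partial>M)"
    by (intro nn_integral_cong) (simp add: h_def Z_def D'_def drift_path_def algebra_simps)
  also have "\<dots> = (\<integral>\<^sup>+p. h p \<partial>distr M (?B \<Otimes>\<^sub>M ?B) (\<lambda>\<omega>. (Z \<omega>, D' \<omega>)))"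
    by (subst nn_integral_distr) auto
  also have "\<dots> = (\<integral>\<^sup>+x. \<integral>\<^sup>+y. h (x, y) \<partial>distr M ?B D' \<partial>distr M ?B Z)"
    unfolding prod[symmetric]
    by (rule PD.nn_integral_fst[symmetric]) (simp cong: measurable_cong_sets)
  also have "\<dots> = (\<integral>\<^sup>+\<omega>. \<integral>\<^sup>+y. h (Z \<omega>, y) \<partial>distr M ?B D' \<partial>M)"
    by (subst nn_integral_distr) auto
  also have "\<dots> = (\<integral>\<^sup>+\<omega>. \<integral>\<^sup>+\<omega>'. h (Z \<omega>, D' \<omega>') \<partial>M \<partial>M)"
    by (subst nn_integral_distr) auto
  also have "\<dots> = (\<integral>\<^sup>+\<omega>. F (abs_area \<nu> s \<omega>, drift_path \<nu> s \<omega>) *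
        (\<integral>\<^sup>+y. ennreal (normal_density (drift_path \<nu> s \<omega> + \<nu> * (t - s)) (sqrt (t - s)) y) * f y \<partial>lborel) \<partial>M)"
  proof (intro nn_integral_cong)
    fix \<omega>
    have [measurable]: "(\<lambda>\<omega>'. W t \<omega>' - W s \<omega>') \<in> borel_measurable M"
      using st by (intro borel_measurable_diff random_variable) auto
    define c where "c = drift_path \<nu> s \<omega> + \<nu> * (t - s)"
    have "(\<integral>\<^sup>+\<omega>'. h (Z \<omega>, D' \<omega>') \<partial>M) = (\<integral>\<^sup>+\<omega>'. F (Z \<omega>) * f (c + (W t \<omega>' - W s \<omega>')) \<partial>M)"
      by (simp add: h_def D'_def Z_def c_def)
    also have "\<dots> = F (Z \<omega>) * (\<integral>\<^sup>+\<omega>'. f (c + (W t \<omega>' - W s \<omega>')) \<partial>M)"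
      by (rule nn_integral_cmult) measurable
    also have "(\<integral>\<^sup>+\<omega>'. f (c + (W t \<omega>' - W s \<omega>')) \<partial>M)
       = (\<integral>\<^sup>+d. ennreal (normal_density 0 (sqrt (t - s)) d) * f (c + d) \<partial>lborel)"
      using st by (intro nn_integral_increment) auto
    also have "\<dots> = (\<integral>\<^sup>+d. ennreal (normal_density c (sqrt (t - s)) (c + 1 * d)) * f (c + 1 * d) \<partial>lborel)"
      by (simp add: normal_density_def)
    also have "\<dots> = (\<integral>\<^sup>+y. ennreal (normal_density c (sqrt (t - s)) y) * f y \<partial>lborel)"
      using nn_integral_real_affine[of "\<lambda>y. ennreal (normal_density c (sqrt (t - s)) y) * f y" 1 c] by simp
    finally show "(\<integral>\<^sup>+\<omega>'. h (Z \<omega>, D' \<omega>') \<partial>M) = F (abs_area \<nu> s \<omega>, drift_path \<nu> s \<omega>) *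
        (\<integral>\<^sup>+y. ennreal (normal_density (drift_path \<nu> s \<omega> + \<nu> * (t - s)) (sqrt (t - s)) y) * f y \<partial>lborel)"
      by (simp add: Z_def c_def)
  qed
  finally show ?thesis .
qed

text \<open>A_t^(n+1) is (n + 1) times the time integral of |Y_s| A_s^n; the expectation is taken
  inside and \<open>markov\<close> applied at each s. The end points 0 and t, excluded there, form a
  null set.\<close>

lemma abs_area_power_Suc:
  assumes t: "0 < t" and f [measurable]: "f \<in> borel_measurable borel"
  shows "(\<integral>\<^sup>+\<omega>. ennreal (abs_area \<nu> t \<omega> ^ Suc n) * f (drift_path \<nu> t \<omega>) \<partial>M)
    = ennreal (real (Suc n)) * (\<integral>\<^sup>+s. indicator {0<..<t} s *
        (\<integral>\<^sup>+\<omega>. ennreal (abs_area \<nu> s \<omega> ^ n) * (ennreal \<bar>drift_path \<nu> s \<omega>\<bar> *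
        (\<integral>\<^sup>+y. ennreal (normal_density (drift_path \<nu> s \<omega> + \<nu> * (t - s)) (sqrt (t - s)) y) * f y \<partial>lborel)) \<partial>M) \<partial>lborel)"
proof -
  define c where "c s = max 0 (min s t)" for s
  have c [simp]: "s \<in> {0..t} \<Longrightarrow> c s = s" for s by (auto simp: c_def)
  have [measurable]: "drift_path \<nu> t \<in> borel_measurable M" using t by (intro measurable_drift_path) auto
  have "(\<lambda>p. \<bar>drift_path \<nu> (max 0 (min (fst p) t)) (snd p)\<bar> * abs_area \<nu> (max 0 (min (fst p) t)) (snd p) ^ n) \<in> borel_measurable (borel \<Otimes>\<^sub>M M)"
    using t
    by (intro borel_measurable_pair_continuous[where f = "\<lambda>u \<omega>. \<bar>drift_path \<nu> u \<omega>\<bar> * abs_area \<nu> u \<omega> ^ n"])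
      (auto intro!: borel_measurable_times borel_measurable_power borel_measurable_abs measurable_drift_path measurable_abs_area
        continuous_intros continuous_drift_path continuous_abs_area)
  hence m: "(\<lambda>p. \<bar>drift_path \<nu> (c (fst p)) (snd p)\<bar> * abs_area \<nu> (c (fst p)) (snd p) ^ n) \<in> borel_measurable (borel \<Otimes>\<^sub>M M)"
    by (simp add: c_def)
  have [measurable]: "(\<lambda>(\<omega>, s). \<bar>drift_path \<nu> (c s) \<omega>\<bar> * abs_area \<nu> (c s) \<omega> ^ n) \<in> borel_measurable (M \<Otimes>\<^sub>M lborel)"
    using measurable_compose[OF _ m, of "\<lambda>p. (snd p, fst p)" "M \<Otimes>\<^sub>M lborel"] by (simp add: case_prod_unfold)
  have "(\<integral>\<^sup>+\<omega>. ennreal (abs_area \<nu> t \<omega> ^ Suc n) * f (drift_path \<nu> t \<omega>) \<partial>M) =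
    (\<integral>\<^sup>+\<omega>. ennreal (real (Suc n)) * (\<integral>\<^sup>+s. indicator {0..t} s * ennreal (\<bar>drift_path \<nu> (c s) \<omega>\<bar> * abs_area \<nu> (c s) \<omega> ^ n) * f (drift_path \<nu> t \<omega>) \<partial>lborel) \<partial>M)"
  proof (intro nn_integral_cong)
    fix \<omega> assume \<omega>: "\<omega> \<in> space M"
    have "ennreal (abs_area \<nu> t \<omega> ^ Suc n) = ennreal (real (Suc n)) *
       (\<integral>\<^sup>+s. indicator {0..t} s * ennreal (\<bar>drift_path \<nu> s \<omega>\<bar> * abs_area \<nu> s \<omega> ^ n) \<partial>lborel)"
      unfolding abs_area_def using t by (intro power_integral_continuous continuous_intros continuous_drift_path \<omega>) auto
    also have "(\<integral>\<^sup>+s. indicator {0..t} s * ennreal (\<bar>drift_path \<nu> s \<omega>\<bar> * abs_area \<nu> s \<omega> ^ n) \<partial>lborel)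
       = (\<integral>\<^sup>+s. indicator {0..t} s * ennreal (\<bar>drift_path \<nu> (c s) \<omega>\<bar> * abs_area \<nu> (c s) \<omega> ^ n) \<partial>lborel)"
      by (intro nn_integral_cong) (auto simp: indicator_def)
    finally show "ennreal (abs_area \<nu> t \<omega> ^ Suc n) * f (drift_path \<nu> t \<omega>) = ennreal (real (Suc n)) *
       (\<integral>\<^sup>+s. indicator {0..t} s * ennreal (\<bar>drift_path \<nu> (c s) \<omega>\<bar> * abs_area \<nu> (c s) \<omega> ^ n) * f (drift_path \<nu> t \<omega>) \<partial>lborel)"
      using \<omega> by (subst nn_integral_multc) (auto simp: mult.assoc)
  qed
  also have "\<dots> = ennreal (real (Suc n)) * (\<integral>\<^sup>+\<omega>. \<integral>\<^sup>+s. indicator {0..t} s * ennreal (\<bar>drift_path \<nu> (c s) \<omega>\<bar> * abs_area \<nu> (c s) \<omega> ^ n) * f (drift_path \<nu> t \<omega>) \<partial>lborel \<partial>M)"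
    by (rule nn_integral_cmult) measurable
  also have "(\<integral>\<^sup>+\<omega>. \<integral>\<^sup>+s. indicator {0..t} s * ennreal (\<bar>drift_path \<nu> (c s) \<omega>\<bar> * abs_area \<nu> (c s) \<omega> ^ n) * f (drift_path \<nu> t \<omega>) \<partial>lborel \<partial>M)
     = (\<integral>\<^sup>+s. \<integral>\<^sup>+\<omega>. indicator {0..t} s * ennreal (\<bar>drift_path \<nu> (c s) \<omega>\<bar> * abs_area \<nu> (c s) \<omega> ^ n) * f (drift_path \<nu> t \<omega>) \<partial>M \<partial>lborel)"
  proof -
    interpret pair_sigma_finite M lborel ..
    show ?thesis by (rule Fubini'[symmetric]) measurable
  qed
  also have "\<dots> = (\<integral>\<^sup>+s. indicator {0<..<t} s *
        (\<integral>\<^sup>+\<omega>. ennreal (abs_area \<nu> s \<omega> ^ n) * (ennreal \<bar>drift_path \<nu> s \<omega>\<bar> *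
        (\<integral>\<^sup>+y. ennreal (normal_density (drift_path \<nu> s \<omega> + \<nu> * (t - s)) (sqrt (t - s)) y) * f y \<partial>lborel)) \<partial>M) \<partial>lborel)"
  proof (rule nn_integral_cong_AE)
    have "AE s in lborel. s \<noteq> 0 \<and> s \<noteq> t" using AE_lborel_singleton[of 0] AE_lborel_singleton[of t] by eventually_elim auto
    thus "AE s in lborel. (\<integral>\<^sup>+\<omega>. indicator {0..t} s * ennreal (\<bar>drift_path \<nu> (c s) \<omega>\<bar> * abs_area \<nu> (c s) \<omega> ^ n) * f (drift_path \<nu> t \<omega>) \<partial>M)
      = indicator {0<..<t} s *
        (\<integral>\<^sup>+\<omega>. ennreal (abs_area \<nu> s \<omega> ^ n) * (ennreal \<bar>drift_path \<nu> s \<omega>\<bar> *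
        (\<integral>\<^sup>+y. ennreal (normal_density (drift_path \<nu> s \<omega> + \<nu> * (t - s)) (sqrt (t - s)) y) * f y \<partial>lborel)) \<partial>M)"
    proof eventually_elim
      case (elim s)
      show ?case
      proof (cases "s \<in> {0<..<t}")
        case True
        hence s: "0 < s" "s < t" "c s = s" by auto
        have "(\<integral>\<^sup>+\<omega>. indicator {0..t} s * ennreal (\<bar>drift_path \<nu> (c s) \<omega>\<bar> * abs_area \<nu> (c s) \<omega> ^ n) * f (drift_path \<nu> t \<omega>) \<partial>M)
          = (\<integral>\<^sup>+\<omega>. (\<lambda>(a, y). ennreal (\<bar>y\<bar> * a ^ n)) (abs_area \<nu> s \<omega>, drift_path \<nu> s \<omega>) * f (drift_path \<nu> t \<omega>) \<partial>M)"
          using s by simp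
        also have "\<dots> = (\<integral>\<^sup>+\<omega>. (\<lambda>(a, y). ennreal (\<bar>y\<bar> * a ^ n)) (abs_area \<nu> s \<omega>, drift_path \<nu> s \<omega>) *
           (\<integral>\<^sup>+y. ennreal (normal_density (drift_path \<nu> s \<omega> + \<nu> * (t - s)) (sqrt (t - s)) y) * f y \<partial>lborel) \<partial>M)"
          by (rule markov[OF s(1,2)]) measurable
        also have "\<dots> = (\<integral>\<^sup>+\<omega>. ennreal (abs_area \<nu> s \<omega> ^ n) * (ennreal \<bar>drift_path \<nu> s \<omega>\<bar> *
          (\<integral>\<^sup>+y. ennreal (normal_density (drift_path \<nu> s \<omega> + \<nu> * (t - s)) (sqrt (t - s)) y) * f y \<partial>lborel)) \<partial>M)"
          using abs_area_nonneg by (intro nn_integral_cong) (simp add: ennreal_mult mult_ac)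
        finally show ?thesis using True by simp
      qed (use elim in \<open>auto simp: indicator_def\<close>)
    qed
  qed
  finally show ?thesis .
qed

text \<open>The induction runs over all test functions: its step uses the hypothesis at time s for
  the heat-kernel integral of f, weighted by |z|, as a function of the position z.\<close>

lemma abs_area_power_density:
  assumes t: "0 < t" and f: "f \<in> borel_measurable borel"
  shows "(\<integral>\<^sup>+\<omega>. ennreal (abs_area \<nu> t \<omega> ^ n) * f (drift_path \<nu> t \<omega>) \<partial>M)
    = ennreal (fact n) * (\<integral>\<^sup>+y. area_density n t y * ennreal (exp (\<nu> * y - \<nu>\<^sup>2 * t / 2)) * f y \<partial>lborel)"
  using assms
proof (induction n arbitrary: t f)
  case (0 t f)
  note [measurable] = 0(2)
  have [measurable]: "W t \<in> borel_measurable M" "W 0 \<in> borel_measurable M" using 0 by (auto intro: random_variable)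
  have "(\<integral>\<^sup>+\<omega>. ennreal (abs_area \<nu> t \<omega> ^ 0) * f (drift_path \<nu> t \<omega>) \<partial>M) = (\<integral>\<^sup>+\<omega>. f (\<nu> * t + (W t \<omega> - W 0 \<omega>)) \<partial>M)"
    by (simp add: drift_path_def add_ac)
  also have "\<dots> = (\<integral>\<^sup>+d. ennreal (normal_density 0 (sqrt (t - 0)) d) * f (\<nu> * t + d) \<partial>lborel)"
    using 0 by (intro nn_integral_increment) auto
  also have "\<dots> = (\<integral>\<^sup>+d. ennreal (normal_density 0 (sqrt t) (\<nu> * t + 1 * d - \<nu> * t)) * f (\<nu> * t + 1 * d) \<partial>lborel)"
    by simp
  also have "\<dots> = (\<integral>\<^sup>+y. ennreal (normal_density 0 (sqrt t) (y - \<nu> * t)) * f y \<partial>lborel)"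
    using nn_integral_real_affine[of "\<lambda>y. ennreal (normal_density 0 (sqrt t) (y - \<nu> * t)) * f y" 1 "\<nu> * t"] by simp
  finally have *: "(\<integral>\<^sup>+\<omega>. ennreal (abs_area \<nu> t \<omega> ^ 0) * f (drift_path \<nu> t \<omega>) \<partial>M)
    = (\<integral>\<^sup>+y. ennreal (normal_density 0 (sqrt t) (y - \<nu> * t)) * f y \<partial>lborel)" .
  have "normal_density 0 (sqrt t) (y - \<nu> * t) = normal_density 0 (sqrt t) y * exp (\<nu> * y - \<nu>\<^sup>2 * t / 2)" for y
  proof -
    have "- (y - \<nu> * t)\<^sup>2 / (2 * t) = - y\<^sup>2 / (2 * t) + (\<nu> * y - \<nu>\<^sup>2 * t / 2)"
      using 0 by (simp add: field_simps power2_eq_square)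
    hence "exp (- (y - \<nu> * t)\<^sup>2 / (2 * t)) = exp (- y\<^sup>2 / (2 * t)) * exp (\<nu> * y - \<nu>\<^sup>2 * t / 2)"
      by (simp only: exp_add)
    thus ?thesis using 0 by (simp add: normal_density_def)
  qed
  thus ?case unfolding * by (simp add: area_density.simps ennreal_mult' normal_density_nonneg)
next
  case (Suc n t f)
  note [measurable] = Suc.prems(2)
  \<comment> \<open>The exponential weight at time s absorbs the drift of the kernel from s to t and
    becomes the weight at time t, which leaves the driftless recursion.\<close>
  have tilt: "exp (\<nu> * z - \<nu>\<^sup>2 * s / 2) * normal_density (z + \<nu> * (t - s)) (sqrt (t - s)) y
      = exp (\<nu> * y - \<nu>\<^sup>2 * t / 2) * normal_density 0 (sqrt (t - s)) (y - z)" if "s < t" for s z y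
  proof -
    have "- (y - (z + \<nu> * (t - s)))\<^sup>2 / (2 * (t - s)) + (\<nu> * z - \<nu>\<^sup>2 * s / 2)
       = - (y - z)\<^sup>2 / (2 * (t - s)) + (\<nu> * y - \<nu>\<^sup>2 * t / 2)"
      using that by (simp add: divide_simps) (simp add: algebra_simps power2_eq_square)
    hence "exp (- (y - (z + \<nu> * (t - s)))\<^sup>2 / (2 * (t - s))) * exp (\<nu> * z - \<nu>\<^sup>2 * s / 2)
       = exp (- (y - z)\<^sup>2 / (2 * (t - s))) * exp (\<nu> * y - \<nu>\<^sup>2 * t / 2)"
      by (simp only: exp_add[symmetric])
    thus ?thesis using that by (simp add: normal_density_def mult_ac)
  qed
  have "(\<integral>\<^sup>+\<omega>. ennreal (abs_area \<nu> t \<omega> ^ Suc n) * f (drift_path \<nu> t \<omega>) \<partial>M)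
    = ennreal (real (Suc n)) * (\<integral>\<^sup>+s. indicator {0<..<t} s *
        (\<integral>\<^sup>+\<omega>. ennreal (abs_area \<nu> s \<omega> ^ n) * (ennreal \<bar>drift_path \<nu> s \<omega>\<bar> *
        (\<integral>\<^sup>+y. ennreal (normal_density (drift_path \<nu> s \<omega> + \<nu> * (t - s)) (sqrt (t - s)) y) * f y \<partial>lborel)) \<partial>M) \<partial>lborel)"
    by (rule abs_area_power_Suc[OF Suc.prems])
  also have "\<dots> = ennreal (real (Suc n)) * (\<integral>\<^sup>+s. ennreal (fact n) * (\<integral>\<^sup>+y.
     indicator {0<..<t} s * (\<integral>\<^sup>+z. area_density n s z * ennreal (\<bar>z\<bar> * normal_density 0 (sqrt (t - s)) (y - z)) \<partial>lborel)
        * (ennreal (exp (\<nu> * y - \<nu>\<^sup>2 * t / 2)) * f y) \<partial>lborel) \<partial>lborel)"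
  proof (rule arg_cong2[of _ _ _ _ "(*)", OF refl], rule nn_integral_cong)
    fix s
    show "indicator {0<..<t} s *
        (\<integral>\<^sup>+\<omega>. ennreal (abs_area \<nu> s \<omega> ^ n) * (ennreal \<bar>drift_path \<nu> s \<omega>\<bar> *
        (\<integral>\<^sup>+y. ennreal (normal_density (drift_path \<nu> s \<omega> + \<nu> * (t - s)) (sqrt (t - s)) y) * f y \<partial>lborel)) \<partial>M)
      = ennreal (fact n) * (\<integral>\<^sup>+y.
     indicator {0<..<t} s * (\<integral>\<^sup>+z. area_density n s z * ennreal (\<bar>z\<bar> * normal_density 0 (sqrt (t - s)) (y - z)) \<partial>lborel)
        * (ennreal (exp (\<nu> * y - \<nu>\<^sup>2 * t / 2)) * f y) \<partial>lborel)"
    proof (cases "s \<in> {0<..<t}")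
      case True
      hence s: "0 < s" "s < t" by auto
      have "(\<integral>\<^sup>+\<omega>. ennreal (abs_area \<nu> s \<omega> ^ n) * (ennreal \<bar>drift_path \<nu> s \<omega>\<bar> *
        (\<integral>\<^sup>+y. ennreal (normal_density (drift_path \<nu> s \<omega> + \<nu> * (t - s)) (sqrt (t - s)) y) * f y \<partial>lborel)) \<partial>M)
        = ennreal (fact n) * (\<integral>\<^sup>+z. area_density n s z * ennreal (exp (\<nu> * z - \<nu>\<^sup>2 * s / 2)) * (ennreal \<bar>z\<bar> *
        (\<integral>\<^sup>+y. ennreal (normal_density (z + \<nu> * (t - s)) (sqrt (t - s)) y) * f y \<partial>lborel)) \<partial>lborel)"
        by (rule Suc.IH[of s "\<lambda>z. ennreal \<bar>z\<bar> *
          (\<integral>\<^sup>+y. ennreal (normal_density (z + \<nu> * (t - s)) (sqrt (t - s)) y) * f y \<partial>lborel)", OF s(1)]) measurable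
      also have "(\<integral>\<^sup>+z. area_density n s z * ennreal (exp (\<nu> * z - \<nu>\<^sup>2 * s / 2)) * (ennreal \<bar>z\<bar> *
        (\<integral>\<^sup>+y. ennreal (normal_density (z + \<nu> * (t - s)) (sqrt (t - s)) y) * f y \<partial>lborel)) \<partial>lborel)
       = (\<integral>\<^sup>+z. \<integral>\<^sup>+y. area_density n s z * ennreal (\<bar>z\<bar> * normal_density 0 (sqrt (t - s)) (y - z)) *
           (ennreal (exp (\<nu> * y - \<nu>\<^sup>2 * t / 2)) * f y) \<partial>lborel \<partial>lborel)"
      proof (intro nn_integral_cong)
        fix z
        have "area_density n s z * ennreal (exp (\<nu> * z - \<nu>\<^sup>2 * s / 2)) * (ennreal \<bar>z\<bar> *
         (\<integral>\<^sup>+y. ennreal (normal_density (z + \<nu> * (t - s)) (sqrt (t - s)) y) * f y \<partial>lborel))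
         = (\<integral>\<^sup>+y. area_density n s z * ennreal \<bar>z\<bar> * ennreal (exp (\<nu> * z - \<nu>\<^sup>2 * s / 2) * normal_density (z + \<nu> * (t - s)) (sqrt (t - s)) y) * f y \<partial>lborel)"
          by (simp add: ennreal_mult' mult_ac nn_integral_cmult[symmetric])
        also have "\<dots> = (\<integral>\<^sup>+y. area_density n s z * ennreal (\<bar>z\<bar> * normal_density 0 (sqrt (t - s)) (y - z)) *
           (ennreal (exp (\<nu> * y - \<nu>\<^sup>2 * t / 2)) * f y) \<partial>lborel)"
          unfolding tilt[OF s(2)] by (simp add: ennreal_mult' mult_ac)
        finally show "area_density n s z * ennreal (exp (\<nu> * z - \<nu>\<^sup>2 * s / 2)) * (ennreal \<bar>z\<bar> *
         (\<integral>\<^sup>+y. ennreal (normal_density (z + \<nu> * (t - s)) (sqrt (t - s)) y) * f y \<partial>lborel)) = \<dots>" .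
      qed
      also have "\<dots> = (\<integral>\<^sup>+y. \<integral>\<^sup>+z. area_density n s z * ennreal (\<bar>z\<bar> * normal_density 0 (sqrt (t - s)) (y - z)) *
           (ennreal (exp (\<nu> * y - \<nu>\<^sup>2 * t / 2)) * f y) \<partial>lborel \<partial>lborel)"
        by (rule lborel_pair.Fubini') measurable
      also have "\<dots> = (\<integral>\<^sup>+y. (\<integral>\<^sup>+z. area_density n s z * ennreal (\<bar>z\<bar> * normal_density 0 (sqrt (t - s)) (y - z)) \<partial>lborel) *
           (ennreal (exp (\<nu> * y - \<nu>\<^sup>2 * t / 2)) * f y) \<partial>lborel)"
        by (intro nn_integral_cong nn_integral_multc) measurable
      finally show ?thesis using True by simp
    qed simp
  qed
  also have "\<dots> = ennreal (real (Suc n)) * (ennreal (fact n) * (\<integral>\<^sup>+s. \<integral>\<^sup>+y.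
     indicator {0<..<t} s * (\<integral>\<^sup>+z. area_density n s z * ennreal (\<bar>z\<bar> * normal_density 0 (sqrt (t - s)) (y - z)) \<partial>lborel)
        * (ennreal (exp (\<nu> * y - \<nu>\<^sup>2 * t / 2)) * f y) \<partial>lborel \<partial>lborel))"
    by (intro arg_cong2[of _ _ _ _ "(*)"] refl nn_integral_cmult) measurable
  also have "(\<integral>\<^sup>+s. \<integral>\<^sup>+y.
     indicator {0<..<t} s * (\<integral>\<^sup>+z. area_density n s z * ennreal (\<bar>z\<bar> * normal_density 0 (sqrt (t - s)) (y - z)) \<partial>lborel)
        * (ennreal (exp (\<nu> * y - \<nu>\<^sup>2 * t / 2)) * f y) \<partial>lborel \<partial>lborel)
     = (\<integral>\<^sup>+y. \<integral>\<^sup>+s.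
     indicator {0<..<t} s * (\<integral>\<^sup>+z. area_density n s z * ennreal (\<bar>z\<bar> * normal_density 0 (sqrt (t - s)) (y - z)) \<partial>lborel)
        * (ennreal (exp (\<nu> * y - \<nu>\<^sup>2 * t / 2)) * f y) \<partial>lborel \<partial>lborel)"
    by (rule lborel_pair.Fubini') measurable
  also have "\<dots> = (\<integral>\<^sup>+y. area_density (Suc n) t y * (ennreal (exp (\<nu> * y - \<nu>\<^sup>2 * t / 2)) * f y) \<partial>lborel)"
    unfolding area_density.simps by (intro nn_integral_cong nn_integral_multc) measurable
  finally show ?case by (simp add: ennreal_mult' mult.assoc)
qed

end

section \<open>The Laplace transform in time\<close>

definition std_normal_cdf :: "real \<Rightarrow> real" where
  "std_normal_cdf = cdf (density lborel std_normal_density)"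

lemma real_distribution_std_normal: "real_distribution (density lborel std_normal_density)"
  by (rule real_distribution.intro) (auto intro!: prob_space_normal_density real_distribution_axioms.intro)

lemma std_normal_cdf_diff:
  assumes "x \<le> y"
  shows "std_normal_cdf y - std_normal_cdf x = integral {x..y} std_normal_density"
proof (cases "x = y")
  case False
  hence xy: "x < y" using assms by simp
  interpret real_distribution "density lborel std_normal_density" by (rule real_distribution_std_normal)
  have c: "continuous_on {x..y} std_normal_density"
    unfolding normal_density_def by (intro continuous_intros) auto
  have "emeasure (density lborel std_normal_density) {x<..y} = (\<integral>\<^sup>+z. ennreal (std_normal_density z) * indicator {x<..y} z \<partial>lborel)"
    by (rule emeasure_density) auto
  also have "\<dots> = (\<integral>\<^sup>+z. ennreal (indicator {x..y} z *\<^sub>R std_normal_density z) \<partial>lborel)"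
  proof (rule nn_integral_cong_AE)
    show "AE z in lborel. ennreal (std_normal_density z) * indicator {x<..y} z = ennreal (indicator {x..y} z *\<^sub>R std_normal_density z)"
      using AE_lborel_singleton[of x] by eventually_elim (auto simp: indicator_def)
  qed
  also have "\<dots> = ennreal (LINT z:{x..y}|lborel. std_normal_density z)"
    unfolding set_lebesgue_integral_def
    using borel_integrable_atLeastAtMost'[OF c] unfolding set_integrable_def
    by (rule nn_integral_eq_integral) (auto simp: indicator_def)
  also have "(LINT z:{x..y}|lborel. std_normal_density z) = integral {x..y} std_normal_density"
    by (rule set_borel_integral_eq_integral(2)[OF borel_integrable_atLeastAtMost'[OF c]])
  finally have "measure (density lborel std_normal_density) {x<..y} = integral {x..y} std_normal_density"
    by (simp add: measure_def integral_nonneg[OF integrable_continuous_real[OF c]])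
  thus ?thesis unfolding std_normal_cdf_def cdf_diff_eq[OF xy] .
qed simp

lemma has_real_derivative_std_normal_cdf: "(std_normal_cdf has_real_derivative std_normal_density x) (at x)"
proof -
  have c: "continuous_on {x - 1..x + 1} std_normal_density"
    unfolding normal_density_def by (intro continuous_intros) auto
  have "((\<lambda>u. std_normal_cdf (x - 1) + integral {x - 1..u} std_normal_density) has_real_derivative 0 + std_normal_density x) (at x within {x - 1..x + 1})"
    by (intro DERIV_add DERIV_const integral_has_real_derivative[OF c]) auto
  hence "((\<lambda>u. std_normal_cdf (x - 1) + integral {x - 1..u} std_normal_density) has_real_derivative std_normal_density x) (at x within {x - 1<..<x + 1})"
    by (auto elim: DERIV_subset)
  hence "((\<lambda>u. std_normal_cdf (x - 1) + integral {x - 1..u} std_normal_density) has_real_derivative std_normal_density x) (at x)"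
    by (subst (asm) at_within_open) auto
  thus ?thesis
    by (rule has_field_derivative_transform_within_open[of _ _ _ "{x-1<..<x+1}"])
      (auto simp: std_normal_cdf_diff[symmetric])
qed

lemma std_normal_cdf_at_top: "(std_normal_cdf \<longlongrightarrow> 1) at_top" and std_normal_cdf_at_bot: "(std_normal_cdf \<longlongrightarrow> 0) at_bot"
proof -
  interpret real_distribution "density lborel std_normal_density" by (rule real_distribution_std_normal)
  show "(std_normal_cdf \<longlongrightarrow> 1) at_top" unfolding std_normal_cdf_def by (rule cdf_lim_at_top_prob)
  show "(std_normal_cdf \<longlongrightarrow> 0) at_bot" unfolding std_normal_cdf_def by (rule cdf_lim_at_bot)
qed

lemma heat_kernel_Laplace:
  assumes "y \<noteq> 0"
  shows "(\<integral>\<^sup>+t. indicator {0<..} t * ennreal (exp (- t / 2) * normal_density 0 (sqrt t) y) \<partial>lborel) = ennreal (exp (- \<bar>y\<bar>))"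
proof -
  define a where "a = \<bar>y\<bar>"
  have a: "a > 0" "y\<^sup>2 = a\<^sup>2" using assms by (auto simp: a_def)
  define f where "f t = exp (- t / 2) * normal_density 0 (sqrt t) y" for t
  \<comment> \<open>An antiderivative of the kind known from the inverse Gaussian law. Completing
    the square turns both normal densities with their prefactors into \<open>f t * sqrt t\<close>,
    and the contributions of a in the inner derivatives cancel. The limits at 0 and at infinity
    differ by exp (-a).\<close>
  define F where "F t = exp (- a) * std_normal_cdf (sqrt t - a / sqrt t) + exp a * std_normal_cdf (sqrt t + a / sqrt t)" for t
  have F: "(F has_real_derivative f t) (at t)" if t: "t > 0" for t
  proof -
    let ?m = "std_normal_density (sqrt t - a / sqrt t)" and ?p = "std_normal_density (sqrt t + a / sqrt t)"
    have "(F has_real_derivative exp (- a) * (?m * (1 / (2 * sqrt t) + a / (2 * t * sqrt t)))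
       + exp a * (?p * (1 / (2 * sqrt t) - a / (2 * t * sqrt t)))) (at t)"
      unfolding F_def using t
      by (auto intro!: derivative_eq_intros DERIV_chain2[OF has_real_derivative_std_normal_cdf] simp: field_simps)
    moreover have "exp (- a) * ?m = f t * sqrt t"
    proof -
      have "- (sqrt t - a / sqrt t)\<^sup>2 / 2 - a = - t / 2 - a\<^sup>2 / (2 * t)"
        using t by (simp add: power2_diff power_divide field_simps) (simp add: power2_eq_square)?
      hence "exp (- a) * exp (- (sqrt t - a / sqrt t)\<^sup>2 / 2) = exp (- t / 2) * exp (- a\<^sup>2 / (2 * t))"
        by (simp add: exp_add[symmetric])
      thus ?thesis using t a by (simp add: f_def normal_density_def real_sqrt_mult)
    qed
    moreover have "exp a * ?p = f t * sqrt t"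
    proof -
      have "- (sqrt t + a / sqrt t)\<^sup>2 / 2 + a = - t / 2 - a\<^sup>2 / (2 * t)"
        using t by (simp add: power2_sum power_divide field_simps) (simp add: power2_eq_square)?
      hence "exp a * exp (- (sqrt t + a / sqrt t)\<^sup>2 / 2) = exp (- t / 2) * exp (- a\<^sup>2 / (2 * t))"
        by (simp add: exp_add[symmetric])
      thus ?thesis using t a by (simp add: f_def normal_density_def real_sqrt_mult)
    qed
    ultimately have "(F has_real_derivative f t * sqrt t * (1 / (2 * sqrt t) + a / (2 * t * sqrt t))
       + f t * sqrt t * (1 / (2 * sqrt t) - a / (2 * t * sqrt t))) (at t)"
      by (simp only: mult.assoc[symmetric])
    also have "f t * sqrt t * (1 / (2 * sqrt t) + a / (2 * t * sqrt t))
       + f t * sqrt t * (1 / (2 * sqrt t) - a / (2 * t * sqrt t)) = f t"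
      using t by (simp add: field_simps)
    finally show ?thesis .
  qed
  have cont: "isCont f t" if "t > 0" for t
    unfolding f_def normal_density_def using that by (intro continuous_intros) auto

  have lim0: "(F \<longlongrightarrow> exp a) (at_right 0)"
  proof -
    have "filterlim (\<lambda>t. sqrt t - a / sqrt t) at_bot (at_right 0)"
      using a by real_asymp
    moreover have "filterlim (\<lambda>t. sqrt t + a / sqrt t) at_top (at_right 0)"
      using a by real_asymp
    ultimately have "(F \<longlongrightarrow> exp (- a) * 0 + exp a * 1) (at_right 0)"
      unfolding F_def
      by (intro tendsto_intros filterlim_compose[OF std_normal_cdf_at_bot] filterlim_compose[OF std_normal_cdf_at_top])
    thus ?thesis by simp
  qed
  have liminf: "(F \<longlongrightarrow> exp (- a) + exp a) at_top"
  proof -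
    have "filterlim (\<lambda>t. sqrt t - a / sqrt t) at_top at_top"
      using a by real_asymp
    moreover have "filterlim (\<lambda>t. sqrt t + a / sqrt t) at_top at_top"
      using a by real_asymp
    ultimately have "(F \<longlongrightarrow> exp (- a) * 1 + exp a * 1) at_top"
      unfolding F_def by (intro tendsto_intros filterlim_compose[OF std_normal_cdf_at_top])
    thus ?thesis by simp
  qed
  have f0: "0 \<le> f t" for t by (simp add: f_def)
  have *: "set_integrable lborel (einterval 0 \<infinity>) f" "(LBINT t=0..\<infinity>. f t) = (exp (- a) + exp a) - exp a"
  proof (rule_tac [!] interval_integral_FTC_nonneg)
    show "((F \<circ> real_of_ereal) \<longlongrightarrow> exp a) (at_right 0)" "((F \<circ> real_of_ereal) \<longlongrightarrow> exp a) (at_right 0)"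
      using lim0 by (simp_all add: ereal_tendsto_simps zero_ereal_def)
    show "((F \<circ> real_of_ereal) \<longlongrightarrow> exp (- a) + exp a) (at_left \<infinity>)" "((F \<circ> real_of_ereal) \<longlongrightarrow> exp (- a) + exp a) (at_left \<infinity>)"
      using liminf by (simp_all add: ereal_tendsto_simps)
  qed (use F cont f0 in \<open>auto simp: zero_ereal_def\<close>)
  have e: "einterval 0 \<infinity> = {0<..}" by (auto simp: einterval_def zero_ereal_def)
  have "(\<integral>\<^sup>+t. indicator {0<..} t * ennreal (f t) \<partial>lborel) = (\<integral>\<^sup>+t. ennreal (indicator {0<..} t *\<^sub>R f t) \<partial>lborel)"
    by (intro nn_integral_cong) (auto simp: indicator_def)
  also have "\<dots> = ennreal (\<integral>t. indicator {0<..} t *\<^sub>R f t \<partial>lborel)"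
    using *(1) unfolding set_integrable_def e
    by (rule nn_integral_eq_integral) (auto simp: indicator_def f_def)
  also have "(\<integral>t. indicator {0<..} t *\<^sub>R f t \<partial>lborel) = exp (- a)"
    using *(2) by (simp add: interval_lebesgue_integral_def e set_lebesgue_integral_def)
  finally show ?thesis by (simp add: f_def a_def)
qed

lemma borel_measurable_poly [measurable (raw)]:
  fixes p :: "real poly"
  assumes "f \<in> borel_measurable N"
  shows "(\<lambda>x. poly p (f x)) \<in> borel_measurable N"
  by (rule measurable_compose[OF assms borel_measurable_continuous_onI]) (intro continuous_intros)

section \<open>Polynomials produced by convolution with exp (-|y|)\<close>

text \<open>Nonnegative coefficients survive the constructions below and give nonnegativity on the
  half-line, as the passage between real and \<open>ennreal\<close> integrals requires.\<close>

definition nonneg_poly :: "real poly \<Rightarrow> bool" where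
  "nonneg_poly p \<longleftrightarrow> (\<forall>i. 0 \<le> coeff p i)"

lemma poly_nonneg: "nonneg_poly p \<Longrightarrow> 0 \<le> x \<Longrightarrow> 0 \<le> poly p x"
  by (auto simp: poly_altdef nonneg_poly_def intro!: sum_nonneg)

lemma nonneg_poly_pderiv: "nonneg_poly p \<Longrightarrow> nonneg_poly (pderiv p)"
  by (auto simp: nonneg_poly_def coeff_pderiv)

text \<open>The inverse of 1 - D/2 on polynomials is the Neumann series of the powers of D/2, which
  keeps coefficients nonnegative; it is built as p + v, where v solves the equation for p'/2, of
  smaller degree.\<close>

lemma ex_minus_half_pderiv:
  assumes "nonneg_poly p"
  shows "\<exists>u. nonneg_poly u \<and> u - smult (1/2) (pderiv u) = p"
  using assms
proof (induction "degree p" arbitrary: p rule: less_induct)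
  case (less p)
  show ?case
  proof (cases "degree p = 0")
    case True
    then obtain c where "p = [:c:]" using degree_0_id by metis
    thus ?thesis using less.prems by (intro exI[of _ p]) auto
  next
    case False
    have "degree (smult (1/2) (pderiv p)) < degree p" using False by (simp add: degree_pderiv)
    moreover have "nonneg_poly (smult (1/2) (pderiv p))"
      using nonneg_poly_pderiv[OF less.prems] by (simp add: nonneg_poly_def)
    ultimately obtain v where v: "nonneg_poly v" "v - smult (1/2) (pderiv v) = smult (1/2) (pderiv p)"
      using less.hyps by blast
    have "(p + v) - smult (1/2) (pderiv (p + v)) = p + (v - smult (1/2) (pderiv v)) - smult (1/2) (pderiv p)"
      by (simp add: pderiv_add smult_add_right algebra_simps)
    also have "\<dots> = p" by (simp add: v(2))
    finally show ?thesis using v(1) less.prems by (intro exI[of _ "p + v"]) (auto simp: nonneg_poly_def)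
  qed
qed

lemma ex_pderiv:
  assumes "nonneg_poly u" "c \<ge> 0"
  shows "\<exists>R. nonneg_poly R \<and> pderiv R = u \<and> coeff R 0 = c"
proof -
  define R where "R = [:c:] + (\<Sum>n\<le>degree u. monom (coeff u n / real (Suc n)) (Suc n))"
  have R: "coeff R i = (if i = 0 then c else coeff u (i - 1) / real i)" for i
  proof (cases i)
    case (Suc j)
    have "coeff R i = (\<Sum>n\<le>degree u. if n = j then coeff u n / real (Suc n) else 0)"
      by (auto simp: R_def Suc coeff_sum coeff_monom intro!: sum.cong)
    also have "\<dots> = coeff u j / real (Suc j)"
      using coeff_eq_0[of u j] by auto
    finally show ?thesis by (simp add: Suc)
  qed (simp add: R_def coeff_sum)
  have "pderiv R = u" by (rule poly_eqI) (simp add: coeff_pderiv R)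
  thus ?thesis using assms R by (intro exI[of _ R]) (auto simp: nonneg_poly_def)
qed

text \<open>Up to a factor 2, exp (-|y|) is the Green function of 1 - d^2/dy^2, so its convolution f
  with |z| P(|z|) exp (-|z|) solves f - f'' = 2 |y| P(|y|) exp (-|y|). For f = R(|y|) exp (-|y|)
  this is the differential equation, and smoothness of the even function f at 0 is the initial
  condition.\<close>

definition next_poly :: "real poly \<Rightarrow> real poly \<Rightarrow> bool" where
  "next_poly P R \<longleftrightarrow> nonneg_poly R \<and> pderiv R - smult (1/2) (pderiv (pderiv R)) = pCons 0 P \<and>
     poly R 0 = poly (pderiv R) 0"

lemma ex_next_poly:
  assumes "nonneg_poly P" shows "\<exists>R. next_poly P R"
proof -
  have "nonneg_poly (pCons 0 P)" using assms by (auto simp: nonneg_poly_def coeff_pCons split: nat.split)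
  then obtain u where u: "nonneg_poly u" "u - smult (1/2) (pderiv u) = pCons 0 P"
    using ex_minus_half_pderiv by blast
  moreover have "coeff u 0 \<ge> 0" using u(1) by (auto simp: nonneg_poly_def)
  ultimately obtain R where "nonneg_poly R" "pderiv R = u" "coeff R 0 = coeff u 0"
    using ex_pderiv by blast
  thus ?thesis using u(2) by (intro exI[of _ R]) (auto simp: next_poly_def poly_0_coeff_0)
qed

lemma tendsto_poly_exp: "((\<lambda>x. poly p x * exp (- 2 * x)) \<longlongrightarrow> (0::real)) at_top"
proof -
  have "((\<lambda>x. x ^ i * exp (- 2 * x)) \<longlongrightarrow> (0::real)) at_top" for i :: nat
    by real_asymp
  hence "((\<lambda>x. \<Sum>i\<le>degree p. coeff p i * (x ^ i * exp (- 2 * x))) \<longlongrightarrow> (\<Sum>i\<le>degree p. coeff p i * 0)) at_top"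
    by (intro tendsto_intros)
  thus ?thesis by (simp add: poly_altdef sum_distrib_right mult.assoc)
qed

text \<open>The line is split at 0 and y. With D = R', R - D/2 is an antiderivative of z P and -D
  exp (-2z)/2 one of z P exp (-2z). The boundary terms at y add up to R(y) exp (-y), and those at 0
  cancel because R(0) = D(0).\<close>

lemma next_poly_integral_nonneg:
  assumes P: "nonneg_poly P" and R: "next_poly P R" and y: "y \<ge> 0"
  shows "(\<integral>\<^sup>+z. ennreal (poly P \<bar>z\<bar> * exp (- \<bar>z\<bar>)) * ennreal (\<bar>z\<bar> * exp (- \<bar>y - z\<bar>)) \<partial>lborel) = ennreal (poly R y * exp (- y))"
proof -
  define D where "D = pderiv R"
  define g where "g z = poly P z * z" for z
  have g0: "g z \<ge> 0" if "z \<ge> 0" for z using poly_nonneg[OF P that] that by (simp add: g_def)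
  have D0: "poly D z \<ge> 0" if "z \<ge> 0" for z
    using R that by (auto simp: D_def next_poly_def intro!: poly_nonneg nonneg_poly_pderiv)
  have ode: "g z = poly D z - poly (pderiv D) z / 2" for z
  proof -
    have "poly (pderiv R - smult (1/2) (pderiv (pderiv R))) z = poly (pCons 0 P) z" using R by (simp add: next_poly_def)
    thus ?thesis by (simp add: D_def g_def)
  qed
  have [measurable]: "g \<in> borel_measurable borel" unfolding g_def by measurable
  have tail: "(\<integral>\<^sup>+z. ennreal (c * (g z * exp (- 2 * z))) * indicator {b..} z \<partial>lborel) = ennreal (c * (poly D b * exp (- 2 * b) / 2))"
    if "b \<ge> 0" "c \<ge> 0" for b c
  proof -
    have "(\<integral>\<^sup>+z. ennreal (c * (g z * exp (- 2 * z))) * indicator {b..} z \<partial>lborel) = ennreal (0 - (- c / 2) * (poly D b * exp (- 2 * b)))"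
    proof (rule nn_integral_FTC_atLeast)
      show "((\<lambda>z. (- c / 2) * (poly D z * exp (- 2 * z))) has_real_derivative c * (g z * exp (- 2 * z))) (at z)" for z
        by (auto intro!: derivative_eq_intros simp: ode field_simps)
      show "((\<lambda>z. (- c / 2) * (poly D z * exp (- 2 * z))) \<longlongrightarrow> 0) at_top"
        by (intro tendsto_mult_right_zero tendsto_poly_exp)
    qed (use that g0 in auto)
    thus ?thesis by simp
  qed
  have mid: "(\<integral>\<^sup>+z. ennreal (exp (- y) * g z) * indicator {0..y} z \<partial>lborel) = ennreal (exp (- y) * (poly R y - poly D y / 2) - exp (- y) * (poly R 0 - poly D 0 / 2))"
    by (rule nn_integral_FTC_Icc[where F = "\<lambda>z. exp (- y) * (poly R z - poly D z / 2)"])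
      (use y g0 in \<open>auto intro!: derivative_eq_intros simp: ode D_def\<close>)
  have left: "(\<integral>\<^sup>+z. ennreal (poly P \<bar>z\<bar> * exp (- \<bar>z\<bar>)) * ennreal (\<bar>z\<bar> * exp (- \<bar>y - z\<bar>)) * indicator {..0} z \<partial>lborel)
     = ennreal (exp (- y) * (poly D 0 / 2))"
  proof -
    have "(\<integral>\<^sup>+z. ennreal (poly P \<bar>z\<bar> * exp (- \<bar>z\<bar>)) * ennreal (\<bar>z\<bar> * exp (- \<bar>y - z\<bar>)) * indicator {..0} z \<partial>lborel)
      = (\<integral>\<^sup>+z. ennreal (poly P \<bar>- z\<bar> * exp (- \<bar>- z\<bar>)) * ennreal (\<bar>- z\<bar> * exp (- \<bar>y - - z\<bar>)) * indicator {..0} (- z) \<partial>lborel)"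
      using nn_integral_real_affine[of "\<lambda>z. ennreal (poly P \<bar>z\<bar> * exp (- \<bar>z\<bar>)) * ennreal (\<bar>z\<bar> * exp (- \<bar>y - z\<bar>)) * indicator {..0} z" "-1" 0] by simp
    also have "\<dots> = (\<integral>\<^sup>+z. ennreal (exp (- y) * (g z * exp (- 2 * z))) * indicator {0..} z \<partial>lborel)"
    proof (intro nn_integral_cong)
      fix z :: real
      have "exp (- z) * exp (- (y + z)) = exp (- y) * exp (- 2 * z)" by (simp add: exp_add[symmetric])
      hence "poly P z * exp (- z) * (z * exp (- (y + z))) = exp (- y) * (g z * exp (- 2 * z))" by (simp add: g_def mult_ac)
      thus "ennreal (poly P \<bar>- z\<bar> * exp (- \<bar>- z\<bar>)) * ennreal (\<bar>- z\<bar> * exp (- \<bar>y - - z\<bar>)) * indicator {..0} (- z)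
        = ennreal (exp (- y) * (g z * exp (- 2 * z))) * indicator {0..} z"
        using y by (cases "z \<ge> 0") (simp_all add: indicator_def ennreal_mult''[symmetric])
    qed
    finally show ?thesis using tail[of 0 "exp (- y)"] by simp
  qed
  have "(\<integral>\<^sup>+z. ennreal (poly P \<bar>z\<bar> * exp (- \<bar>z\<bar>)) * ennreal (\<bar>z\<bar> * exp (- \<bar>y - z\<bar>)) \<partial>lborel)
    = (\<integral>\<^sup>+z. (ennreal (poly P \<bar>z\<bar> * exp (- \<bar>z\<bar>)) * ennreal (\<bar>z\<bar> * exp (- \<bar>y - z\<bar>)) * indicator {..0} z
       + ennreal (exp (- y) * g z) * indicator {0..y} z) + ennreal (exp y * (g z * exp (- 2 * z))) * indicator {y..} z \<partial>lborel)"
  proof (rule nn_integral_cong_AE)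
    have "AE z in lborel. z \<noteq> 0 \<and> z \<noteq> y" using AE_lborel_singleton[of 0] AE_lborel_singleton[of y] by eventually_elim auto
    thus "AE z in lborel. ennreal (poly P \<bar>z\<bar> * exp (- \<bar>z\<bar>)) * ennreal (\<bar>z\<bar> * exp (- \<bar>y - z\<bar>)) =
      (ennreal (poly P \<bar>z\<bar> * exp (- \<bar>z\<bar>)) * ennreal (\<bar>z\<bar> * exp (- \<bar>y - z\<bar>)) * indicator {..0} z
       + ennreal (exp (- y) * g z) * indicator {0..y} z) + ennreal (exp y * (g z * exp (- 2 * z))) * indicator {y..} z"
    proof eventually_elim
      case (elim z)
      consider "z < 0" | "0 < z" "z < y" | "y < z" using elim by linarith
      thus ?case
      proof cases
        case 2
        have "exp (- z) * exp (- (y - z)) = exp (- y)" by (simp add: exp_add[symmetric])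
        hence "poly P z * exp (- z) * (z * exp (- (y - z))) = exp (- y) * g z" by (simp add: g_def mult_ac)
        thus ?thesis using 2 by (simp add: indicator_def ennreal_mult''[symmetric])
      next
        case 3
        have "exp (- z) * exp (- (z - y)) = exp y * exp (- 2 * z)" by (simp add: exp_add[symmetric])
        hence "poly P z * exp (- z) * (z * exp (- (z - y))) = exp y * (g z * exp (- 2 * z))" by (simp add: g_def mult_ac)
        thus ?thesis using 3 y by (simp add: indicator_def ennreal_mult''[symmetric])
      qed (use y in \<open>auto simp: indicator_def\<close>)
    qed
  qed
  also have "\<dots> = (ennreal (exp (- y) * (poly D 0 / 2)) +
     ennreal (exp (- y) * (poly R y - poly D y / 2) - exp (- y) * (poly R 0 - poly D 0 / 2)))
      + ennreal (exp y * (poly D y * exp (- 2 * y) / 2))"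
    using y tail[of y "exp y"] by (subst nn_integral_add; (subst nn_integral_add)?) (simp_all add: left mid)
  also have "\<dots> = ennreal (exp (- y) * (poly D 0 / 2) +
     (exp (- y) * (poly R y - poly D y / 2) - exp (- y) * (poly R 0 - poly D 0 / 2))
      + exp y * (poly D y * exp (- 2 * y) / 2))"
  proof -
    \<comment> \<open>The middle piece is a difference; its sign must be known before the three
      \<open>ennreal\<close> terms can be added as reals.\<close>
    have b: "0 \<le> (exp (- y) * (poly R y - poly D y / 2) - exp (- y) * (poly R 0 - poly D 0 / 2))"
    proof -
      have "(\<lambda>z. exp (- y) * (poly R z - poly D z / 2)) 0 \<le> (\<lambda>z. exp (- y) * (poly R z - poly D z / 2)) y"
      proof (rule DERIV_nonneg_imp_nondecreasing[OF y])
        fix z assume "0 \<le> z" "z \<le> y"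
        thus "\<exists>d. ((\<lambda>z. exp (- y) * (poly R z - poly D z / 2)) has_real_derivative d) (at z) \<and> 0 \<le> d"
          using g0[of z] by (intro exI[of _ "exp (- y) * g z"]) (auto intro!: derivative_eq_intros simp: ode D_def)
      qed
      thus ?thesis by simp
    qed
    have a: "0 \<le> exp (- y) * (poly D 0 / 2)" using D0[of 0] by simp
    have c: "0 \<le> exp y * (poly D y * exp (- 2 * y) / 2)" using D0[OF y] by simp
    show ?thesis by (simp only: ennreal_plus[OF add_nonneg_nonneg[OF a b] c] ennreal_plus[OF a b])
  qed
  also have "exp y * (poly D y * exp (- 2 * y) / 2) = exp (- y) * (poly D y / 2)"
  proof -
    have "exp y * exp (- 2 * y) = exp (- y)" by (simp add: exp_add[symmetric])
    thus ?thesis by (simp add: field_simps)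
  qed
  also have "poly R 0 = poly D 0" using R by (simp add: next_poly_def D_def)
  also have "exp (- y) * (poly D 0 / 2) + (exp (- y) * (poly R y - poly D y / 2) - exp (- y) * (poly D 0 - poly D 0 / 2))
      + exp (- y) * (poly D y / 2) = poly R y * exp (- y)"
    by (simp add: algebra_simps)
  finally show ?thesis .
qed

lemma next_poly_integral:
  assumes P: "nonneg_poly P" and R: "next_poly P R"
  shows "(\<integral>\<^sup>+z. ennreal (poly P \<bar>z\<bar> * exp (- \<bar>z\<bar>)) * ennreal (\<bar>z\<bar> * exp (- \<bar>y - z\<bar>)) \<partial>lborel) = ennreal (poly R \<bar>y\<bar> * exp (- \<bar>y\<bar>))"
proof (cases "y \<ge> 0")
  case True
  thus ?thesis using next_poly_integral_nonneg[OF assms, of y] by simp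
next
  case False
  have "(\<integral>\<^sup>+z. ennreal (poly P \<bar>z\<bar> * exp (- \<bar>z\<bar>)) * ennreal (\<bar>z\<bar> * exp (- \<bar>y - z\<bar>)) \<partial>lborel)
     = (\<integral>\<^sup>+z. ennreal (poly P \<bar>z\<bar> * exp (- \<bar>z\<bar>)) * ennreal (\<bar>z\<bar> * exp (- \<bar>y + z\<bar>)) \<partial>lborel)"
    using nn_integral_real_affine[of "\<lambda>z. ennreal (poly P \<bar>z\<bar> * exp (- \<bar>z\<bar>)) * ennreal (\<bar>z\<bar> * exp (- \<bar>y - z\<bar>))" "-1" 0] by simp
  also have "\<dots> = (\<integral>\<^sup>+z. ennreal (poly P \<bar>z\<bar> * exp (- \<bar>z\<bar>)) * ennreal (\<bar>z\<bar> * exp (- \<bar>- y - z\<bar>)) \<partial>lborel)"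
  proof -
    have "\<bar>y + z\<bar> = \<bar>- y - z\<bar>" for z by linarith
    thus ?thesis by simp
  qed
  finally show ?thesis using next_poly_integral_nonneg[OF assms, of "- y"] False by simp
qed

section \<open>Moments of polynomials against exp (-y)\<close>

text \<open>The integral of y^N p(y) exp (-y) over the half-line, given by coefficients: integration
  by parts becomes algebra, and polynomial dependence on N after division by N! is visible.\<close>

definition exp_moment :: "nat \<Rightarrow> real poly \<Rightarrow> real" where
  "exp_moment N p = (\<Sum>j\<le>degree p. coeff p j * fact (N + j))"

lemma exp_moment_eq: "degree p \<le> m \<Longrightarrow> exp_moment N p = (\<Sum>j\<le>m. coeff p j * fact (N + j))"
  unfolding exp_moment_def by (intro sum.mono_neutral_left) (auto simp: coeff_eq_0)

lemma exp_moment_diff: "exp_moment N (p - r) = exp_moment N p - exp_moment N r"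
proof -
  define m where "m = max (degree p) (degree r)"
  have "degree (p - r) \<le> m" "degree p \<le> m" "degree r \<le> m" by (auto simp: m_def intro: degree_diff_le)
  thus ?thesis by (simp add: exp_moment_eq[where m = m] sum_subtractf left_diff_distrib)
qed

lemma exp_moment_smult: "exp_moment N (smult c p) = c * exp_moment N p"
  by (subst (1 2) exp_moment_eq[where m = "degree p"]) (auto simp: sum_distrib_left mult.assoc)

lemma exp_moment_pCons: "exp_moment N (pCons 0 p) = exp_moment (Suc N) p"
proof -
  have "exp_moment N (pCons 0 p) = (\<Sum>j\<le>Suc (degree p). coeff (pCons 0 p) j * fact (N + j))"
    by (rule exp_moment_eq) (simp add: degree_pCons_le)
  also have "\<dots> = (\<Sum>j\<le>degree p. coeff p j * fact (Suc N + j))"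
    by (subst sum.atMost_Suc_shift) simp
  finally show ?thesis by (simp only: exp_moment_def)
qed

lemma exp_moment_pderiv_0: "exp_moment 0 (pderiv p) = exp_moment 0 p - coeff p 0"
proof -
  have "exp_moment 0 (pderiv p) = (\<Sum>j\<le>degree p. coeff (pderiv p) j * fact j)"
    by (subst exp_moment_eq[where m = "degree p"]) (auto simp: degree_pderiv)
  also have "\<dots> = (\<Sum>j\<le>degree p. coeff p (Suc j) * fact (Suc j))"
    by (intro sum.cong) (auto simp: coeff_pderiv)
  also have "\<dots> = (\<Sum>j\<le>Suc (degree p). coeff p j * fact j) - coeff p 0"
    by (subst sum.atMost_Suc_shift) simp
  also have "(\<Sum>j\<le>Suc (degree p). coeff p j * fact j) = exp_moment 0 p"
    by (subst exp_moment_eq[where m = "Suc (degree p)"]) auto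
  finally show ?thesis .
qed

lemma exp_moment_pderiv_Suc: "exp_moment (Suc N) (pderiv p) = exp_moment (Suc N) p - real (Suc N) * exp_moment N p"
proof -
  have "exp_moment (Suc N) (pderiv p) = (\<Sum>j\<le>degree p. coeff (pderiv p) j * fact (Suc N + j))"
    by (rule exp_moment_eq) (auto simp: degree_pderiv)
  also have "\<dots> = (\<Sum>j\<le>degree p. coeff p (Suc j) * (real (Suc j) * fact (N + Suc j)))"
    by (intro sum.cong) (auto simp: coeff_pderiv)
  also have "\<dots> = (\<Sum>j\<le>Suc (degree p). coeff p j * (real j * fact (N + j)))"
    by (subst sum.atMost_Suc_shift) simp
  also have "\<dots> = (\<Sum>j\<le>Suc (degree p). coeff p j * fact (Suc N + j) - real (Suc N) * (coeff p j * fact (N + j)))"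
    by (intro sum.cong refl) (simp add: algebra_simps)
  also have "\<dots> = exp_moment (Suc N) p - real (Suc N) * exp_moment N p"
    unfolding sum_subtractf sum_distrib_left[symmetric]
    by (subst (1 2) exp_moment_eq[where m = "Suc (degree p)"]) auto
  finally show ?thesis .
qed

text \<open>The boundary terms R(0) and R'(0) of the integrations by parts cancel; this is where the
  initial condition in \<open>next_poly\<close> enters.\<close>

lemma exp_moment_next_0:
  assumes "next_poly P R"
  shows "exp_moment 0 R = 2 * exp_moment 1 P"
proof -
  have "exp_moment 0 (pderiv R - smult (1/2) (pderiv (pderiv R))) = exp_moment 1 P"
    using assms by (simp add: next_poly_def exp_moment_pCons)
  thus ?thesis using assms by (simp add: exp_moment_diff exp_moment_smult exp_moment_pderiv_0 next_poly_def poly_0_coeff_0 field_simps)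
qed

lemma exp_moment_next_Suc:
  assumes "next_poly P R"
  shows "exp_moment (Suc (Suc N)) R = real (Suc (Suc N)) * real (Suc N) * exp_moment N R + 2 * exp_moment (Suc (Suc (Suc N))) P"
proof -
  have "exp_moment (Suc (Suc N)) (pderiv R - smult (1/2) (pderiv (pderiv R))) = exp_moment (Suc (Suc (Suc N))) P"
    using assms by (simp add: next_poly_def exp_moment_pCons)
  thus ?thesis by (simp add: exp_moment_diff exp_moment_smult exp_moment_pderiv_Suc algebra_simps)
qed

primrec kernel_poly :: "nat \<Rightarrow> real poly" where
  "kernel_poly 0 = 1"
| "kernel_poly (Suc n) = (SOME R. next_poly (kernel_poly n) R)"

lemma nonneg_kernel_poly: "nonneg_poly (kernel_poly n)" and next_kernel_poly: "next_poly (kernel_poly n) (kernel_poly (Suc n))"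
proof -
  have *: "nonneg_poly (kernel_poly n) \<Longrightarrow> next_poly (kernel_poly n) (kernel_poly (Suc n))" for n
    using someI_ex[OF ex_next_poly] by simp
  show "nonneg_poly (kernel_poly n)" for n
    by (induction n) (use * in \<open>auto simp: next_poly_def nonneg_poly_def[of 1] simp del: kernel_poly.simps(2)\<close>)
  with * show "next_poly (kernel_poly n) (kernel_poly (Suc n))" by blast
qed

text \<open>The scaling by (-1/2)^n absorbs the factor 2 and the sign in which the two recursions
  differ at each level; uniqueness of the polynomial solution does the rest.\<close>

lemma exp_moment_kernel_poly: "exp_moment N (kernel_poly n) = (- 2) ^ n * airy_moment N $ n"
proof -
  define u where "u n N = (- 1 / 2) ^ n * exp_moment N (kernel_poly n) / fact N" for n N
  have L0: "exp_moment N (kernel_poly 0) = fact N" for N by (simp add: exp_moment_def)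
  have "u n N = airy_moment N $ n / fact N"
  proof (rule airy_moment_unique)
    fix n
    have "(\<lambda>N. u n N) = (\<lambda>N. \<Sum>j\<le>degree (kernel_poly n). (- 1 / 2) ^ n * coeff (kernel_poly n) j * (fact (N + j) / fact N))"
      by (simp add: u_def exp_moment_def sum_distrib_left sum_divide_distrib mult.assoc)
    moreover have "is_poly \<dots>"
      by (intro is_poly_sum is_poly_mult is_poly_const is_poly_fact_quotient)
    ultimately show "is_poly (u n)" by simp
    show "u n 0 = (if n = 0 then 1 else - u (n - 1) 1)"
      by (cases n) (simp_all only: u_def L0 exp_moment_next_0[OF next_kernel_poly], auto)
    fix N
    show "u n (N + 2) = u n N - (if n = 0 then 0 else real (N + 3) * u (n - 1) (N + 3))"
    proof (cases n)
      case 0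
      thus ?thesis by (simp add: u_def L0 del: kernel_poly.simps)
    next
      case (Suc k)
      have f2: "fact (N + 2) = real (Suc (Suc N)) * real (Suc N) * fact N"
        by (simp add: mult_ac)
      have f3: "fact (N + 3) = real (N + 3) * fact (N + 2)"
        by (simp add: numeral_3_eq_3)
      have "exp_moment (N + 2) (kernel_poly (Suc k)) = real (Suc (Suc N)) * real (Suc N) * exp_moment N (kernel_poly (Suc k)) + 2 * exp_moment (N + 3) (kernel_poly k)"
        using exp_moment_next_Suc[OF next_kernel_poly, of N k] by (simp add: numeral_3_eq_3 del: kernel_poly.simps)
      hence "u n (N + 2) = (- 1 / 2) ^ Suc k * (real (Suc (Suc N)) * real (Suc N) * exp_moment N (kernel_poly (Suc k))) / fact (N + 2)
        + (- 1 / 2) ^ Suc k * 2 * exp_moment (N + 3) (kernel_poly k) / fact (N + 2)"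
        unfolding u_def Suc by (simp only: distrib_left add_divide_distrib mult.assoc)
      also have "(- 1 / 2) ^ Suc k * (real (Suc (Suc N)) * real (Suc N) * exp_moment N (kernel_poly (Suc k))) / fact (N + 2) = u n N"
        unfolding f2 u_def Suc by (simp del: kernel_poly.simps of_nat_Suc)
      also have "(- 1 / 2) ^ Suc k * 2 * exp_moment (N + 3) (kernel_poly k) / fact (N + 2) = - (real (N + 3) * u k (N + 3))"
        unfolding f3 u_def by simp
      finally show ?thesis using Suc by simp
    qed
  qed
  moreover have "(- 2) ^ n * (- 1 / 2) ^ n = (1::real)"
    by (simp only: power_mult_distrib[symmetric]) simp
  hence "exp_moment N (kernel_poly n) = (- 2) ^ n * (u n N * fact N)"
    by (simp add: u_def mult.assoc[symmetric] del: kernel_poly.simps)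
  ultimately show ?thesis by simp
qed

section \<open>Laplace transform of the densities\<close>

definition laplace_density :: "nat \<Rightarrow> real \<Rightarrow> ennreal" where
  "laplace_density n y = (\<integral>\<^sup>+t. indicator {0<..} t * ennreal (exp (- t / 2)) * area_density n t y \<partial>lborel)"

lemma indicator_greaterThan: "indicator {a<..} s = (if a < s then 1 else 0)"
  by (simp add: indicator_def)

lemma shifted_Laplace:
  "(\<integral>\<^sup>+t. indicator {s<..} t * ennreal (exp (- t / 2) * normal_density 0 (sqrt (t - s)) x) \<partial>lborel)
   = ennreal (exp (- s / 2)) * (\<integral>\<^sup>+u. indicator {0<..} u * ennreal (exp (- u / 2) * normal_density 0 (sqrt u) x) \<partial>lborel)"
proof -
  have "(\<integral>\<^sup>+t. indicator {s<..} t * ennreal (exp (- t / 2) * normal_density 0 (sqrt (t - s)) x) \<partial>lborel)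
    = (\<integral>\<^sup>+u. indicator {s<..} (s + u) * ennreal (exp (- (s + u) / 2) * normal_density 0 (sqrt u) x) \<partial>lborel)"
    using nn_integral_real_affine[of "\<lambda>t. indicator {s<..} t * ennreal (exp (- t / 2) * normal_density 0 (sqrt (t - s)) x)" 1 s]
    by simp
  also have "\<dots> = (\<integral>\<^sup>+u. ennreal (exp (- s / 2)) * (indicator {0<..} u * ennreal (exp (- u / 2) * normal_density 0 (sqrt u) x)) \<partial>lborel)"
  proof (intro nn_integral_cong)
    fix u
    have "exp (- (s + u) / 2) = exp (- s / 2) * exp (- u / 2)"
      by (simp add: exp_add[symmetric] add_divide_distrib)
    thus "indicator {s<..} (s + u) * ennreal (exp (- (s + u) / 2) * normal_density 0 (sqrt u) x)
      = ennreal (exp (- s / 2)) * (indicator {0<..} u * ennreal (exp (- u / 2) * normal_density 0 (sqrt u) x))"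
      by (simp add: indicator_def ennreal_mult' mult.assoc)
  qed
  also have "\<dots> = ennreal (exp (- s / 2)) * (\<integral>\<^sup>+u. indicator {0<..} u * ennreal (exp (- u / 2) * normal_density 0 (sqrt u) x) \<partial>lborel)"
    by (rule nn_integral_cmult) measurable
  finally show ?thesis .
qed

text \<open>The recursion of \<open>area_density\<close> is a convolution in time. With the
  t-integral innermost, the shift by s splits off exp (-s/2), and the transform becomes a
  product.\<close>

lemma laplace_density_Suc:
  "laplace_density (Suc n) y = (\<integral>\<^sup>+z. laplace_density n z * (ennreal \<bar>z\<bar> *
     (\<integral>\<^sup>+u. indicator {0<..} u * ennreal (exp (- u / 2) * normal_density 0 (sqrt u) (y - z)) \<partial>lborel)) \<partial>lborel)"
proof -
  let ?k = "\<lambda>t s z. indicator {0<..} s * area_density n s z * ennreal \<bar>z\<bar> * (indicator {s<..} t * ennreal (exp (- t / 2) * normal_density 0 (sqrt (t - s)) (y - z)))"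
  have "laplace_density (Suc n) y = (\<integral>\<^sup>+t. \<integral>\<^sup>+s. \<integral>\<^sup>+z. ?k t s z \<partial>lborel \<partial>lborel \<partial>lborel)"
    unfolding laplace_density_def area_density.simps
  proof (intro nn_integral_cong)
    fix t
    have "indicator {0<..} t * ennreal (exp (- t / 2)) * (\<integral>\<^sup>+s. indicator {0<..<t} s *
      (\<integral>\<^sup>+z. area_density n s z * ennreal (\<bar>z\<bar> * normal_density 0 (sqrt (t - s)) (y - z)) \<partial>lborel) \<partial>lborel)
      = (\<integral>\<^sup>+s. indicator {0<..} t * ennreal (exp (- t / 2)) * (indicator {0<..<t} s *
      (\<integral>\<^sup>+z. area_density n s z * ennreal (\<bar>z\<bar> * normal_density 0 (sqrt (t - s)) (y - z)) \<partial>lborel)) \<partial>lborel)"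
      unfolding indicator_greaterThanLessThan by (rule nn_integral_cmult[symmetric]) measurable
    also have "\<dots> = (\<integral>\<^sup>+s. \<integral>\<^sup>+z. ?k t s z \<partial>lborel \<partial>lborel)"
    proof (intro nn_integral_cong)
      fix s
      have "indicator {0<..} t * ennreal (exp (- t / 2)) * (indicator {0<..<t} s *
        (\<integral>\<^sup>+z. area_density n s z * ennreal (\<bar>z\<bar> * normal_density 0 (sqrt (t - s)) (y - z)) \<partial>lborel))
        = (\<integral>\<^sup>+z. (indicator {0<..} t * ennreal (exp (- t / 2)) * indicator {0<..<t} s) *
           (area_density n s z * ennreal (\<bar>z\<bar> * normal_density 0 (sqrt (t - s)) (y - z))) \<partial>lborel)"
        by (subst nn_integral_cmult) (auto simp: mult.assoc)
      also have "\<dots> = (\<integral>\<^sup>+z. ?k t s z \<partial>lborel)"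
        by (intro nn_integral_cong) (auto simp: indicator_def ennreal_mult' mult_ac)
      finally show "indicator {0<..} t * ennreal (exp (- t / 2)) * (indicator {0<..<t} s *
        (\<integral>\<^sup>+z. area_density n s z * ennreal (\<bar>z\<bar> * normal_density 0 (sqrt (t - s)) (y - z)) \<partial>lborel)) = (\<integral>\<^sup>+z. ?k t s z \<partial>lborel)" .
    qed
    finally show "indicator {0<..} t * ennreal (exp (- t / 2)) * (\<integral>\<^sup>+s. indicator {0<..<t} s *
      (\<integral>\<^sup>+z. area_density n s z * ennreal (\<bar>z\<bar> * normal_density 0 (sqrt (t - s)) (y - z)) \<partial>lborel) \<partial>lborel)
      = (\<integral>\<^sup>+s. \<integral>\<^sup>+z. ?k t s z \<partial>lborel \<partial>lborel)" .
  qed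
  also have "\<dots> = (\<integral>\<^sup>+s. \<integral>\<^sup>+t. \<integral>\<^sup>+z. ?k t s z \<partial>lborel \<partial>lborel \<partial>lborel)"
    unfolding indicator_greaterThan by (rule lborel_pair.Fubini') measurable
  also have "\<dots> = (\<integral>\<^sup>+s. \<integral>\<^sup>+z. \<integral>\<^sup>+t. ?k t s z \<partial>lborel \<partial>lborel \<partial>lborel)"
    unfolding indicator_greaterThan by (intro nn_integral_cong lborel_pair.Fubini') measurable
  also have "\<dots> = (\<integral>\<^sup>+z. \<integral>\<^sup>+s. \<integral>\<^sup>+t. ?k t s z \<partial>lborel \<partial>lborel \<partial>lborel)"
    unfolding indicator_greaterThan by (rule lborel_pair.Fubini') measurable
  also have "\<dots> = (\<integral>\<^sup>+z. laplace_density n z * (ennreal \<bar>z\<bar> *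
     (\<integral>\<^sup>+u. indicator {0<..} u * ennreal (exp (- u / 2) * normal_density 0 (sqrt u) (y - z)) \<partial>lborel)) \<partial>lborel)"
  proof (intro nn_integral_cong)
    fix z
    have "(\<integral>\<^sup>+s. \<integral>\<^sup>+t. ?k t s z \<partial>lborel \<partial>lborel) = (\<integral>\<^sup>+s. indicator {0<..} s * area_density n s z * ennreal \<bar>z\<bar> *
       (\<integral>\<^sup>+t. indicator {s<..} t * ennreal (exp (- t / 2) * normal_density 0 (sqrt (t - s)) (y - z)) \<partial>lborel) \<partial>lborel)"
      by (intro nn_integral_cong nn_integral_cmult) measurable
    also have "\<dots> = (\<integral>\<^sup>+s. indicator {0<..} s * ennreal (exp (- s / 2)) * area_density n s z * (ennreal \<bar>z\<bar> *
       (\<integral>\<^sup>+u. indicator {0<..} u * ennreal (exp (- u / 2) * normal_density 0 (sqrt u) (y - z)) \<partial>lborel)) \<partial>lborel)"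
      unfolding shifted_Laplace by (simp only: mult_ac)
    also have "\<dots> = laplace_density n z * (ennreal \<bar>z\<bar> *
       (\<integral>\<^sup>+u. indicator {0<..} u * ennreal (exp (- u / 2) * normal_density 0 (sqrt u) (y - z)) \<partial>lborel))"
      unfolding laplace_density_def by (rule nn_integral_multc) measurable
    finally show "(\<integral>\<^sup>+s. \<integral>\<^sup>+t. ?k t s z \<partial>lborel \<partial>lborel) = \<dots>" .
  qed
  finally show ?thesis .
qed

lemma laplace_density_eq: "y \<noteq> 0 \<Longrightarrow> laplace_density n y = ennreal (poly (kernel_poly n) \<bar>y\<bar> * exp (- \<bar>y\<bar>))"
proof (induction n arbitrary: y)
  case 0
  thus ?case using heat_kernel_Laplace[of y] by (simp add: laplace_density_def area_density.simps ennreal_mult' mult.assoc)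
next
  case (Suc n)
  have "laplace_density (Suc n) y = (\<integral>\<^sup>+z. ennreal (poly (kernel_poly n) \<bar>z\<bar> * exp (- \<bar>z\<bar>)) * ennreal (\<bar>z\<bar> * exp (- \<bar>y - z\<bar>)) \<partial>lborel)"
    unfolding laplace_density_Suc
  proof (rule nn_integral_cong_AE)
    have "AE z in lborel. z \<noteq> 0 \<and> z \<noteq> y" using AE_lborel_singleton[of 0] AE_lborel_singleton[of y] by eventually_elim auto
    thus "AE z in lborel. laplace_density n z * (ennreal \<bar>z\<bar> *
     (\<integral>\<^sup>+u. indicator {0<..} u * ennreal (exp (- u / 2) * normal_density 0 (sqrt u) (y - z)) \<partial>lborel))
     = ennreal (poly (kernel_poly n) \<bar>z\<bar> * exp (- \<bar>z\<bar>)) * ennreal (\<bar>z\<bar> * exp (- \<bar>y - z\<bar>))"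
      by eventually_elim (simp only: Suc.IH heat_kernel_Laplace ennreal_mult' abs_ge_zero right_minus_eq simp_thms eq_commute,
         subst heat_kernel_Laplace, simp, simp add: ennreal_mult')
  qed
  also have "\<dots> = ennreal (poly (kernel_poly (Suc n)) \<bar>y\<bar> * exp (- \<bar>y\<bar>))"
    by (rule next_poly_integral[OF nonneg_kernel_poly next_kernel_poly])
  finally show ?case .
qed

section \<open>Brownian scaling and even moments\<close>

text \<open>Scaling time by c and space by sqrt c scales the area by c^(3/2); the exponent is 3n/2
  for its n-th power and -1/2 for a density in y.\<close>

lemma area_density_scale:
  assumes "c > 0" "t > 0"
  shows "area_density n (c * t) (sqrt c * y) = ennreal (c powr ((3 * real n - 1) / 2)) * area_density n t y"
  using assms
proof (induction n arbitrary: t y)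
  case (0 t y)
  have "normal_density 0 (sqrt (c * t)) (sqrt c * y) = c powr (- 1 / 2) * normal_density 0 (sqrt t) y"
    using 0 by (simp add: normal_density_def real_sqrt_mult power_mult_distrib powr_minus powr_half_sqrt divide_simps)
  thus ?case by (simp add: area_density.simps ennreal_mult')
next
  case (Suc n t y)
  have nd: "normal_density 0 (sqrt (c * t - c * s)) (sqrt c * y - sqrt c * z) = c powr (- 1 / 2) * normal_density 0 (sqrt (t - s)) (y - z)"
    if "s < t" for s z
  proof -
    have "(c * t - c * s) = c * (t - s)" "sqrt c * y - sqrt c * z = sqrt c * (y - z)" by (auto simp: algebra_simps)
    thus ?thesis
      using Suc.prems that by (simp add: normal_density_def real_sqrt_mult power_mult_distrib powr_minus powr_half_sqrt divide_simps)
  qed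
  have sc: "sqrt c \<noteq> 0" "c \<noteq> 0" using Suc.prems by auto
  have "area_density (Suc n) (c * t) (sqrt c * y) = ennreal c * (\<integral>\<^sup>+s. indicator {0<..<c * t} (c * s) *
     (\<integral>\<^sup>+z. area_density n (c * s) z * ennreal (\<bar>z\<bar> * normal_density 0 (sqrt (c * t - c * s)) (sqrt c * y - z)) \<partial>lborel) \<partial>lborel)"
    unfolding area_density.simps indicator_greaterThanLessThan
    by (subst nn_integral_real_affine[OF _ sc(2), where t = 0]) (use Suc.prems in auto)
  also have "\<dots> = ennreal c * (\<integral>\<^sup>+s. ennreal (sqrt c * (c powr ((3 * real n - 1) / 2) * (sqrt c * c powr (- 1 / 2)))) * (indicator {0<..<t} s *
     (\<integral>\<^sup>+z. area_density n s z * ennreal (\<bar>z\<bar> * normal_density 0 (sqrt (t - s)) (y - z)) \<partial>lborel)) \<partial>lborel)"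
  proof (rule arg_cong2[of _ _ _ _ "(*)", OF refl], rule nn_integral_cong)
    fix s
    show "indicator {0<..<c * t} (c * s) * (\<integral>\<^sup>+z. area_density n (c * s) z * ennreal (\<bar>z\<bar> * normal_density 0 (sqrt (c * t - c * s)) (sqrt c * y - z)) \<partial>lborel)
      = ennreal (sqrt c * (c powr ((3 * real n - 1) / 2) * (sqrt c * c powr (- 1 / 2)))) * (indicator {0<..<t} s *
     (\<integral>\<^sup>+z. area_density n s z * ennreal (\<bar>z\<bar> * normal_density 0 (sqrt (t - s)) (y - z)) \<partial>lborel))"
    proof (cases "s \<in> {0<..<t}")
      case True
      have "(\<integral>\<^sup>+z. area_density n (c * s) z * ennreal (\<bar>z\<bar> * normal_density 0 (sqrt (c * t - c * s)) (sqrt c * y - z)) \<partial>lborel)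
        = ennreal (sqrt c) * (\<integral>\<^sup>+z. area_density n (c * s) (sqrt c * z) * ennreal (\<bar>sqrt c * z\<bar> * normal_density 0 (sqrt (c * t - c * s)) (sqrt c * y - sqrt c * z)) \<partial>lborel)"
        by (subst nn_integral_real_affine[OF _ sc(1), where t = 0]) (use Suc.prems in auto)
      also have "\<dots> = ennreal (sqrt c) * (\<integral>\<^sup>+z. ennreal (c powr ((3 * real n - 1) / 2) * (sqrt c * c powr (- 1 / 2))) *
           (area_density n s z * ennreal (\<bar>z\<bar> * normal_density 0 (sqrt (t - s)) (y - z))) \<partial>lborel)"
      proof (rule arg_cong2[of _ _ _ _ "(*)", OF refl], rule nn_integral_cong)
        fix z
        have "area_density n (c * s) (sqrt c * z) = ennreal (c powr ((3 * real n - 1) / 2)) * area_density n s z"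
          using Suc.IH Suc.prems True by simp
        moreover have "normal_density 0 (sqrt (c * t - c * s)) (sqrt c * y - sqrt c * z) = c powr (- 1 / 2) * normal_density 0 (sqrt (t - s)) (y - z)"
          using nd True by simp
        ultimately show "area_density n (c * s) (sqrt c * z) * ennreal (\<bar>sqrt c * z\<bar> * normal_density 0 (sqrt (c * t - c * s)) (sqrt c * y - sqrt c * z))
          = ennreal (c powr ((3 * real n - 1) / 2) * (sqrt c * c powr (- 1 / 2))) * (area_density n s z * ennreal (\<bar>z\<bar> * normal_density 0 (sqrt (t - s)) (y - z)))"
          using Suc.prems by (simp add: abs_mult ennreal_mult' mult_ac)
      qed
      also have "\<dots> = ennreal (sqrt c) * (ennreal (c powr ((3 * real n - 1) / 2) * (sqrt c * c powr (- 1 / 2))) *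
           (\<integral>\<^sup>+z. area_density n s z * ennreal (\<bar>z\<bar> * normal_density 0 (sqrt (t - s)) (y - z)) \<partial>lborel))"
        by (subst nn_integral_cmult) auto
      finally show ?thesis using True Suc.prems by (simp add: ennreal_mult' mult.assoc)
    qed (use Suc.prems in \<open>auto simp: indicator_def zero_less_mult_iff\<close>)
  qed
  also have "\<dots> = ennreal c * (ennreal (sqrt c * (c powr ((3 * real n - 1) / 2) * (sqrt c * c powr (- 1 / 2)))) * area_density (Suc n) t y)"
    unfolding area_density.simps indicator_greaterThanLessThan by (subst nn_integral_cmult) auto
  also have "\<dots> = ennreal (c * (sqrt c * (c powr ((3 * real n - 1) / 2) * (sqrt c * c powr (- 1 / 2))))) * area_density (Suc n) t y"
    using Suc.prems by (simp add: ennreal_mult' mult.assoc)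
  also have "c * (sqrt c * (c powr ((3 * real n - 1) / 2) * (sqrt c * c powr (- 1 / 2)))) = c powr ((3 * real (Suc n) - 1) / 2)"
  proof -
    have "c * (sqrt c * (c powr ((3 * real n - 1) / 2) * (sqrt c * c powr (- 1 / 2))))
      = c powr 1 * (c powr (1/2) * (c powr ((3 * real n - 1) / 2) * (c powr (1/2) * c powr (- 1 / 2))))"
      using Suc.prems by (simp add: powr_half_sqrt)
    also have "\<dots> = c powr (1 + (1/2 + ((3 * real n - 1) / 2 + (1/2 + (- 1 / 2)))))"
      by (simp only: powr_add)
    also have "1 + (1/2 + ((3 * real n - 1) / 2 + (1/2 + (- 1 / 2)))) = (3 * real (Suc n) - 1) / 2"
      by (simp add: field_simps)
    finally show ?thesis .
  qed
  finally show ?case .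
qed

lemma area_density_even: "area_density n t (- y) = area_density n t y"
proof (induction n arbitrary: t y)
  case 0
  show ?case by (simp add: area_density.simps normal_density_def)
next
  case (Suc n)
  have "(\<integral>\<^sup>+z. area_density n s z * ennreal (\<bar>z\<bar> * normal_density 0 (sqrt (t - s)) (- y - z)) \<partial>lborel)
     = (\<integral>\<^sup>+z. area_density n s z * ennreal (\<bar>z\<bar> * normal_density 0 (sqrt (t - s)) (y - z)) \<partial>lborel)" for s
  proof -
    have "(\<integral>\<^sup>+z. area_density n s z * ennreal (\<bar>z\<bar> * normal_density 0 (sqrt (t - s)) (- y - z)) \<partial>lborel)
      = (\<integral>\<^sup>+z. area_density n s (- z) * ennreal (\<bar>z\<bar> * normal_density 0 (sqrt (t - s)) (- y - - z)) \<partial>lborel)"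
      using nn_integral_real_affine[of "\<lambda>z. area_density n s z * ennreal (\<bar>z\<bar> * normal_density 0 (sqrt (t - s)) (- y - z))" "-1" 0] by simp
    also have "\<dots> = (\<integral>\<^sup>+z. area_density n s z * ennreal (\<bar>z\<bar> * normal_density 0 (sqrt (t - s)) (y - z)) \<partial>lborel)"
      by (simp add: Suc.IH normal_density_def power2_commute)
    finally show ?thesis .
  qed
  thus ?case by (simp add: area_density.simps)
qed

definition area_moment :: "nat \<Rightarrow> nat \<Rightarrow> ennreal" where
  "area_moment n r = (\<integral>\<^sup>+y. area_density n 1 y * ennreal (y ^ (2 * r)) \<partial>lborel)"

lemma area_density_moment:
  assumes "t > 0"
  shows "(\<integral>\<^sup>+y. area_density n t y * ennreal (y ^ (2 * r)) \<partial>lborel) = ennreal (t powr (3 * real n / 2 + real r)) * area_moment n r"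
proof -
  have sc: "sqrt t \<noteq> 0" using assms by simp
  have "(\<integral>\<^sup>+y. area_density n t y * ennreal (y ^ (2 * r)) \<partial>lborel)
      = ennreal (sqrt t) * (\<integral>\<^sup>+y. area_density n (t * 1) (sqrt t * y) * ennreal ((sqrt t * y) ^ (2 * r)) \<partial>lborel)"
    by (subst nn_integral_real_affine[OF _ sc, where t = 0]) (use assms in auto)
  also have "\<dots> = ennreal (sqrt t) * (\<integral>\<^sup>+y. ennreal (t powr ((3 * real n - 1) / 2) * t ^ r) * (area_density n 1 y * ennreal (y ^ (2 * r))) \<partial>lborel)"
    unfolding area_density_scale[OF assms zero_less_one]
  proof (rule arg_cong2[of _ _ _ _ "(*)", OF refl], rule nn_integral_cong)
    fix y
    have "(sqrt t * y) ^ (2 * r) = t ^ r * y ^ (2 * r)"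
      using assms by (simp add: power_mult_distrib power_mult)
    thus "ennreal (t powr ((3 * real n - 1) / 2)) * area_density n 1 y * ennreal ((sqrt t * y) ^ (2 * r))
      = ennreal (t powr ((3 * real n - 1) / 2) * t ^ r) * (area_density n 1 y * ennreal (y ^ (2 * r)))"
      using assms by (simp add: ennreal_mult' mult_ac)
  qed
  also have "\<dots> = ennreal (sqrt t * (t powr ((3 * real n - 1) / 2) * t ^ r)) * area_moment n r"
    unfolding area_moment_def using assms by (subst nn_integral_cmult) (auto simp: ennreal_mult' mult.assoc)
  also have "sqrt t * (t powr ((3 * real n - 1) / 2) * t ^ r) = t powr (1/2) * (t powr ((3 * real n - 1) / 2) * t powr (real r))"
    using assms by (simp add: powr_half_sqrt powr_realpow)
  also have "\<dots> = t powr (1/2 + ((3 * real n - 1) / 2 + real r))"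
    by (simp only: powr_add)
  also have "1/2 + ((3 * real n - 1) / 2 + real r) = 3 * real n / 2 + real r"
    by (simp add: field_simps)
  finally show ?thesis .
qed

lemma Gamma_half_nn_integral:
  assumes "a > 0"
  shows "(\<integral>\<^sup>+t. indicator {0<..} t * ennreal (exp (- t / 2) * t powr (a - 1)) \<partial>lborel) = ennreal (2 powr a * Gamma a)"
proof -
  have "(\<integral>\<^sup>+t. indicator {0<..} t * ennreal (exp (- t / 2) * t powr (a - 1)) \<partial>lborel)
    = ennreal 2 * (\<integral>\<^sup>+t. indicator {0<..} (2 * t) * ennreal (exp (- (2 * t) / 2) * (2 * t) powr (a - 1)) \<partial>lborel)"
    using nn_integral_real_affine[of "\<lambda>t. indicator {0<..} t * ennreal (exp (- t / 2) * t powr (a - 1))" 2 0] by simp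
  also have "(\<integral>\<^sup>+t. indicator {0<..} (2 * t) * ennreal (exp (- (2 * t) / 2) * (2 * t) powr (a - 1)) \<partial>lborel)
    = (\<integral>\<^sup>+t. ennreal (2 powr (a - 1)) * ennreal (indicator {0..} t * t powr (a - 1) / exp t) \<partial>lborel)"
  proof (rule nn_integral_cong_AE)
    show "AE t in lborel. indicator {0<..} (2 * t) * ennreal (exp (- (2 * t) / 2) * (2 * t) powr (a - 1))
      = ennreal (2 powr (a - 1)) * ennreal (indicator {0..} t * t powr (a - 1) / exp t)"
      using AE_lborel_singleton[of 0]
      by eventually_elim (auto simp: indicator_def powr_mult ennreal_mult'[symmetric] exp_minus field_simps)
  qed
  also have "\<dots> = ennreal (2 powr (a - 1)) * ennreal (Gamma a)"
    by (subst nn_integral_cmult) (auto simp: Gamma_conv_nn_integral_real[OF assms])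
  also have "ennreal 2 * \<dots> = ennreal (2 * 2 powr (a - 1) * Gamma a)"
    using Gamma_real_pos[OF assms] by (simp add: ennreal_mult' ennreal_mult'' mult.assoc)
  also have "2 * 2 powr (a - 1) = 2 powr (1 + (a - 1))"
    by (simp only: powr_add) simp
  finally show ?thesis by simp
qed

lemma nn_integral_poly_exp:
  assumes "nonneg_poly P"
  shows "(\<integral>\<^sup>+y. ennreal (poly P \<bar>y\<bar> * exp (- \<bar>y\<bar>)) * ennreal (y ^ (2 * r)) \<partial>lborel) = ennreal (2 * exp_moment (2 * r) P)"
proof -
  let ?f = "\<lambda>y. ennreal (poly P \<bar>y\<bar> * exp (- \<bar>y\<bar>)) * ennreal (y ^ (2 * r))"
  have half: "(\<integral>\<^sup>+y. ?f y * indicator {0..} y \<partial>lborel) = ennreal (exp_moment (2 * r) P)"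
  proof -
    have "(\<integral>\<^sup>+y. ?f y * indicator {0..} y \<partial>lborel) =
      (\<integral>\<^sup>+y. (\<Sum>j\<le>degree P. ennreal (coeff P j) * (ennreal (y ^ (2 * r + j) * exp (- y)) * indicator {0..} y)) \<partial>lborel)"
    proof (intro nn_integral_cong)
      fix y :: real
      show "?f y * indicator {0..} y = (\<Sum>j\<le>degree P. ennreal (coeff P j) * (ennreal (y ^ (2 * r + j) * exp (- y)) * indicator {0..} y))"
      proof (cases "y \<ge> 0")
        case True
        have "?f y = ennreal (\<Sum>j\<le>degree P. coeff P j * (y ^ (2 * r + j) * exp (- y)))"
        proof -
          have "(poly P y * exp (- y)) * y ^ (2 * r) = (\<Sum>j\<le>degree P. coeff P j * (y ^ (2 * r + j) * exp (- y)))"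
            unfolding poly_altdef sum_distrib_right
            by (intro sum.cong refl) (simp only: power_add mult_ac)
          thus ?thesis using True by (simp add: ennreal_mult''[symmetric])
        qed
        also have "\<dots> = (\<Sum>j\<le>degree P. ennreal (coeff P j * (y ^ (2 * r + j) * exp (- y))))"
          using True assms by (intro sum_ennreal[symmetric]) (auto simp: nonneg_poly_def)
        finally show ?thesis using True assms by (simp add: ennreal_mult' nonneg_poly_def)
      qed simp
    qed
    also have "\<dots> = (\<Sum>j\<le>degree P. ennreal (coeff P j) * (\<integral>\<^sup>+y. ennreal (y ^ (2 * r + j) * exp (- y)) * indicator {0..} y \<partial>lborel))"
      by (subst nn_integral_sum) (auto intro!: sum.cong nn_integral_cmult)
    also have "\<dots> = (\<Sum>j\<le>degree P. ennreal (coeff P j) * ennreal (fact (2 * r + j)))"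
      unfolding nn_intergal_power_times_exp_Ici by simp
    also have "\<dots> = ennreal (exp_moment (2 * r) P)"
      using assms unfolding exp_moment_def
      by (subst sum_ennreal[symmetric]) (auto simp: nonneg_poly_def ennreal_mult')
    finally show ?thesis .
  qed
  have L0: "exp_moment (2 * r) P \<ge> 0" using assms unfolding exp_moment_def by (intro sum_nonneg) (auto simp: nonneg_poly_def)
  have "(\<integral>\<^sup>+y. ?f y \<partial>lborel) = (\<integral>\<^sup>+y. ?f y * indicator {0..} y + ?f (- y) * indicator {0..} (- y) \<partial>lborel)"
  proof (rule nn_integral_cong_AE)
    show "AE y in lborel. ?f y = ?f y * indicator {0..} y + ?f (- y) * indicator {0..} (- y)"
      using AE_lborel_singleton[of 0] by eventually_elim (auto simp: indicator_def)
  qed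
  also have "\<dots> = (\<integral>\<^sup>+y. ?f y * indicator {0..} y \<partial>lborel) + (\<integral>\<^sup>+y. ?f (- y) * indicator {0..} (- y) \<partial>lborel)"
    by (rule nn_integral_add) measurable
  also have "(\<integral>\<^sup>+y. ?f (- y) * indicator {0..} (- y) \<partial>lborel) = (\<integral>\<^sup>+y. ?f y * indicator {0..} y \<partial>lborel)"
    using nn_integral_real_affine[of "\<lambda>y. ?f y * indicator {0..} y" "-1" 0] by simp
  finally show ?thesis unfolding half using L0 by (simp flip: ennreal_plus)
qed

text \<open>By scaling, the moment at time t is a constant times t^a, and the transform of t^a at
  1/2 is a Gamma value, so this single transform yields the constant. The 2 from the two half-lines
  cancels one factor of 2^(a+1).\<close>

lemma area_moment_eq: "area_moment n r = ennreal (exp_moment (2 * r) (kernel_poly n) / (2 powr (3 * real n / 2 + real r) * Gamma (3 * real n / 2 + real r + 1)))"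
proof -
  define a where "a = 3 * real n / 2 + real r"
  have a: "a \<ge> 0" by (simp add: a_def)
  have "(\<integral>\<^sup>+y. laplace_density n y * ennreal (y ^ (2 * r)) \<partial>lborel) = (\<integral>\<^sup>+y. ennreal (poly (kernel_poly n) \<bar>y\<bar> * exp (- \<bar>y\<bar>)) * ennreal (y ^ (2 * r)) \<partial>lborel)"
  proof (rule nn_integral_cong_AE)
    show "AE y in lborel. laplace_density n y * ennreal (y ^ (2 * r)) = ennreal (poly (kernel_poly n) \<bar>y\<bar> * exp (- \<bar>y\<bar>)) * ennreal (y ^ (2 * r))"
      using AE_lborel_singleton[of 0] by eventually_elim (simp add: laplace_density_eq)
  qed
  also have "\<dots> = ennreal (2 * exp_moment (2 * r) (kernel_poly n))" by (rule nn_integral_poly_exp[OF nonneg_kernel_poly])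
  finally have 1: "(\<integral>\<^sup>+y. laplace_density n y * ennreal (y ^ (2 * r)) \<partial>lborel) = ennreal (2 * exp_moment (2 * r) (kernel_poly n))" .
  have "(\<integral>\<^sup>+y. laplace_density n y * ennreal (y ^ (2 * r)) \<partial>lborel) = (\<integral>\<^sup>+y. \<integral>\<^sup>+t. indicator {0<..} t * ennreal (exp (- t / 2)) * area_density n t y * ennreal (y ^ (2 * r)) \<partial>lborel \<partial>lborel)"
    unfolding laplace_density_def by (intro nn_integral_cong nn_integral_multc[symmetric]) measurable
  also have "\<dots> = (\<integral>\<^sup>+t. \<integral>\<^sup>+y. indicator {0<..} t * ennreal (exp (- t / 2)) * area_density n t y * ennreal (y ^ (2 * r)) \<partial>lborel \<partial>lborel)"
    by (rule lborel_pair.Fubini') measurable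
  also have "\<dots> = (\<integral>\<^sup>+t. indicator {0<..} t * ennreal (exp (- t / 2) * t powr (a + 1 - 1)) * area_moment n r \<partial>lborel)"
  proof (intro nn_integral_cong)
    fix t
    have "(\<integral>\<^sup>+y. indicator {0<..} t * ennreal (exp (- t / 2)) * area_density n t y * ennreal (y ^ (2 * r)) \<partial>lborel)
      = indicator {0<..} t * ennreal (exp (- t / 2)) * (\<integral>\<^sup>+y. area_density n t y * ennreal (y ^ (2 * r)) \<partial>lborel)"
      by (subst nn_integral_cmult[symmetric]) (auto simp: mult.assoc)
    also have "\<dots> = indicator {0<..} t * ennreal (exp (- t / 2) * t powr (a + 1 - 1)) * area_moment n r"
      by (cases "t > 0") (simp_all add: area_density_moment a_def ennreal_mult' mult.assoc)
    finally show "(\<integral>\<^sup>+y. indicator {0<..} t * ennreal (exp (- t / 2)) * area_density n t y * ennreal (y ^ (2 * r)) \<partial>lborel) = \<dots>" .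
  qed
  also have "\<dots> = ennreal (2 powr (a + 1) * Gamma (a + 1)) * area_moment n r"
    using a Gamma_half_nn_integral[of "a + 1"] by (subst nn_integral_multc) auto
  finally have 2: "ennreal (2 powr (a + 1) * Gamma (a + 1)) * area_moment n r = ennreal (2 * exp_moment (2 * r) (kernel_poly n))"
    using 1 by simp
  define g where "g = 2 powr (a + 1) * Gamma (a + 1)"
  have g: "g > 0" using a by (auto simp: g_def intro!: mult_pos_pos Gamma_real_pos)
  have L0: "exp_moment (2 * r) (kernel_poly n) \<ge> 0" using nonneg_kernel_poly[of n] unfolding exp_moment_def by (intro sum_nonneg) (auto simp: nonneg_poly_def)
  have "area_moment n r = ennreal (1 / g) * (ennreal g * area_moment n r)"
    using g by (simp add: mult.assoc[symmetric] ennreal_mult''[symmetric])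
  also have "\<dots> = ennreal (2 * exp_moment (2 * r) (kernel_poly n) / g)"
    using g L0 unfolding g_def 2 by (simp add: ennreal_mult''[symmetric])
  also have "2 * exp_moment (2 * r) (kernel_poly n) / g = exp_moment (2 * r) (kernel_poly n) / (2 powr a * Gamma (a + 1))"
    by (simp add: g_def powr_add)
  finally show ?thesis by (simp add: a_def)
qed

text \<open>Adding the reflected integral replaces the exponential by cosh. All terms of its series
  are nonnegative, so termwise integration is monotone convergence.\<close>

lemma area_density_exp_integral:
  assumes "t > 0"
  shows "(\<integral>\<^sup>+y. area_density n t y * ennreal (exp (\<nu> * y)) \<partial>lborel) = (\<Sum>r. ennreal (\<nu> ^ (2 * r) / fact (2 * r) * t powr (3 * real n / 2 + real r)) * area_moment n r)"
proof -
  define I where "I = (\<integral>\<^sup>+y. area_density n t y * ennreal (exp (\<nu> * y)) \<partial>lborel)"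
  have "I = (\<integral>\<^sup>+y. area_density n t y * ennreal (exp (- (\<nu> * y))) \<partial>lborel)"
    unfolding I_def using nn_integral_real_affine[of "\<lambda>y. area_density n t y * ennreal (exp (\<nu> * y))" "-1" 0] by (simp add: area_density_even)
  hence "I + I = (\<integral>\<^sup>+y. area_density n t y * ennreal (exp (\<nu> * y)) + area_density n t y * ennreal (exp (- (\<nu> * y))) \<partial>lborel)"
    by (subst nn_integral_add) (auto simp: I_def)
  also have "\<dots> = (\<integral>\<^sup>+y. ennreal 2 * (area_density n t y * ennreal (cosh (\<nu> * y))) \<partial>lborel)"
  proof (intro nn_integral_cong)
    fix y
    have "ennreal (exp (\<nu> * y)) + ennreal (exp (- (\<nu> * y))) = ennreal 2 * ennreal (cosh (\<nu> * y))"
    proof -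
      have "ennreal (exp (\<nu> * y)) + ennreal (exp (- (\<nu> * y))) = ennreal (exp (\<nu> * y) + exp (- (\<nu> * y)))"
        by (rule ennreal_plus[symmetric]) auto
      also have "exp (\<nu> * y) + exp (- (\<nu> * y)) = 2 * cosh (\<nu> * y)" by (simp add: cosh_field_def)
      also have "ennreal (2 * cosh (\<nu> * y)) = ennreal 2 * ennreal (cosh (\<nu> * y))" by (rule ennreal_mult') simp
      finally show ?thesis .
    qed
    thus "area_density n t y * ennreal (exp (\<nu> * y)) + area_density n t y * ennreal (exp (- (\<nu> * y))) = ennreal 2 * (area_density n t y * ennreal (cosh (\<nu> * y)))"
      by (simp add: distrib_left[symmetric] mult.left_commute)
  qed
  also have "\<dots> = ennreal 2 * (\<integral>\<^sup>+y. area_density n t y * ennreal (cosh (\<nu> * y)) \<partial>lborel)"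
    by (rule nn_integral_cmult) (measurable, simp add: cosh_field_def)
  finally have "ennreal 2 * I = ennreal 2 * (\<integral>\<^sup>+y. area_density n t y * ennreal (cosh (\<nu> * y)) \<partial>lborel)"
    by (simp add: mult_2)
  hence "I = (\<integral>\<^sup>+y. area_density n t y * ennreal (cosh (\<nu> * y)) \<partial>lborel)"
    by (simp add: ennreal_mult_cancel_left)
  also have "\<dots> = (\<integral>\<^sup>+y. (\<Sum>r. ennreal (\<nu> ^ (2 * r) / fact (2 * r)) * (area_density n t y * ennreal (y ^ (2 * r)))) \<partial>lborel)"
  proof (intro nn_integral_cong)
    fix y
    have s: "(\<lambda>r. (\<nu> * y) ^ (2 * r) / fact (2 * r)) sums cosh (\<nu> * y)"
    proof -
      have "(\<lambda>r. if even r then (\<nu> * y) ^ r /\<^sub>R fact r else 0) sums cosh (\<nu> * y)" by (rule cosh_converges)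
      hence "(\<lambda>r. if even (2 * r) then (\<nu> * y) ^ (2 * r) /\<^sub>R fact (2 * r) else 0) sums cosh (\<nu> * y)"
        by (subst sums_mono_reindex[of "\<lambda>r. 2 * r"]) (auto simp: strict_mono_def elim: evenE)
      thus ?thesis by (simp add: divide_inverse mult.commute)
    qed
    have "ennreal (cosh (\<nu> * y)) = (\<Sum>r. ennreal ((\<nu> * y) ^ (2 * r) / fact (2 * r)))"
    proof -
      have nn: "0 \<le> (\<nu> * y) ^ (2 * r) / fact (2 * r)" for r by (simp add: power_mult)
      show ?thesis
        unfolding suminf_ennreal2[OF nn sums_summable[OF s]] sums_unique[OF s, symmetric] ..
    qed
    also have "area_density n t y * \<dots> = (\<Sum>r. area_density n t y * ennreal ((\<nu> * y) ^ (2 * r) / fact (2 * r)))"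
      by (rule ennreal_suminf_cmult[symmetric])
    also have "\<dots> = (\<Sum>r. ennreal (\<nu> ^ (2 * r) / fact (2 * r)) * (area_density n t y * ennreal (y ^ (2 * r))))"
      by (intro suminf_cong) (simp add: power_mult_distrib ennreal_mult''[symmetric] mult.left_commute)
    finally show "area_density n t y * ennreal (cosh (\<nu> * y)) = \<dots>" .
  qed
  also have "\<dots> = (\<Sum>r. \<integral>\<^sup>+y. ennreal (\<nu> ^ (2 * r) / fact (2 * r)) * (area_density n t y * ennreal (y ^ (2 * r))) \<partial>lborel)"
    by (rule nn_integral_suminf) measurable
  also have "\<dots> = (\<Sum>r. ennreal (\<nu> ^ (2 * r) / fact (2 * r) * t powr (3 * real n / 2 + real r)) * area_moment n r)"
    by (intro suminf_cong, subst nn_integral_cmult) (auto simp: area_density_moment[OF assms] mult.assoc[symmetric] ennreal_mult''[symmetric])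
  finally show ?thesis by (simp add: I_def)
qed

section \<open>The moment formula\<close>

text \<open>All factors that depend on r go into \<open>S_coeff n l i r * x ^ r\<close>; the sums
  over k, l and i are finite, so the series over r may be taken inside.\<close>

lemma airy_moment_sums:
  "(\<lambda>r. x ^ r * airy_moment (2 * r) $ n / (fact (2 * r) * Gamma (3 * real n / 2 + real r + 1))) sums
     (\<Sum>k=0..n. c1_tilde (n - k) * (\<Sum>l=0..k. \<Sum>i=0..l.
       ((real l - real k - 1/2) gchoose (l - i)) * (3/2) ^ l * c2 (k - l) * Re (Sigma_coeff n l i x)))"
proof -
  have "x ^ r * airy_moment (2 * r) $ n / (fact (2 * r) * Gamma (3 * real n / 2 + real r + 1)) =
     (\<Sum>k=0..n. c1_tilde (n - k) * (\<Sum>l=0..k. \<Sum>i=0..l.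
       ((real l - real k - 1/2) gchoose (l - i)) * (3/2) ^ l * c2 (k - l) * (S_coeff n l i r * x ^ r)))" for r
  proof -
    define Q where "Q = x ^ r / (fact (2 * r) * Gamma (3 * real n / 2 + real r + 1))"
    have s: "S_coeff n l i r * x ^ r = (fact (2 * r + l) * (chord_fps ^ (2 * r)) $ i) * Q" for l i
      by (simp add: S_coeff_def Q_def add_ac)
    have "x ^ r * airy_moment (2 * r) $ n / (fact (2 * r) * Gamma (3 * real n / 2 + real r + 1)) = airy_moment (2 * r) $ n * Q"
      by (simp add: Q_def)
    also have "\<dots> = (\<Sum>k=0..n. c1_tilde (n - k) * (\<Sum>l=0..k. \<Sum>i=0..l.
       ((real l - real k - 1/2) gchoose (l - i)) * (3/2) ^ l * c2 (k - l) * ((fact (2 * r + l) * (chord_fps ^ (2 * r)) $ i) * Q)))"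
      unfolding airy_moment_nth by (simp only: sum_distrib_right mult.assoc)
    finally show ?thesis by (simp only: s)
  qed
  thus ?thesis by (simp only:) (intro sums_sum sums_mult S_coeff_sums)
qed

context standard_brownian_motion
begin

text \<open>The sign of the explicit formula is not apparent from its coefficients; nonnegativity
  comes from a series of nonnegative terms, and it allows the return from \<open>ennreal\<close> to
  the reals.\<close>

lemma abs_area_moment:
  assumes t: "t > 0"
  shows "\<exists>V\<ge>0. (\<integral>\<^sup>+\<omega>. ennreal (abs_area \<nu> t \<omega> ^ n) \<partial>M) = ennreal V \<and>
    V = (-1) ^ n * t powr (3 * real n / 2) * fact n * exp (- (\<nu>\<^sup>2 * t / 2)) / sqrt (2 ^ n) *
      (\<Sum>k=0..n. c1_tilde (n - k) * (\<Sum>l=0..k. \<Sum>i=0..l.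
       ((real l - real k - 1/2) gchoose (l - i)) * (3/2) ^ l * c2 (k - l) * Re (Sigma_coeff n l i (\<nu>\<^sup>2 * t / 2))))"
proof -
  define x where "x = \<nu>\<^sup>2 * t / 2"
  define T where "T = (\<Sum>k=0..n. c1_tilde (n - k) * (\<Sum>l=0..k. \<Sum>i=0..l.
       ((real l - real k - 1/2) gchoose (l - i)) * (3/2) ^ l * c2 (k - l) * Re (Sigma_coeff n l i x)))"
  define a where "a r = 3 * real n / 2 + real r" for r
  define C where "C = (-1) ^ n * t powr (3 * real n / 2) / sqrt (2 ^ n)"
  define f where "f r = \<nu> ^ (2 * r) / fact (2 * r) * t powr a r * (exp_moment (2 * r) (kernel_poly n) / (2 powr a r * Gamma (a r + 1)))" for r
  have L0: "exp_moment (2 * r) (kernel_poly n) \<ge> 0" for r using nonneg_kernel_poly[of n] unfolding exp_moment_def by (intro sum_nonneg) (auto simp: nonneg_poly_def)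
  have G0: "Gamma (a r + 1) > 0" for r by (intro Gamma_real_pos) (simp add: a_def add_pos_nonneg)
  have f0: "f r \<ge> 0" for r
    unfolding f_def using L0 G0[of r] by (simp add: power_mult)
  have f_eq: "f r = C * (x ^ r * airy_moment (2 * r) $ n / (fact (2 * r) * Gamma (3 * real n / 2 + real r + 1)))" for r
  proof -
    \<comment> \<open>Balance of the powers of two: (-2)^n over 2^(3n/2) leaves (-1)^n / sqrt (2^n),
      and 2^r turns \<nu>^(2r) t^r into x^r.\<close>
    have 1: "2 powr a r = 2 ^ n * sqrt (2 ^ n) * 2 ^ r"
    proof -
      have "2 powr a r = 2 powr (real n + real n / 2 + real r)" by (simp add: a_def field_simps)
      also have "\<dots> = 2 ^ n * 2 powr (real n / 2) * 2 ^ r" unfolding powr_add by (simp add: powr_realpow)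
      also have "2 powr (real n / 2) = sqrt (2 ^ n)"
        by (simp add: powr_half_sqrt[symmetric] powr_realpow[symmetric] powr_powr)
      finally show ?thesis .
    qed
    have 2: "t powr a r = t powr (3 * real n / 2) * t ^ r" using t by (simp add: a_def powr_add powr_realpow)
    have 3: "x ^ r = \<nu> ^ (2 * r) * t ^ r / 2 ^ r" by (simp add: x_def power_mult_distrib power_divide power_mult)
    have 4: "exp_moment (2 * r) (kernel_poly n) = (-1) ^ n * 2 ^ n * airy_moment (2 * r) $ n"
      unfolding exp_moment_kernel_poly by (simp add: power_minus[of 2])
    show ?thesis
      unfolding f_def 1 2 3 4 C_def by (simp add: a_def mult_ac)
  qed
  have "f sums (C * T)" unfolding f_eq T_def by (intro sums_mult airy_moment_sums)
  hence "(\<Sum>r. ennreal (f r)) = ennreal (C * T)" by (rule suminf_ennreal_eq[OF f0])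
  moreover have CT: "C * T \<ge> 0" using sums_le[OF _ sums_zero \<open>f sums (C * T)\<close>] f0 by auto
  moreover have "(\<integral>\<^sup>+\<omega>. ennreal (abs_area \<nu> t \<omega> ^ n) \<partial>M) = ennreal (fact n) * (ennreal (exp (- x)) * (\<Sum>r. ennreal (f r)))"
  proof -
    have "(\<integral>\<^sup>+\<omega>. ennreal (abs_area \<nu> t \<omega> ^ n) \<partial>M) = (\<integral>\<^sup>+\<omega>. ennreal (abs_area \<nu> t \<omega> ^ n) * (\<lambda>_. 1) (drift_path \<nu> t \<omega>) \<partial>M)" by simp
    also have "\<dots> = ennreal (fact n) * (\<integral>\<^sup>+y. area_density n t y * ennreal (exp (\<nu> * y - \<nu>\<^sup>2 * t / 2)) * 1 \<partial>lborel)"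
      by (rule abs_area_power_density[OF t]) simp
    also have "(\<integral>\<^sup>+y. area_density n t y * ennreal (exp (\<nu> * y - \<nu>\<^sup>2 * t / 2)) * 1 \<partial>lborel)
       = (\<integral>\<^sup>+y. ennreal (exp (- x)) * (area_density n t y * ennreal (exp (\<nu> * y))) \<partial>lborel)"
    proof (intro nn_integral_cong)
      fix y
      have "exp (\<nu> * y - \<nu>\<^sup>2 * t / 2) = exp (- x) * exp (\<nu> * y)" by (simp add: x_def exp_add[symmetric])
      thus "area_density n t y * ennreal (exp (\<nu> * y - \<nu>\<^sup>2 * t / 2)) * 1 = ennreal (exp (- x)) * (area_density n t y * ennreal (exp (\<nu> * y)))"
        by (simp add: ennreal_mult' mult.left_commute)
    qed
    also have "\<dots> = ennreal (exp (- x)) * (\<integral>\<^sup>+y. area_density n t y * ennreal (exp (\<nu> * y)) \<partial>lborel)"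
      by (rule nn_integral_cmult) measurable
    also have "(\<integral>\<^sup>+y. area_density n t y * ennreal (exp (\<nu> * y)) \<partial>lborel) = (\<Sum>r. ennreal (f r))"
      unfolding area_density_exp_integral[OF t] area_moment_eq a_def[symmetric]
    proof (rule suminf_cong)
      fix r
      show "ennreal (\<nu> ^ (2 * r) / fact (2 * r) * t powr a r) * ennreal (exp_moment (2 * r) (kernel_poly n) / (2 powr a r * Gamma (a r + 1))) = ennreal (f r)"
        unfolding f_def using L0[of r] G0[of r] by (intro ennreal_mult''[symmetric]) simp
    qed
    finally show ?thesis .
  qed
  ultimately have "(\<integral>\<^sup>+\<omega>. ennreal (abs_area \<nu> t \<omega> ^ n) \<partial>M) = ennreal (fact n * (exp (- x) * (C * T)))"
    by (simp add: ennreal_mult')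
  moreover have "fact n * (exp (- x) * (C * T)) \<ge> 0" using CT by simp
  moreover have "fact n * (exp (- x) * (C * T)) = (-1) ^ n * t powr (3 * real n / 2) * fact n * exp (- x) / sqrt (2 ^ n) * T"
    by (simp add: C_def)
  ultimately show ?thesis unfolding x_def T_def by blast
qed

end

theorem theorem4:
  fixes M :: "'a measure" and W :: "real \<Rightarrow> 'a \<Rightarrow> real"
    and \<mu> \<sigma> t :: real and n :: nat
  assumes "standard_brownian_motion M W"
    and "\<mu> \<noteq> 0" and "\<sigma> > 0" and "t > 0"
  shows "integrable M (\<lambda>\<omega>. abs_drift_integral W \<mu> \<sigma> t \<omega> ^ n)
    \<and> complex_of_real (\<integral>\<omega>. abs_drift_integral W \<mu> \<sigma> t \<omega> ^ n \<partial>M) =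
      complex_of_real ((-1) ^ n * \<sigma> ^ n * t powr (3 * real n / 2) * fact n
                         * exp (- (\<mu>\<^sup>2 * t / (2 * \<sigma>\<^sup>2))) / sqrt (2 ^ n))
      * (\<Sum>k=0..n. complex_of_real (c1_tilde (n - k)) *
          (\<Sum>l=0..k. \<Sum>i=0..l.
             complex_of_real (((real l - real k - 1/2) gchoose (l - i)) * (3/2) ^ l * c2 (k - l))
             * Sigma_coeff n l i (\<mu>\<^sup>2 * t / (2 * \<sigma>\<^sup>2))))"
proof -
  interpret standard_brownian_motion M W by fact
  \<comment> \<open>Reduction to unit volatility: the area for drift \<mu>/\<sigma> is multiplied by
    \<sigma>, which contributes \<sigma>^n to the moment.\<close>
  define \<nu> where "\<nu> = \<mu> / \<sigma>"
  have x: "\<mu>\<^sup>2 * t / (2 * \<sigma>\<^sup>2) = \<nu>\<^sup>2 * t / 2" by (simp add: \<nu>_def power_divide)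
  let ?X = "abs_drift_integral W \<mu> \<sigma> t"
  let ?T = "\<Sum>k=0..n. c1_tilde (n - k) * (\<Sum>l=0..k. \<Sum>i=0..l.
       ((real l - real k - 1/2) gchoose (l - i)) * (3/2) ^ l * c2 (k - l) * Re (Sigma_coeff n l i (\<nu>\<^sup>2 * t / 2)))"
  obtain V where V: "V \<ge> 0" "(\<integral>\<^sup>+\<omega>. ennreal (abs_area \<nu> t \<omega> ^ n) \<partial>M) = ennreal V"
    "V = (-1) ^ n * t powr (3 * real n / 2) * fact n * exp (- (\<nu>\<^sup>2 * t / 2)) / sqrt (2 ^ n) * ?T"
    using abs_area_moment[OF \<open>t > 0\<close>] by blast
  have [measurable]: "?X \<in> borel_measurable M"
    unfolding abs_drift_integral_def[abs_def] using \<open>t > 0\<close>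
    by (intro borel_measurable_integral_continuous borel_measurable_abs borel_measurable_add borel_measurable_times
        borel_measurable_const random_variable continuous_intros continuous_on_subset[OF continuous_paths]) auto
  have [measurable]: "abs_area \<nu> t \<in> borel_measurable M" using \<open>t > 0\<close> by (intro measurable_abs_area) auto
  have nonneg: "?X \<omega> \<ge> 0" if "\<omega> \<in> space M" for \<omega>
    unfolding abs_drift_integral_def using that
    by (intro integral_nonneg integrable_continuous_real continuous_intros continuous_on_subset[OF continuous_paths]) auto
  \<comment> \<open>The given paths start at \<open>W 0\<close>, so the identity holds only outside
    the null event that \<open>W 0\<close> differs from 0.\<close>
  have XA: "AE \<omega> in M. ?X \<omega> = \<sigma> * abs_area \<nu> t \<omega>"
    using start_zero
  proof eventually_elim
    case (elim \<omega>)
    have "\<bar>\<mu> * s + \<sigma> * W s \<omega>\<bar> = \<sigma> * \<bar>drift_path \<nu> s \<omega>\<bar>" for s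
    proof -
      have "\<mu> * s + \<sigma> * W s \<omega> = \<sigma> * drift_path \<nu> s \<omega>" using \<open>\<sigma> > 0\<close> elim by (simp add: drift_path_def \<nu>_def algebra_simps)
      thus ?thesis using \<open>\<sigma> > 0\<close> by (simp add: abs_mult)
    qed
    thus ?case by (simp add: abs_drift_integral_def abs_area_def)
  qed
  have "(\<integral>\<^sup>+\<omega>. ennreal (?X \<omega> ^ n) \<partial>M) = (\<integral>\<^sup>+\<omega>. ennreal (\<sigma> ^ n) * ennreal (abs_area \<nu> t \<omega> ^ n) \<partial>M)"
  proof (rule nn_integral_cong_AE)
    show "AE \<omega> in M. ennreal (?X \<omega> ^ n) = ennreal (\<sigma> ^ n) * ennreal (abs_area \<nu> t \<omega> ^ n)"
      using XA by eventually_elim (use \<open>\<sigma> > 0\<close> in \<open>simp add: power_mult_distrib ennreal_mult'\<close>)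
  qed
  also have "\<dots> = ennreal (\<sigma> ^ n) * ennreal V" by (subst nn_integral_cmult) (auto simp: V(2))
  also have "\<dots> = ennreal (\<sigma> ^ n * V)" using \<open>\<sigma> > 0\<close> by (simp add: ennreal_mult')
  finally have "has_bochner_integral M (\<lambda>\<omega>. ?X \<omega> ^ n) (\<sigma> ^ n * V)"
    using V(1) \<open>\<sigma> > 0\<close> nonneg by (intro has_bochner_integral_nn_integral) auto
  hence int: "integrable M (\<lambda>\<omega>. ?X \<omega> ^ n)" and eq: "(\<integral>\<omega>. ?X \<omega> ^ n \<partial>M) = \<sigma> ^ n * V"
    by (auto simp: has_bochner_integral_iff)
  have T: "(\<Sum>k=0..n. complex_of_real (c1_tilde (n - k)) *
          (\<Sum>l=0..k. \<Sum>i=0..l.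
             complex_of_real (((real l - real k - 1/2) gchoose (l - i)) * (3/2) ^ l * c2 (k - l))
             * Sigma_coeff n l i (\<nu>\<^sup>2 * t / 2))) = complex_of_real ?T"
    by (subst Sigma_coeff_real) (simp only: of_real_sum of_real_mult)
  show ?thesis
    unfolding x T of_real_mult[symmetric] of_real_eq_iff eq V(3) using int by (simp add: mult_ac)
qed

end
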